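(* Let $P:\mathcal{M}(\mathbb{C})^N\to\mathcal{M}(\mathbb{C})^N$ be a free polynomial map. If $P$ is injective, then $P$ is surjective, and for every $n\ge 1$ the restriction $P^{-1}|_{\mathcal{M}_n(\mathbb{C})^N}$ agrees with (the evaluation on $\mathcal{M}_n(\mathbb{C})^N$ of) some free polynomial map (which may depend on $n$).
   Context: $\mathcal{M}_n(\mathbb{C})$ denotes the $n\times n$ complex matrices and $\mathcal{M}(\mathbb{C})^N=\bigcup_{n\ge1}\mathcal{M}_n(\mathbb{C})^N$. A free polynomial map $P=(p_1,\dots,p_N)$ is an $N$-tuple of noncommutative polynomials in $N$ variables with complex coefficients, evaluated on $X=(X_1,\dots,X_N)\in\mathcal{M}_n(\mathbb{C})^N$ by substituting $X_i$ for the $i$-th variable (constants $c$ becoming $cI_n$); it maps $\mathcal{M}_n(\mathbb{C})^N$ to itself. *)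

theory Defs
  imports Complex_Main "Jordan_Normal_Form.Matrix"
begin

text \<open>Noncommutative (free) polynomials with complex coefficients, as syntax trees
  over the variables x_0, x_1, ...  Every element of the free algebra is represented.\<close>
datatype fpoly = FConst complex | FVar nat | FAdd fpoly fpoly | FMul fpoly fpoly

fun fvars :: "fpoly \<Rightarrow> nat set" where
  "fvars (FConst c) = {}"
| "fvars (FVar i) = {i}"
| "fvars (FAdd p q) = fvars p \<union> fvars q"
| "fvars (FMul p q) = fvars p \<union> fvars q"

fun feval :: "nat \<Rightarrow> complex mat list \<Rightarrow> fpoly \<Rightarrow> complex mat" where
  "feval n X (FConst c) = c \<cdot>\<^sub>m 1\<^sub>m n"
| "feval n X (FVar i) = X ! i"
| "feval n X (FAdd p q) = feval n X p + feval n X q"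
| "feval n X (FMul p q) = feval n X p * feval n X q"

definition mat_tuples :: "nat \<Rightarrow> nat \<Rightarrow> complex mat list set" where
  "mat_tuples n N = {X. length X = N \<and> (\<forall>i<N. X ! i \<in> carrier_mat n n)}"

definition free_poly_map :: "nat \<Rightarrow> fpoly list \<Rightarrow> bool" where
  "free_poly_map N P \<longleftrightarrow> length P = N \<and> (\<forall>p\<in>set P. fvars p \<subseteq> {..<N})"

definition fmap_eval :: "nat \<Rightarrow> fpoly list \<Rightarrow> complex mat list \<Rightarrow> complex mat list" where
  "fmap_eval n P X = map (feval n X) P"

end

theory Submission
  imports Defs "Jordan_Normal_Form.Determinant" "HOL-Computational_Algebra.Computational_Algebra"
    "HOL-Analysis.Continuum_Not_Denumerable"
begin

text \<open>Evaluating \<open>P\<close> at block upper triangular matrices shows that the difference quotient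
  \<open>\<Delta>P(X, Y)\<close>, with \<open>P(X) - P(Y) = \<Delta>P(X, Y)[X - Y]\<close>, is injective for all \<open>X\<close>, \<open>Y\<close> of size \<open>n\<close>.
  Its determinant is a polynomial without zeros, hence constant, so \<open>X - Y = \<Gamma>(X, Y)[P(X) - P(Y)]\<close>
  with \<open>\<Gamma>\<close> polynomial in the entries. This is a certificate of injectivity.

  First, comparing coefficients in \<open>Y\<close> for a generic \<open>X\<close> gives a linear system over the field generated
  by the entries of \<open>P(X)\<close>, so each entry of \<open>X\<close> is a rational function \<open>b/a\<close> of those of \<open>P(X)\<close>.
  Second, by the certificate \<open>P\<close> is injective modulo an ideal of finite index in a finitely generated
  ring of coefficients, and hence surjective, so that \<open>b\<close> lies in the ideal generated by \<open>a\<close> modulo every such ideal;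
  finitely generated rings being residually finite, \<open>a\<close> divides \<open>b\<close> along every line, and \<open>P\<close> has a
  polynomial left inverse \<open>G\<close> on matrices of size \<open>n\<close>. Third, the linear part of \<open>P\<close> at \<open>0\<close>, a special
  case of \<open>\<Delta>P\<close>, is invertible, so the Newton iteration produces free polynomials \<open>Z\<^sub>k\<close> with
  \<open>P(Z\<^sub>k(P(0) + tV)) = P(0) + tV\<close> modulo \<open>t\<^sup>k\<^sup>+\<^sup>1\<close>. These agree with \<open>G\<close> to the same order; therefore
  \<open>P \<circ> G\<close> is the identity, and the homogeneous components of some \<open>Z\<^sub>k\<close> up to the degree of \<open>G\<close> add up to \<open>G\<close>.\<close>

section \<open>Polynomial functions\<close>

text \<open>The Newton iteration alone yields a formal power series in the free variables, and
  nothing in the free algebra makes it stop. What stops it is the degree of an inverse that is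
  polynomial in the entries, found for one matrix size at a time; this is why the free inverse may
  depend on \<open>n\<close>. Size \<open>n\<close> is controlled by injectivity at size
  \<open>n + n\<close>, the size of the block matrices. The detour through a certificate is needed
  because injectivity over the complex numbers says nothing modulo an ideal, whereas a polynomial
  identity survives reduction. All rings are subsets of the complex numbers, quotients are expressed
  by congruences, and indeterminates are replaced by sufficiently generic numbers.\<close>

definition csubring :: "complex set \<Rightarrow> bool" where
  "csubring A \<longleftrightarrow> 1 \<in> A \<and> (\<forall>x\<in>A. \<forall>y\<in>A. x - y \<in> A \<and> x * y \<in> A)"

text \<open>Ideals need not be proper; properness is asked for separately as
  \<open>1 \<notin> I\<close>.\<close>

definition cideal :: "complex set \<Rightarrow> complex set \<Rightarrow> bool" where
  "cideal A I \<longleftrightarrow> I \<subseteq> A \<and> 0 \<in> I \<and> (\<forall>x\<in>I. \<forall>y\<in>I. x - y \<in> I) \<and> (\<forall>a\<in>A. \<forall>x\<in>I. a * x \<in> I)"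

lemma csubringD:
  assumes "csubring A"
  shows "1 \<in> A" "0 \<in> A" "\<And>x. x \<in> A \<Longrightarrow> - x \<in> A" "\<And>x y. x \<in> A \<Longrightarrow> y \<in> A \<Longrightarrow> x - y \<in> A"
    "\<And>x y. x \<in> A \<Longrightarrow> y \<in> A \<Longrightarrow> x + y \<in> A" "\<And>x y. x \<in> A \<Longrightarrow> y \<in> A \<Longrightarrow> x * y \<in> A"
    "\<And>x k. x \<in> A \<Longrightarrow> x ^ k \<in> A"
proof -
  have A: "1 \<in> A" "\<And>x y. x \<in> A \<Longrightarrow> y \<in> A \<Longrightarrow> x - y \<in> A" "\<And>x y. x \<in> A \<Longrightarrow> y \<in> A \<Longrightarrow> x * y \<in> A"
    using assms by (auto simp: csubring_def)
  have z: "0 \<in> A" using A(2)[OF A(1) A(1)] by simp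
  have m: "- x \<in> A" if "x \<in> A" for x using A(2)[OF z that] by simp
  show "1 \<in> A" "0 \<in> A" "\<And>x. x \<in> A \<Longrightarrow> - x \<in> A" "\<And>x y. x \<in> A \<Longrightarrow> y \<in> A \<Longrightarrow> x - y \<in> A"
    "\<And>x y. x \<in> A \<Longrightarrow> y \<in> A \<Longrightarrow> x * y \<in> A" using A z m by auto
  show "x + y \<in> A" if "x \<in> A" "y \<in> A" for x y using A(2)[OF that(1) m[OF that(2)]] by simp
  show "x ^ k \<in> A" if "x \<in> A" for x k by (induction k) (use A that in auto)
qed

lemma csubring_sum: "csubring A \<Longrightarrow> (\<And>i. i \<in> S \<Longrightarrow> f i \<in> A) \<Longrightarrow> sum f S \<in> A"
  by (induction S rule: infinite_finite_induct) (auto intro: csubringD)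

lemma cidealD:
  assumes "cideal A I"
  shows "I \<subseteq> A" "0 \<in> I" "\<And>x. x \<in> I \<Longrightarrow> - x \<in> I" "\<And>x y. x \<in> I \<Longrightarrow> y \<in> I \<Longrightarrow> x - y \<in> I"
    "\<And>x y. x \<in> I \<Longrightarrow> y \<in> I \<Longrightarrow> x + y \<in> I" "\<And>a x. a \<in> A \<Longrightarrow> x \<in> I \<Longrightarrow> a * x \<in> I"
    "\<And>a x. a \<in> A \<Longrightarrow> x \<in> I \<Longrightarrow> x * a \<in> I"
proof -
  have A: "I \<subseteq> A" "0 \<in> I" "\<And>x y. x \<in> I \<Longrightarrow> y \<in> I \<Longrightarrow> x - y \<in> I" "\<And>a x. a \<in> A \<Longrightarrow> x \<in> I \<Longrightarrow> a * x \<in> I"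
    using assms by (auto simp: cideal_def)
  have m: "- x \<in> I" if "x \<in> I" for x using A(3)[OF A(2) that] by simp
  show "I \<subseteq> A" "0 \<in> I" "\<And>x. x \<in> I \<Longrightarrow> - x \<in> I" "\<And>x y. x \<in> I \<Longrightarrow> y \<in> I \<Longrightarrow> x - y \<in> I"
    "\<And>a x. a \<in> A \<Longrightarrow> x \<in> I \<Longrightarrow> a * x \<in> I" using A m by auto
  show "x + y \<in> I" if "x \<in> I" "y \<in> I" for x y using A(3)[OF that(1) m[OF that(2)]] by simp
  show "x * a \<in> I" if "a \<in> A" "x \<in> I" for a x using A(4)[OF that] by (simp add: mult.commute)
qed

lemma cideal_sum: "cideal A I \<Longrightarrow> (\<And>i. i \<in> S \<Longrightarrow> f i \<in> I) \<Longrightarrow> sum f S \<in> I"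
  by (induction S rule: infinite_finite_induct) (auto intro: cidealD)

text \<open>Functions instead of formal polynomials: the complex field is infinite, so nothing is
  lost. Points are infinite sequences of which only the first \<open>M\<close> entries are read.
  \<open>A\<close> is any set of constants, not necessarily a ring, so that a finite or countable
  set can record the constants in use.\<close>

inductive_set polyfun :: "complex set \<Rightarrow> nat \<Rightarrow> ((nat \<Rightarrow> complex) \<Rightarrow> complex) set"
  for A :: "complex set" and M :: nat where
  const: "c \<in> A \<Longrightarrow> (\<lambda>_. c) \<in> polyfun A M"
| var: "k < M \<Longrightarrow> (\<lambda>z. z k) \<in> polyfun A M"
| add: "f \<in> polyfun A M \<Longrightarrow> g \<in> polyfun A M \<Longrightarrow> (\<lambda>z. f z + g z) \<in> polyfun A M"
| mult: "f \<in> polyfun A M \<Longrightarrow> g \<in> polyfun A M \<Longrightarrow> (\<lambda>z. f z * g z) \<in> polyfun A M"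

lemma polyfun_mono:
  assumes "f \<in> polyfun A M" "A \<subseteq> B" "M \<le> M'"
  shows "f \<in> polyfun B M'"
  using assms(1) by induction (use assms(2,3) in \<open>auto intro: polyfun.intros\<close>)

lemma polyfun_sum:
  assumes "0 \<in> A" "\<And>i. i \<in> S \<Longrightarrow> f i \<in> polyfun A M"
  shows "(\<lambda>z. \<Sum>i\<in>S. f i z) \<in> polyfun A M"
  using assms(2) by (induction S rule: infinite_finite_induct) (auto intro: polyfun.intros assms(1))

lemma polyfun_prod:
  assumes "1 \<in> A" "\<And>i. i \<in> S \<Longrightarrow> f i \<in> polyfun A M"
  shows "(\<lambda>z. \<Prod>i\<in>S. f i z) \<in> polyfun A M"
  using assms(2) by (induction S rule: infinite_finite_induct) (auto intro: polyfun.intros assms(1))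

lemma polyfun_diff:
  assumes "-1 \<in> A" "f \<in> polyfun A M" "g \<in> polyfun A M"
  shows "(\<lambda>z. f z - g z) \<in> polyfun A M"
proof -
  have "(\<lambda>z. f z + (-1) * g z) \<in> polyfun A M"
    by (intro polyfun.intros assms)
  thus ?thesis by simp
qed

lemma polyfun_comp:
  assumes "f \<in> polyfun A M" "\<And>k. k < M \<Longrightarrow> g k \<in> polyfun A M'"
  shows "(\<lambda>z. f (\<lambda>k. g k z)) \<in> polyfun A M'"
  using assms(1) by induction (use assms(2) in \<open>auto intro: polyfun.intros\<close>)

lemma polyfun_cong:
  assumes "f \<in> polyfun A M" "\<And>k. k < M \<Longrightarrow> z k = w k"
  shows "f z = f w"
  using assms(1) by induction (use assms(2) in auto)

text \<open>A derivation mentions finitely many constants. This is what moves arguments from the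
  complex field to countable or finitely generated rings.\<close>

lemma polyfun_finite_coeffs:
  assumes "f \<in> polyfun A M"
  shows "\<exists>C. finite C \<and> C \<subseteq> A \<and> f \<in> polyfun C M"
  using assms
proof induction
  case (const c)
  thus ?case by (intro exI[of _ "{c}"]) (auto intro: polyfun.intros)
next
  case (var k)
  thus ?case by (intro exI[of _ "{}"]) (auto intro: polyfun.intros)
next
  case (add f g)
  then obtain C D where "finite C" "C \<subseteq> A" "f \<in> polyfun C M" "finite D" "D \<subseteq> A" "g \<in> polyfun D M" by blast
  thus ?case by (intro exI[of _ "C \<union> D"]) (auto intro!: polyfun.add intro: polyfun_mono)
next
  case (mult f g)
  then obtain C D where "finite C" "C \<subseteq> A" "f \<in> polyfun C M" "finite D" "D \<subseteq> A" "g \<in> polyfun D M" by blast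
  thus ?case by (intro exI[of _ "C \<union> D"]) (auto intro!: polyfun.mult intro: polyfun_mono)
qed

lemma polyfun_finite_coeffs_family:
  assumes "finite I" "\<And>i. i \<in> I \<Longrightarrow> f i \<in> polyfun A M"
  shows "\<exists>C. finite C \<and> C \<subseteq> A \<and> (\<forall>i\<in>I. f i \<in> polyfun C M)"
proof -
  have "\<forall>i\<in>I. \<exists>C. finite C \<and> C \<subseteq> A \<and> f i \<in> polyfun C M"
    using assms(2) polyfun_finite_coeffs by blast
  then obtain C where C: "\<forall>i\<in>I. finite (C i) \<and> C i \<subseteq> A \<and> f i \<in> polyfun (C i) M" by metis
  show ?thesis
    by (intro exI[of _ "\<Union>i\<in>I. C i"]) (use C assms(1) in \<open>auto intro: polyfun_mono\<close>)
qed

lemma polyfun_in_csubring: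
  assumes "f \<in> polyfun A M" "csubring A" "\<And>k. k < M \<Longrightarrow> z k \<in> A"
  shows "f z \<in> A"
  using assms(1) by induction (use assms(2,3) in \<open>auto intro: csubringD\<close>)

lemma polyfun_cong_mod:
  assumes "f \<in> polyfun A M" "csubring A" "cideal A I"
    "\<And>k. k < M \<Longrightarrow> z k \<in> A" "\<And>k. k < M \<Longrightarrow> w k \<in> A" "\<And>k. k < M \<Longrightarrow> z k - w k \<in> I"
  shows "f z - f w \<in> I"
  using assms(1)
proof induction
  case (const c)
  thus ?case using cidealD[OF assms(3)] by simp
next
  case (var k)
  thus ?case using assms by simp
next
  case (add f g)
  have "(f z - f w) + (g z - g w) \<in> I" by (intro cidealD[OF assms(3)] add.IH)
  thus ?case by (simp add: algebra_simps)
next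
  case (mult f g)
  have "f z \<in> A" "g w \<in> A" using mult.hyps polyfun_in_csubring assms by blast+
  hence "f z * (g z - g w) + g w * (f z - f w) \<in> I" by (intro cidealD[OF assms(3)] mult.IH)
  thus ?case by (simp add: algebra_simps)
qed

lemma countable_polyfun:
  assumes "countable A"
  shows "countable (polyfun A M)"
proof -
  define S where "S = rec_nat ((\<lambda>c (_::nat\<Rightarrow>complex). c) ` A \<union> (\<lambda>k z. z k) ` {..<M})
     (\<lambda>_ T. T \<union> (\<lambda>(f, g) z. f z + g z) ` (T \<times> T) \<union> (\<lambda>(f, g) z. f z * g z) ` (T \<times> T))"
  have S0: "S 0 = (\<lambda>c (_::nat\<Rightarrow>complex). c) ` A \<union> (\<lambda>k z. z k) ` {..<M}"
    by (simp add: S_def)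
  have SS: "S (Suc j) = S j \<union> (\<lambda>(f, g) z. f z + g z) ` (S j \<times> S j) \<union> (\<lambda>(f, g) z. f z * g z) ` (S j \<times> S j)" for j
    by (simp add: S_def)
  have c: "countable (S j)" for j
    by (induction j) (auto simp: S0 SS assms intro!: countable_image)
  have "mono S" by (rule incseq_SucI) (auto simp: SS)
  hence mono: "S i \<subseteq> S (max i j)" "S j \<subseteq> S (max i j)" for i j by (auto simp: mono_def)
  have "\<exists>j. f \<in> S j" if "f \<in> polyfun A M" for f
    using that
  proof induction
    case (add f g)
    then obtain i j where "f \<in> S (max i j)" "g \<in> S (max i j)" using mono by blast
    hence "(\<lambda>z. f z + g z) \<in> S (Suc (max i j))" unfolding SS by force
    thus ?case by blast
  next
    case (mult f g)
    then obtain i j where "f \<in> S (max i j)" "g \<in> S (max i j)" using mono by blast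
    hence "(\<lambda>z. f z * g z) \<in> S (Suc (max i j))" unfolding SS by force
    thus ?case by blast
  qed (rule exI[of _ 0], force simp: S0)+
  hence "polyfun A M \<subseteq> (\<Union>j. S j)" by blast
  thus ?thesis using c by (meson countable_UN countable_subset countableI_type)
qed

text \<open>The bound \<open>D\<close> is uniform in the direction \<open>V\<close>, and the
  coefficients are polynomial in \<open>V\<close>; both are needed to reassemble a polynomial
  function from its restrictions to the lines through \<open>y\<close>.\<close>

lemma polyfun_along_line:
  assumes "f \<in> polyfun A M"
  shows "\<exists>P D. (\<forall>V. degree (P V) \<le> D) \<and> (\<forall>j. (\<lambda>V. coeff (P V) j) \<in> polyfun UNIV M)
    \<and> (\<forall>V t. f (\<lambda>k. y k + t * V k) = poly (P V) t)"
  using assms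
proof induction
  case (const c)
  show ?case
    by (rule exI[of _ "\<lambda>_. [:c:]"], rule exI[of _ 0]) (auto intro: polyfun.intros)
next
  case (var k)
  have "(\<lambda>V. coeff [:y k, V k:] j) \<in> polyfun UNIV M" for j
    using var by (cases j; cases "j - 1") (auto simp: coeff_pCons intro: polyfun.intros)
  thus ?case
    by (intro exI[of _ "\<lambda>V. [:y k, V k:]"] exI[of _ 1]) auto
next
  case (add f g)
  then obtain P D Q E where *:
    "\<And>V. degree (P V) \<le> D" "\<And>j. (\<lambda>V. coeff (P V) j) \<in> polyfun UNIV M" "\<And>V t. f (\<lambda>k. y k + t * V k) = poly (P V) t"
    "\<And>V. degree (Q V) \<le> E" "\<And>j. (\<lambda>V. coeff (Q V) j) \<in> polyfun UNIV M" "\<And>V t. g (\<lambda>k. y k + t * V k) = poly (Q V) t"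
    by metis
  have "degree (P V + Q V) \<le> max D E" for V
    by (rule degree_add_le) (use *(1,4)[of V] in auto)
  moreover have "(\<lambda>V. coeff (P V + Q V) j) \<in> polyfun UNIV M" for j
    by (auto intro: polyfun.intros *)
  ultimately show ?case using *(3,6)
    by (intro exI[of _ "\<lambda>V. P V + Q V"] exI[of _ "max D E"]) auto
next
  case (mult f g)
  then obtain P D Q E where *:
    "\<And>V. degree (P V) \<le> D" "\<And>j. (\<lambda>V. coeff (P V) j) \<in> polyfun UNIV M" "\<And>V t. f (\<lambda>k. y k + t * V k) = poly (P V) t"
    "\<And>V. degree (Q V) \<le> E" "\<And>j. (\<lambda>V. coeff (Q V) j) \<in> polyfun UNIV M" "\<And>V t. g (\<lambda>k. y k + t * V k) = poly (Q V) t"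
    by metis
  have "degree (P V * Q V) \<le> D + E" for V
    using degree_mult_le[of "P V" "Q V"] *(1,4)[of V] by linarith
  moreover have "(\<lambda>V. coeff (P V * Q V) j) \<in> polyfun UNIV M" for j
    unfolding coeff_mult by (intro polyfun_sum polyfun.intros *) auto
  ultimately show ?case using *(3,6)
    by (intro exI[of _ "\<lambda>V. P V * Q V"] exI[of _ "D + E"]) auto
qed

lemma polyfun_univariate:
  assumes "f \<in> polyfun A M"
  shows "\<exists>p. \<forall>t. f (\<lambda>k. y k + t * V k) = poly p t"
  using polyfun_along_line[OF assms] by metis

lemma polyfun_univariate_upd:
  assumes "f \<in> polyfun A M"
  shows "\<exists>p. \<forall>t. f (z(r := t)) = poly p t"
proof -
  obtain p where "\<forall>t. f (\<lambda>k. (z(r := 0)) k + t * (if k = r then 1 else 0)) = poly p t"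
    using polyfun_univariate[OF assms, of "z(r := 0)" "\<lambda>k. if k = r then 1 else 0"] by blast
  moreover have "(\<lambda>k. (z(r := 0)) k + t * (if k = r then 1 else 0)) = z(r := t)" for t
    by auto
  ultimately show ?thesis by auto
qed

text \<open>On the line through \<open>z\<close> and \<open>w\<close> both factors become univariate
  polynomials, and the first is not zero since the line meets \<open>w\<close> at
  \<open>t = 1\<close>. Univariate polynomials form a domain.\<close>

lemma polyfun_mult_eq_0:
  assumes "f \<in> polyfun A M" "g \<in> polyfun B M" "\<And>z. f z * g z = 0" "f w \<noteq> 0"
  shows "g z = 0"
proof -
  obtain p where p: "\<forall>t. f (\<lambda>k. z k + t * (w k - z k)) = poly p t"
    using polyfun_univariate[OF assms(1), of z "\<lambda>k. w k - z k"] by blast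
  obtain q where q: "\<forall>t. g (\<lambda>k. z k + t * (w k - z k)) = poly q t"
    using polyfun_univariate[OF assms(2), of z "\<lambda>k. w k - z k"] by blast
  have "poly (p * q) t = 0" for t using assms(3) p q by (metis poly_mult)
  hence "p * q = 0" using poly_all_0_iff_0 by blast
  moreover have "poly p 1 \<noteq> 0" using p[rule_format, of 1] assms(4) by simp
  ultimately have "q = 0" by auto
  thus ?thesis using q[rule_format, of 0] by simp
qed

text \<open>Coordinates are released from \<open>S\<close> one at a time, each time because a
  univariate polynomial with infinitely many roots is zero. Membership of \<open>0\<close> serves
  the coordinates beyond \<open>M\<close>, which are reset to it.\<close>

lemma polyfun_eq_0_infinite:
  assumes f: "f \<in> polyfun A M" and S: "infinite S" "0 \<in> S"
    and z: "\<And>z. (\<And>k. z k \<in> S) \<Longrightarrow> f z = 0"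
  shows "f z = 0"
proof -
  have *: "\<forall>z. (\<forall>k\<ge>r. z k \<in> S) \<longrightarrow> f z = 0" for r
  proof (induction r)
    case 0
    thus ?case using z by auto
  next
    case (Suc r)
    show ?case
    proof (intro allI impI)
      fix w assume w: "\<forall>k\<ge>Suc r. w k \<in> S"
      obtain p where p: "\<forall>t. f (w(r := t)) = poly p t" using polyfun_univariate_upd[OF f] by blast
      have "poly p t = 0" if "t \<in> S" for t
      proof -
        have "(w(r := t)) k \<in> S" if "k \<ge> r" for k
          using w \<open>t \<in> S\<close> that by (cases "k = r") auto
        hence "f (w(r := t)) = 0" using Suc by blast
        thus ?thesis using p by simp
      qed
      hence "infinite {t. poly p t = 0}" using S(1) by (metis (mono_tags, lifting) finite_subset mem_Collect_eq subsetI)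
      hence "p = 0" using poly_roots_finite by blast
      thus "f w = 0" using p[rule_format, of "w r"] by simp
    qed
  qed
  have "f z = f (\<lambda>k. if k < M then z k else 0)" by (rule polyfun_cong[OF f]) auto
  also have "\<dots> = 0" using * [of M] S(2) by simp
  finally show ?thesis .
qed

text \<open>The coordinates of \<open>x\<close> are chosen one by one. The invariant is that each
  nonzero \<open>f\<close> stays nonzero at its own witness \<open>Y f\<close> after the first
  \<open>r\<close> coordinates are overwritten by those of \<open>x\<close>. For the next coordinate
  each \<open>f\<close> forbids finitely many values, so countably many are forbidden in
  all.\<close>

lemma polyfun_generic_point:
  assumes "countable \<F>" "\<And>f. f \<in> \<F> \<Longrightarrow> f \<in> polyfun UNIV M"
  shows "\<exists>x. \<forall>f\<in>\<F>. f x = 0 \<longrightarrow> (\<forall>z. f z = 0)"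
proof -
  have "\<forall>f. \<exists>Y. f \<in> \<F> \<and> \<not> (\<forall>z. f z = 0) \<longrightarrow> f Y \<noteq> 0" by auto
  then obtain Y where Y: "\<And>f. f \<in> \<F> \<Longrightarrow> \<not> (\<forall>z. f z = 0) \<Longrightarrow> f (Y f) \<noteq> 0" by metis
  have "\<exists>x. \<forall>f\<in>\<F>. \<not> (\<forall>z. f z = 0) \<longrightarrow> f (\<lambda>k. if k < r then x k else Y f k) \<noteq> 0" for r
  proof (induction r)
    case 0
    thus ?case using Y by simp
  next
    case (Suc r)
    then obtain x where x: "\<And>f. f \<in> \<F> \<Longrightarrow> \<not> (\<forall>z. f z = 0) \<Longrightarrow> f (\<lambda>k. if k < r then x k else Y f k) \<noteq> 0"
      by blast
    define B where "B f = {t. f ((\<lambda>k. if k < r then x k else Y f k)(r := t)) = 0}" for f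
    have fin: "finite (B f)" if fF: "f \<in> \<F>" and nz: "\<not> (\<forall>z. f z = 0)" for f
    proof -
      let ?z = "\<lambda>k. if k < r then x k else Y f k"
      obtain p where p: "\<forall>t. f (?z(r := t)) = poly p t"
        using polyfun_univariate_upd[OF assms(2)[OF fF]] by blast
      have "poly p (Y f r) \<noteq> 0"
      proof -
        have "?z(r := Y f r) = ?z" by auto
        thus ?thesis using x[OF fF nz] p by metis
      qed
      hence "p \<noteq> 0" by auto
      thus ?thesis using p poly_roots_finite by (simp add: B_def)
    qed
    have "countable (\<Union>f\<in>{f\<in>\<F>. \<not> (\<forall>z. f z = 0)}. B f)"
      using assms(1) fin by (intro countable_UN) (auto intro: countable_finite countable_subset[of _ \<F>])
    moreover have "uncountable (UNIV :: complex set)" by (rule uncountable_UNIV_complex)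
    ultimately have "(\<Union>f\<in>{f\<in>\<F>. \<not> (\<forall>z. f z = 0)}. B f) \<noteq> UNIV" by metis
    then obtain t where t: "t \<notin> (\<Union>f\<in>{f\<in>\<F>. \<not> (\<forall>z. f z = 0)}. B f)" by blast
    have "f (\<lambda>k. if k < Suc r then (x(r := t)) k else Y f k) \<noteq> 0" if "f \<in> \<F>" "\<not> (\<forall>z. f z = 0)" for f
    proof -
      have "(\<lambda>k. if k < Suc r then (x(r := t)) k else Y f k) = (\<lambda>k. if k < r then x k else Y f k)(r := t)"
        by auto
      thus ?thesis using t that by (auto simp: B_def)
    qed
    thus ?case by blast
  qed
  then obtain x where x: "\<And>f. f \<in> \<F> \<Longrightarrow> \<not> (\<forall>z. f z = 0) \<Longrightarrow> f (\<lambda>k. if k < M then x k else Y f k) \<noteq> 0"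
    by blast
  have "f x \<noteq> 0" if "f \<in> \<F>" "\<not> (\<forall>z. f z = 0)" for f
    using x[OF that] polyfun_cong[OF assms(2)[OF that(1)], of x "\<lambda>k. if k < M then x k else Y f k"] by auto
  thus ?thesis by blast
qed

section \<open>Determinants and inverses of matrices of polynomial functions\<close>

lemma polyfun_det:
  assumes "\<And>z. A z \<in> carrier_mat n n" "\<And>i j. i < n \<Longrightarrow> j < n \<Longrightarrow> (\<lambda>z. A z $$ (i, j)) \<in> polyfun UNIV M"
  shows "(\<lambda>z. det (A z)) \<in> polyfun UNIV M"
proof -
  have "(\<lambda>z. det (A z)) = (\<lambda>z. \<Sum>p \<in> {p. p permutes {0..<n}}. signof p * (\<Prod>i = 0..<n. A z $$ (i, p i)))"
    using det_def'[OF assms(1)] by auto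
  also have "\<dots> \<in> polyfun UNIV M"
    by (intro polyfun_sum polyfun.mult polyfun.const polyfun_prod assms(2)) (auto simp: permutes_in_image)
  finally show ?thesis .
qed

text \<open>Along the line from \<open>w\<close> to \<open>z\<close> the function is a univariate
  polynomial without roots, so the fundamental theorem of algebra applies.\<close>

lemma polyfun_nonvanishing_const:
  assumes "f \<in> polyfun A M" "\<And>z. f z \<noteq> 0"
  shows "f z = f w"
proof -
  obtain p where p: "\<forall>t. f (\<lambda>k. w k + t * (z k - w k)) = poly p t"
    using polyfun_univariate[OF assms(1), of w "\<lambda>k. z k - w k"] by blast
  have "constant (poly p)"
    using fundamental_theorem_of_algebra[of p] assms(2) p by metis
  hence "poly p 1 = poly p 0" by (simp add: constant_def)
  thus ?thesis using p[rule_format, of 0] p[rule_format, of 1] by simp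
qed

text \<open>Cramer's rule: the inverse is the adjugate over the determinant. Injectivity at every
  \<open>z\<close> leaves the determinant without zeros, hence constant, so the quotient is again
  polynomial.\<close>

lemma polyfun_inverse_matrix:
  fixes d :: "nat \<Rightarrow> nat \<Rightarrow> (nat \<Rightarrow> complex) \<Rightarrow> complex"
  assumes d: "\<And>i j. i < m \<Longrightarrow> j < m \<Longrightarrow> d i j \<in> polyfun UNIV M"
    and inj: "\<And>z h. (\<And>i. i < m \<Longrightarrow> (\<Sum>j<m. d i j z * h j) = 0) \<Longrightarrow> (\<And>j. j < m \<Longrightarrow> h j = 0)"
  shows "\<exists>\<Gamma>. (\<forall>i<m. \<forall>j<m. \<Gamma> i j \<in> polyfun UNIV M) \<and>
    (\<forall>z. \<forall>i<m. \<forall>k<m. (\<Sum>j<m. \<Gamma> i j z * d j k z) = (if i = k then 1 else 0))"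
proof -
  define A where "A z = mat m m (\<lambda>(i, j). d i j z)" for z
  have A: "A z \<in> carrier_mat m m" for z by (simp add: A_def)
  have dA: "(\<lambda>z. det (A z)) \<in> polyfun UNIV M"
    by (rule polyfun_det[where n = m]) (auto simp: A_def d)
  have nz: "det (A z) \<noteq> 0" for z
  proof
    assume "det (A z) = 0"
    then obtain v where v: "v \<in> carrier_vec m" "v \<noteq> 0\<^sub>v m" "A z *\<^sub>v v = 0\<^sub>v m"
      using det_0_iff_vec_prod_zero_field[OF A] by blast
    have "(\<Sum>j<m. d i j z * v $ j) = 0" if "i < m" for i
    proof -
      have "(A z *\<^sub>v v) $ i = 0" using v(3) that by simp
      thus ?thesis using that v(1) by (auto simp: A_def scalar_prod_def lessThan_atLeast0)
    qed
    hence "\<And>j. j < m \<Longrightarrow> v $ j = 0" using inj by blast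
    hence "v = 0\<^sub>v m" using v(1) by (intro eq_vecI) auto
    thus False using v by simp
  qed
  define \<delta> where "\<delta> = det (A (\<lambda>_. 0))"
  have \<delta>: "det (A z) = \<delta>" "\<delta> \<noteq> 0" for z
    unfolding \<delta>_def using polyfun_nonvanishing_const[OF dA] nz by auto
  define \<Gamma> where "\<Gamma> i j z = inverse \<delta> * adj_mat (A z) $$ (i, j)" for i j z
  have adj: "adj_mat (A z) \<in> carrier_mat m m" "adj_mat (A z) * A z = det (A z) \<cdot>\<^sub>m 1\<^sub>m m" for z
    using adj_mat[OF A] by auto
  have "\<Gamma> i j \<in> polyfun UNIV M" if ij: "i < m" "j < m" for i j
  proof -
    have md: "mat_delete (A z) j i \<in> carrier_mat (m - 1) (m - 1)" for z
      using A by (rule mat_delete_carrier)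
    have "(\<lambda>z. det (mat_delete (A z) j i)) \<in> polyfun UNIV M"
    proof (rule polyfun_det[OF md])
      fix a b assume ab: "a < m - 1" "b < m - 1"
      have "mat_delete (A z) j i $$ (a, b) = d (if a < j then a else Suc a) (if b < i then b else Suc b) z" for z
        using ab ij by (auto simp: mat_delete_def A_def)
      thus "(\<lambda>z. mat_delete (A z) j i $$ (a, b)) \<in> polyfun UNIV M" using ab by (auto intro!: d)
    qed
    hence "(\<lambda>z. inverse \<delta> * ((- 1) ^ (j + i) * det (mat_delete (A z) j i))) \<in> polyfun UNIV M"
      by (intro polyfun.mult polyfun.const) auto
    moreover have "\<Gamma> i j = (\<lambda>z. inverse \<delta> * ((- 1) ^ (j + i) * det (mat_delete (A z) j i)))"
      using ij by (auto simp: \<Gamma>_def adj_mat_def cofactor_def A_def)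
    ultimately show ?thesis by simp
  qed
  moreover have "(\<Sum>j<m. \<Gamma> i j z * d j k z) = (if i = k then 1 else 0)" if ik: "i < m" "k < m" for i k z
  proof -
    have "(\<Sum>j<m. adj_mat (A z) $$ (i, j) * d j k z) = (adj_mat (A z) * A z) $$ (i, k)"
      using ik adj(1)[of z] A[of z] by (auto simp: A_def scalar_prod_def lessThan_atLeast0)
    also have "\<dots> = (if i = k then \<delta> else 0)" using adj(2) \<delta> ik by simp
    finally show ?thesis using \<delta>(2) by (simp add: \<Gamma>_def mult.assoc flip: sum_distrib_left)
  qed
  ultimately show ?thesis by blast
qed

section \<open>Rationality of the inverse\<close>

text \<open>The expansion isolates the scalars outside \<open>K\<close> as the numbers
  \<open>c\<close>, to which the descent to \<open>K\<close> can then be applied.\<close>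

lemma polyfun_scalar_expansion:
  assumes "g \<in> polyfun UNIV M" "{0, 1} \<subseteq> K"
  shows "\<exists>L. (\<forall>(c, q)\<in>set L. q \<in> polyfun K M) \<and> (\<forall>z. g z = (\<Sum>(c, q)\<leftarrow>L. c * q z))"
  using assms(1)
proof induction
  case (const c)
  thus ?case using assms(2) by (intro exI[of _ "[(c, \<lambda>_. 1)]"]) (auto intro: polyfun.intros)
next
  case (var k)
  thus ?case by (intro exI[of _ "[(1, \<lambda>z. z k)]"]) (auto intro: polyfun.intros)
next
  case (add f g)
  then obtain L L' where "\<forall>(c, q)\<in>set L. q \<in> polyfun K M" "\<forall>z. f z = (\<Sum>(c, q)\<leftarrow>L. c * q z)"
    "\<forall>(c, q)\<in>set L'. q \<in> polyfun K M" "\<forall>z. g z = (\<Sum>(c, q)\<leftarrow>L'. c * q z)" by blast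
  thus ?case by (intro exI[of _ "L @ L'"]) auto
next
  case (mult f g)
  then obtain L L' where L: "\<forall>(c, q)\<in>set L. q \<in> polyfun K M" "\<forall>z. f z = (\<Sum>(c, q)\<leftarrow>L. c * q z)"
    "\<forall>(c, q)\<in>set L'. q \<in> polyfun K M" "\<forall>z. g z = (\<Sum>(c, q)\<leftarrow>L'. c * q z)" by blast
  define P where "P L = concat (map (\<lambda>(c, q). map (\<lambda>(d, r). (c * d, \<lambda>z. q z * r z)) L') L)" for L :: "(complex \<times> ((nat \<Rightarrow> complex) \<Rightarrow> complex)) list"
  have 1: "(\<Sum>(c, q)\<leftarrow>P L. c * q z) = (\<Sum>(c, q)\<leftarrow>L. c * q z) * (\<Sum>(c, q)\<leftarrow>L'. c * q z)" for L z
  proof (induction L)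
    case (Cons a L)
    obtain c q where a: "a = (c, q)" by (cases a)
    have "(\<Sum>(c, q)\<leftarrow>map (\<lambda>(d, r). (c * d, \<lambda>z. q z * r z)) L''. c * q z) = c * q z * (\<Sum>(c, q)\<leftarrow>L''. c * q z)" for L'' :: "(complex \<times> ((nat \<Rightarrow> complex) \<Rightarrow> complex)) list"
      by (induction L'') (auto simp: algebra_simps)
    thus ?case using Cons by (simp add: P_def a algebra_simps)
  qed (simp add: P_def)
  have "\<forall>(c, q)\<in>set (P L). q \<in> polyfun K M"
    using L(1,3) by (fastforce simp: P_def intro: polyfun.mult)
  thus ?case using L(2,4) 1 by (intro exI[of _ "P L"]) simp
qed

text \<open>A solution \<open>c\<close> over the complex numbers of linear equations with coefficients in \<open>K\<close> is replaced
  by one in \<open>K\<close>; the same \<open>d\<close> serves all equations at once, as \<open>c\<close> generates a finite-dimensional space.\<close>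

lemma subfield_relations_descend:
  fixes r :: nat
  assumes K: "csubring K" "\<And>x. x \<in> K \<Longrightarrow> inverse x \<in> K"
  shows "\<exists>d. (\<forall>i<r. d i \<in> K) \<and> (\<forall>k k0. (\<forall>i<r. k i \<in> K) \<longrightarrow> k0 \<in> K \<longrightarrow>
    (\<Sum>i<r. k i * c i) = k0 \<longrightarrow> (\<Sum>i<r. k i * d i) = (k0 :: complex))"
proof (induction r)
  case 0
  show ?case by simp
next
  case (Suc r)
  then obtain d where d': "\<forall>i<r. d i \<in> K" "\<forall>k k0. (\<forall>i<r. k i \<in> K) \<longrightarrow> k0 \<in> K \<longrightarrow>
    (\<Sum>i<r. k i * c i) = k0 \<longrightarrow> (\<Sum>i<r. k i * d i) = k0" by blast
  note d = d'(1) d'(2)[THEN spec, THEN spec, THEN mp, THEN mp, THEN mp]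
  show ?case
  \<comment> \<open>If \<open>c r\<close> is an affine combination over \<open>K\<close> of the
    earlier numbers, \<open>d r\<close> has to be the same combination of the earlier
    \<open>d i\<close>. Otherwise \<open>c r\<close> occurs in no relation with a nonzero
    coefficient, and \<open>0\<close> will do.\<close>
  proof (cases "\<exists>l l0. (\<forall>i<r. l i \<in> K) \<and> l0 \<in> K \<and> c r = l0 + (\<Sum>i<r. l i * c i)")
    case True
    then obtain l l0 where l: "\<forall>i<r. l i \<in> K" "l0 \<in> K" "c r = l0 + (\<Sum>i<r. l i * c i)" by blast
    let ?d = "d(r := l0 + (\<Sum>i<r. l i * d i))"
    have "(\<Sum>i<Suc r. k i * ?d i) = k0"
      if k: "\<forall>i<Suc r. k i \<in> K" "k0 \<in> K" "(\<Sum>i<Suc r. k i * c i) = k0" for k k0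
    proof -
      have "(\<Sum>i<r. (k i + k r * l i) * c i) = k0 - k r * l0"
        using k(3) l(3) by (simp add: algebra_simps sum.distrib sum_distrib_left)
      hence "(\<Sum>i<r. (k i + k r * l i) * d i) = k0 - k r * l0"
        by (intro d(2)) (use k l K(1) in \<open>auto intro!: csubringD\<close>)
      thus ?thesis by (simp add: algebra_simps sum.distrib sum_distrib_left)
    qed
    moreover have "\<forall>i<Suc r. ?d i \<in> K"
      using d(1) l K(1) by (auto intro!: csubringD csubring_sum simp: less_Suc_eq)
    ultimately show ?thesis by blast
  next
    case False
    let ?d = "d(r := 0)"
    have "(\<Sum>i<Suc r. k i * ?d i) = k0"
      if k: "\<forall>i<Suc r. k i \<in> K" "k0 \<in> K" "(\<Sum>i<Suc r. k i * c i) = k0" for k k0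
    proof (cases "k r = 0")
      case True
      thus ?thesis using k d(2)[of k k0] by simp
    next
      case nz: False
      have "c r = inverse (k r) * k0 + (\<Sum>i<r. (- (inverse (k r) * k i)) * c i)"
      proof -
        have "(\<Sum>i<r. (- (inverse (k r) * k i)) * c i) = - inverse (k r) * (\<Sum>i<r. k i * c i)"
          by (simp add: sum_distrib_left mult.assoc sum_negf)
        also have "(\<Sum>i<r. k i * c i) = k0 - k r * c r" using k(3) by (simp add: algebra_simps)
        finally show ?thesis using nz by (simp add: field_simps)
      qed
      moreover have "\<forall>i<r. - (inverse (k r) * k i) \<in> K" "inverse (k r) * k0 \<in> K"
        using k K by (auto intro!: csubringD)
      ultimately have "\<exists>l l0. (\<forall>i<r. l i \<in> K) \<and> l0 \<in> K \<and> c r = l0 + (\<Sum>i<r. l i * c i)"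
        by (intro exI[of _ "\<lambda>i. - (inverse (k r) * k i)"] exI[of _ "inverse (k r) * k0"] conjI)
      thus ?thesis using False by blast
    qed
    moreover have "\<forall>i<Suc r. ?d i \<in> K"
      using d(1) csubringD[OF K(1)] by (auto simp: less_Suc_eq)
    ultimately show ?thesis by blast
  qed
qed

definition juxt :: "nat \<Rightarrow> (nat \<Rightarrow> complex) \<Rightarrow> (nat \<Rightarrow> complex) \<Rightarrow> nat \<Rightarrow> complex" where
  "juxt m x y = (\<lambda>k. if k < m then x k else y (k - m))"

lemma polyfun_juxt:
  assumes "f \<in> polyfun A (2 * m)"
  shows "(\<lambda>y. f (juxt m x y)) \<in> polyfun UNIV m"
  unfolding juxt_def
proof (rule polyfun_comp[OF polyfun_mono[OF assms subset_UNIV order.refl]])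
  fix k assume "k < 2 * m"
  thus "(\<lambda>y. if k < m then x k else y (k - m)) \<in> polyfun UNIV m"
    by (cases "k < m") (auto intro: polyfun.intros)
qed

text \<open>Since \<open>F j X\<close> lies in \<open>K\<close>, the identity expresses \<open>X i - y i\<close> linearly, with complex coefficients, in
  polynomials in \<open>y\<close> over \<open>K\<close> that vanish at \<open>X\<close>. Descending the coefficients to \<open>K\<close> and putting
  \<open>y = X\<close> shows that \<open>X i\<close> is the descended constant term.\<close>

lemma coordinate_in_subfield:
  assumes K: "csubring K" "\<And>x. x \<in> K \<Longrightarrow> inverse x \<in> K" and inf: "infinite K"
    and F: "\<And>j. j < m \<Longrightarrow> F j \<in> polyfun K m" and X: "\<And>j. j < m \<Longrightarrow> F j X \<in> K"
    and \<Gamma>: "\<And>j. j < m \<Longrightarrow> \<Gamma> j \<in> polyfun UNIV m"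
    and id: "\<And>y. X i - y i = (\<Sum>j<m. \<Gamma> j y * (F j X - F j y))" and i: "i < m"
  shows "X i \<in> K"
proof -
  \<comment> \<open>\<open>S\<close> is the complex span of the polynomials over \<open>K\<close>
    that vanish at \<open>X\<close>.\<close>
  define S where "S = {h. \<exists>L. (\<forall>(c, q)\<in>set L. q \<in> polyfun K m \<and> q X = 0) \<and> (\<forall>z. h z = (\<Sum>(c, q)\<leftarrow>L. c * q z))}"
  have K': "0 \<in> K" "1 \<in> K" "-1 \<in> K" using csubringD[OF K(1)] by auto
  have S0: "(\<lambda>_. 0) \<in> S" unfolding S_def by (auto intro!: exI[of _ "[]"])
  have Sadd: "(\<lambda>z. f z + g z) \<in> S" if fg: "f \<in> S" "g \<in> S" for f g
  proof -
    obtain L L' where "\<forall>(c, q)\<in>set L. q \<in> polyfun K m \<and> q X = 0" "\<forall>z. f z = (\<Sum>(c, q)\<leftarrow>L. c * q z)"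
      "\<forall>(c, q)\<in>set L'. q \<in> polyfun K m \<and> q X = 0" "\<forall>z. g z = (\<Sum>(c, q)\<leftarrow>L'. c * q z)"
      using fg unfolding S_def by blast
    thus ?thesis unfolding S_def by (intro CollectI exI[of _ "L @ L'"]) auto
  qed
  have Ssum: "(\<lambda>z. \<Sum>j\<in>J. f j z) \<in> S" if "\<And>j. j \<in> J \<Longrightarrow> f j \<in> S" for J :: "nat set" and f
    using that by (induction J rule: infinite_finite_induct) (auto intro: S0 Sadd)
  have "(\<lambda>y. \<Gamma> j y * (F j X - F j y)) \<in> S" if j: "j < m" for j
  proof -
    obtain L where L: "\<forall>(c, q)\<in>set L. q \<in> polyfun K m" "\<forall>z. \<Gamma> j z = (\<Sum>(c, q)\<leftarrow>L. c * q z)"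
      using polyfun_scalar_expansion[OF \<Gamma>[OF j], of K] K' by blast
    have Fj: "(\<lambda>y. F j X - F j y) \<in> polyfun K m"
      by (intro polyfun_diff polyfun.const X F j K')
    let ?L = "map (\<lambda>(c, q). (c, \<lambda>y. q y * (F j X - F j y))) L"
    have "(\<Sum>(c, q)\<leftarrow>map (\<lambda>(c, q). (c, \<lambda>y. q y * (F j X - F j y))) L. c * q z)
      = (\<Sum>(c, q)\<leftarrow>L. c * q z) * (F j X - F j z)" for L :: "(complex \<times> ((nat \<Rightarrow> complex) \<Rightarrow> complex)) list" and z
      by (induction L) (auto simp: algebra_simps)
    moreover have "\<forall>(c, q)\<in>set ?L. q \<in> polyfun K m \<and> q X = 0"
      using L(1) Fj by (auto intro: polyfun.mult)
    ultimately show ?thesis using L(2) unfolding S_def by (intro CollectI exI[of _ ?L]) simp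
  qed
  hence "(\<lambda>y. \<Sum>j<m. \<Gamma> j y * (F j X - F j y)) \<in> S" by (intro Ssum) auto
  then obtain L where L: "\<forall>(c, q)\<in>set L. q \<in> polyfun K m \<and> q X = 0"
    "\<And>y. X i - y i = (\<Sum>(c, q)\<leftarrow>L. c * q y)" unfolding id S_def by blast
  define r where "r = length L"
  \<comment> \<open>Slot \<open>r\<close> holds \<open>X i\<close>, so that it is descended together
    with the scalars. At a point \<open>y\<close> over \<open>K\<close> the expansion is a relation
    among these numbers with coefficients in \<open>K\<close> and right-hand side
    \<open>y i\<close>.\<close>
  define c where "c = (\<lambda>l. fst (L ! l))(r := X i)"
  have sum: "(\<Sum>(c, q)\<leftarrow>L. c * q y) = (\<Sum>l<r. c l * snd (L ! l) y)" for y
    unfolding sum_list_sum_nth by (simp add: r_def c_def lessThan_atLeast0 case_prod_beta)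
  obtain d where d': "\<forall>l<Suc r. d l \<in> K" "\<forall>k k0. (\<forall>l<Suc r. k l \<in> K) \<longrightarrow> k0 \<in> K \<longrightarrow>
    (\<Sum>l<Suc r. k l * c l) = k0 \<longrightarrow> (\<Sum>l<Suc r. k l * d l) = k0"
    using subfield_relations_descend[OF K, of "Suc r" c] by blast
  note d = d'(1) d'(2)[THEN spec, THEN spec, THEN mp, THEN mp, THEN mp]
  have q: "snd (L ! l) \<in> polyfun K m" "snd (L ! l) X = 0" if "l < r" for l
    using bspec[OF L(1) nth_mem[of l L]] that unfolding r_def case_prod_beta by blast+
  define h where "h y = d r - (\<Sum>l<r. snd (L ! l) y * d l) - y i" for y
  have "h y = 0" if y: "\<And>k. y k \<in> K" for y
  proof -
    have "(\<Sum>l<Suc r. ((\<lambda>l. - snd (L ! l) y)(r := 1)) l * d l) = y i"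
    proof (rule d(2))
      show "\<forall>l<Suc r. ((\<lambda>l. - snd (L ! l) y)(r := 1)) l \<in> K"
        using polyfun_in_csubring[OF q(1) K(1) y] K(1) by (auto simp: less_Suc_eq intro: csubringD)
      have "(\<Sum>l<r. c l * snd (L ! l) y) = X i - y i" using L(2) sum by simp
      thus "(\<Sum>l<Suc r. ((\<lambda>l. - snd (L ! l) y)(r := 1)) l * c l) = y i"
        by (simp add: sum_negf c_def mult.commute)
    qed (use y in auto)
    thus ?thesis by (simp add: h_def sum_negf)
  qed
  moreover have "h \<in> polyfun K m"
    unfolding h_def using d(1)
    by (intro polyfun_diff polyfun_sum polyfun.intros K' q i) auto
  \<comment> \<open>So far \<open>h\<close> vanishes at points over \<open>K\<close>. As
    \<open>K\<close> is infinite, \<open>h\<close> vanishes at \<open>X\<close> too, where all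
    polynomials in \<open>L\<close> are zero and only \<open>X i = d r\<close> remains.\<close>
  ultimately have "h X = 0" using polyfun_eq_0_infinite[of h K m K] inf K' by blast
  hence "X i = d r" using q(2) by (simp add: h_def)
  thus ?thesis using d(1) by simp
qed

theorem polynomial_identity_rational_inverse:
  assumes F: "\<And>j. j < m \<Longrightarrow> F j \<in> polyfun UNIV m"
    and \<Gamma>: "\<And>j. j < m \<Longrightarrow> \<Gamma> j \<in> polyfun UNIV (2 * m)"
    and id: "\<And>x y. x i - y i = (\<Sum>j<m. \<Gamma> j (juxt m x y) * (F j x - F j y))" and i: "i < m"
  shows "\<exists>a b. a \<in> polyfun UNIV m \<and> b \<in> polyfun UNIV m \<and> (\<exists>x. a (\<lambda>j. F j x) \<noteq> 0) \<and>
    (\<forall>x. a (\<lambda>j. F j x) * x i = b (\<lambda>j. F j x))"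
proof -
  obtain C where C: "finite C" "\<And>j. j < m \<Longrightarrow> F j \<in> polyfun C m"
    using polyfun_finite_coeffs_family[of "{..<m}" F UNIV m] F by auto
  define A where "A = C \<union> {0, 1, -1}"
  have A: "countable A" "0 \<in> A" "1 \<in> A" "-1 \<in> A" using C(1) by (auto simp: A_def countable_finite)
  have FA: "F j \<in> polyfun A m" if "j < m" for j
    using C(2)[OF that] by (rule polyfun_mono) (auto simp: A_def)
  obtain X where X: "\<And>f. f \<in> polyfun A m \<Longrightarrow> f X = 0 \<Longrightarrow> (\<forall>z. f z = 0)"
    using polyfun_generic_point[OF countable_polyfun[OF A(1)], of m m] polyfun_mono[OF _ subset_UNIV order.refl]
    by metis
  define \<kappa> where "\<kappa> j = F j X" for j
  have \<kappa>: "(\<lambda>j. F j X) = \<kappa>" by (simp add: \<kappa>_def fun_eq_iff)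
  \<comment> \<open>The field generated by \<open>A\<close> and the values \<open>\<kappa> j\<close>
    for \<open>j < m\<close>.\<close>
  define K where "K = {f \<kappa> / g \<kappa> | f g. f \<in> polyfun A m \<and> g \<in> polyfun A m \<and> g \<kappa> \<noteq> 0}"
  have KI: "f \<kappa> / g \<kappa> \<in> K" if "f \<in> polyfun A m" "g \<in> polyfun A m" "g \<kappa> \<noteq> 0" for f g
    using that unfolding K_def by blast
  have Kf: "f \<kappa> \<in> K" if "f \<in> polyfun A m" for f
    using KI[OF that polyfun.const[OF A(3)]] by simp
  have K1: "1 \<in> K" using Kf[OF polyfun.const[OF A(3)]] by simp
  have "x - y \<in> K \<and> x * y \<in> K" if xy: "x \<in> K" "y \<in> K" for x y
  proof -
    obtain f g f' g' where *: "f \<in> polyfun A m" "g \<in> polyfun A m" "g \<kappa> \<noteq> 0" "x = f \<kappa> / g \<kappa>"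
      "f' \<in> polyfun A m" "g' \<in> polyfun A m" "g' \<kappa> \<noteq> 0" "y = f' \<kappa> / g' \<kappa>"
      using xy unfolding K_def by blast
    have gg: "(\<lambda>z. g z * g' z) \<in> polyfun A m" by (intro polyfun.intros *)
    have "(\<lambda>z. f z * g' z - g z * f' z) \<in> polyfun A m" by (intro polyfun_diff polyfun.intros * A)
    from KI[OF this gg] have "(f \<kappa> * g' \<kappa> - g \<kappa> * f' \<kappa>) / (g \<kappa> * g' \<kappa>) \<in> K" using * by simp
    moreover have "(f \<kappa> * g' \<kappa> - g \<kappa> * f' \<kappa>) / (g \<kappa> * g' \<kappa>) = x - y"
      unfolding *(4,8) using *(3,7) by (simp add: diff_divide_distrib mult.commute)
    moreover have "(\<lambda>z. f z * f' z) \<in> polyfun A m" by (intro polyfun.intros *)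
    from KI[OF this gg] have "x * y \<in> K" using * by simp
    ultimately show ?thesis by simp
  qed
  hence K: "csubring K" using K1 by (auto simp: csubring_def)
  have Kinv: "inverse x \<in> K" if xK: "x \<in> K" for x
  proof (cases "x = 0")
    case True
    thus ?thesis using csubringD[OF K] by simp
  next
    case False
    obtain f g where *: "f \<in> polyfun A m" "g \<in> polyfun A m" "g \<kappa> \<noteq> 0" "x = f \<kappa> / g \<kappa>"
      using xK unfolding K_def by blast
    have "f \<kappa> \<noteq> 0" using False * by auto
    from KI[OF *(2,1) this] show ?thesis using * by (simp add: inverse_eq_divide)
  qed
  have "of_nat l \<in> K" for l by (induction l) (use csubringD[OF K] in auto)
  hence "range (of_nat :: nat \<Rightarrow> complex) \<subseteq> K" by auto
  hence inf: "infinite K" by (rule infinite_super) (simp add: finite_image_iff inj_of_nat)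
  have AK: "A \<subseteq> K" using Kf polyfun.const by blast
  have "X i \<in> K"
  proof (rule coordinate_in_subfield[OF K Kinv inf _ _ polyfun_juxt[OF \<Gamma>] id i])
    show "F j \<in> polyfun K m" if "j < m" for j by (rule polyfun_mono[OF FA[OF that] AK order.refl])
    show "F j X \<in> K" if "j < m" for j using Kf[OF polyfun.var[OF that]] by (simp add: \<kappa>_def)
  qed
  then obtain b a where ab: "b \<in> polyfun A m" "a \<in> polyfun A m" "a \<kappa> \<noteq> 0" "X i = b \<kappa> / a \<kappa>"
    unfolding K_def by blast
  \<comment> \<open>With the denominator cleared, \<open>X i = b \<kappa> / a \<kappa>\<close> is an
    equation over \<open>A\<close> at a generic point, hence an identity.\<close>
  have "(\<lambda>x. a (\<lambda>j. F j x) * x i - b (\<lambda>j. F j x)) \<in> polyfun A m"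
    by (intro polyfun_diff polyfun.mult polyfun.var polyfun_comp[OF ab(1)] polyfun_comp[OF ab(2)] FA A i)
  hence "a (\<lambda>j. F j x) * x i - b (\<lambda>j. F j x) = 0" for x
    by (rule X[THEN spec]) (use ab \<kappa> in simp)
  moreover have "a \<in> polyfun UNIV m" "b \<in> polyfun UNIV m" using ab(1,2) polyfun_mono by blast+
  ultimately show ?thesis using ab(3) \<kappa> by (metis eq_iff_diff_eq_0)
qed

section \<open>Finite quotients of finitely generated rings\<close>

text \<open>Finiteness of \<open>A / I\<close>, stated through representatives so that no quotient
  ring has to be formed.\<close>

definition finite_index :: "complex set \<Rightarrow> complex set \<Rightarrow> bool" where
  "finite_index A I \<longleftrightarrow> (\<exists>T. finite T \<and> (\<forall>x\<in>A. \<exists>y\<in>T. y \<in> A \<and> x - y \<in> I))"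

text \<open>\<open>A[t]\<close> inside the polynomials over the complex field, which makes division
  with remainder available; that remainders stay over \<open>A\<close> is then a matter of proof.
  For an ideal \<open>I\<close> the same set is the extended ideal \<open>I[t]\<close>.\<close>

definition polyring :: "complex set \<Rightarrow> complex poly set" where
  "polyring A = {p. \<forall>i. coeff p i \<in> A}"

definition adjoin :: "complex set \<Rightarrow> complex \<Rightarrow> complex set" where
  "adjoin A b = (\<lambda>p. poly p b) ` polyring A"

lemma polyring_closed:
  assumes "csubring A"
  shows "p \<in> polyring A \<Longrightarrow> q \<in> polyring A \<Longrightarrow> p + q \<in> polyring A"
    "p \<in> polyring A \<Longrightarrow> q \<in> polyring A \<Longrightarrow> p - q \<in> polyring A"
    "p \<in> polyring A \<Longrightarrow> q \<in> polyring A \<Longrightarrow> p * q \<in> polyring A"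
    "p \<in> polyring A \<Longrightarrow> - p \<in> polyring A"
    "c \<in> A \<Longrightarrow> p \<in> polyring A \<Longrightarrow> smult c p \<in> polyring A"
    "c \<in> A \<Longrightarrow> [:c:] \<in> polyring A" "1 \<in> polyring A" "c \<in> A \<Longrightarrow> monom c k \<in> polyring A"
    "c \<in> A \<Longrightarrow> p \<in> polyring A \<Longrightarrow> pCons c p \<in> polyring A"
  using csubringD[OF assms]
  by (auto simp: polyring_def coeff_mult coeff_pCons split: nat.splits intro!: csubring_sum[OF assms])

lemma cideal_polyring:
  assumes "csubring A" "cideal A I"
  shows "p \<in> polyring I \<Longrightarrow> q \<in> polyring I \<Longrightarrow> p + q \<in> polyring I"
    "p \<in> polyring I \<Longrightarrow> q \<in> polyring I \<Longrightarrow> p - q \<in> polyring I"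
    "p \<in> polyring A \<Longrightarrow> q \<in> polyring I \<Longrightarrow> p * q \<in> polyring I"
    "0 \<in> polyring I"
    "c \<in> I \<Longrightarrow> [:c:] \<in> polyring I"
  using cidealD[OF assms(2)]
  by (auto simp: polyring_def coeff_mult coeff_pCons split: nat.splits intro!: cideal_sum[OF assms(2)])

lemma cideal_self: "csubring A \<Longrightarrow> cideal A A"
  by (auto simp: cideal_def csubringD)

lemma csubring_adjoin:
  assumes "csubring A"
  shows "csubring (adjoin A b)"
  unfolding csubring_def
proof (intro conjI ballI)
  show "1 \<in> adjoin A b" unfolding adjoin_def by (rule image_eqI[of _ _ 1]) (auto intro: polyring_closed[OF assms])
  fix x y assume "x \<in> adjoin A b" "y \<in> adjoin A b"
  then obtain p q where "p \<in> polyring A" "q \<in> polyring A" "x = poly p b" "y = poly q b"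
    by (auto simp: adjoin_def)
  thus "x - y \<in> adjoin A b" "x * y \<in> adjoin A b" unfolding adjoin_def
    using imageI[of "p - q" "polyring A" "\<lambda>p. poly p b"] imageI[of "p * q" "polyring A" "\<lambda>p. poly p b"]
    by (auto simp: polyring_closed[OF assms])
qed

lemma adjoin_contains:
  assumes "csubring A"
  shows "A \<subseteq> adjoin A b" "b \<in> adjoin A b"
proof -
  show "A \<subseteq> adjoin A b"
    unfolding adjoin_def by (auto intro!: image_eqI[of _ _ "[:_:]"] polyring_closed[OF assms])
  have "[:0, 1:] \<in> polyring A" by (intro polyring_closed[OF assms] csubringD[OF assms])
  thus "b \<in> adjoin A b" unfolding adjoin_def by (intro image_eqI[of _ _ "[:0, 1:]"]) auto
qed

lemma countable_polyring:
  assumes "countable A"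
  shows "countable (polyring A)"
proof -
  have "polyring A \<subseteq> Poly ` lists (insert 0 A)"
  proof
    fix p assume "p \<in> polyring A"
    hence "set (coeffs p) \<subseteq> insert 0 A" by (auto simp: polyring_def coeffs_def)
    hence "coeffs p \<in> lists (insert 0 A)" by (simp add: lists_eq_set)
    thus "p \<in> Poly ` lists (insert 0 A)" by (metis Poly_coeffs imageI)
  qed
  thus ?thesis using assms by (meson countable_image countable_insert countable_lists countable_subset)
qed

text \<open>Long division by \<open>p\<close> uses only the inverse of its leading coefficient, and
  each step subtracts a multiple of \<open>p\<close> by a monomial with coefficient in
  \<open>I\<close>. The case \<open>I = A\<close> says that remainders stay over
  \<open>A\<close>.\<close>

lemma polyring_mod:
  assumes A: "csubring A" "cideal A I" and p: "p \<in> polyring A" "inverse (lead_coeff p) \<in> A" "p \<noteq> 0"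
    and h: "h \<in> polyring I"
  shows "h mod p \<in> polyring I"
  using h
proof (induction "degree h" arbitrary: h rule: less_induct)
  case less
  show ?case
  proof (cases "h = 0 \<or> degree h < degree p")
    case True
    thus ?thesis using less.prems by (auto simp: mod_poly_less)
  next
    case False
    define q where "q = monom (inverse (lead_coeff p) * lead_coeff h) (degree h - degree p)"
    define h' where "h' = h - q * p"
    have lc: "lead_coeff h \<in> I" using less.prems by (simp add: polyring_def)
    have "inverse (lead_coeff p) * lead_coeff h \<in> I" by (rule cidealD(6)[OF A(2) p(2) lc])
    hence "q \<in> polyring I" using cidealD(2)[OF A(2)] by (simp add: q_def polyring_def)
    hence h': "h' \<in> polyring I" unfolding h'_def
      using cideal_polyring[OF A] less.prems p(1) by (metis mult.commute)
    have mod: "h' mod p = h mod p" unfolding h'_def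
      by (metis mod_mult_self2 diff_add_cancel mult.commute)
    have "coeff (q * p) (degree h) = inverse (lead_coeff p) * lead_coeff h * lead_coeff p"
      using False by (simp add: q_def coeff_monom_mult)
    hence c0: "coeff h' (degree h) = 0" using p(3) by (simp add: h'_def)
    have "degree (q * p) \<le> degree h"
      using degree_mult_le[of q p] degree_monom_le[of "inverse (lead_coeff p) * lead_coeff h" "degree h - degree p"] False
      unfolding q_def by linarith
    hence "degree h' \<le> degree h" unfolding h'_def by (intro degree_diff_le) auto
    hence "h' = 0 \<or> degree h' < degree h" using c0 degree_less_if_less_eqI by blast
    thus ?thesis
    proof
      assume "h' = 0"
      thus ?thesis using mod cideal_polyring(4)[OF A] by (metis mod_0)
    qed (use less.hyps[of h'] h' mod in simp)
  qed
qed

text \<open>The ring \<open>A[b]\<close> maps onto \<open>A[t]/(p)\<close>, which is finite modulo \<open>I\<close> because \<open>p\<close> has an invertible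
  leading coefficient; the ideal below is the kernel of the resulting map.\<close>

context
  fixes A I :: "complex set" and p :: "complex poly" and b :: complex
  assumes A: "csubring A" "cideal A I" "finite_index A I"
    and p: "p \<in> polyring A" "inverse (lead_coeff p) \<in> A" "p \<noteq> 0"
    and b: "\<forall>f\<in>polyring A. poly f b = 0 \<longrightarrow> p dvd f"
begin

definition quot_ideal :: "complex set" where
  "quot_ideal = {poly f b | f. f \<in> polyring A \<and> f mod p \<in> polyring I}"

text \<open>Two polynomials over \<open>A\<close> with the same value at \<open>b\<close> differ by
  a multiple of \<open>p\<close>, so the remainder modulo \<open>p\<close>, and with it membership,
  depends on the number alone.\<close>

lemma quot_ideal_iff:
  assumes f: "f \<in> polyring A"
  shows "poly f b \<in> quot_ideal \<longleftrightarrow> f mod p \<in> polyring I"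
proof
  assume "poly f b \<in> quot_ideal"
  then obtain g where g: "g \<in> polyring A" "g mod p \<in> polyring I" "poly f b = poly g b"
    unfolding quot_ideal_def by blast
  have "p dvd f - g" by (rule b[rule_format]) (use f g in \<open>auto intro: polyring_closed[OF A(1)]\<close>)
  hence "f mod p = g mod p" by (simp add: mod_eq_dvd_iff)
  thus "f mod p \<in> polyring I" using g by simp
qed (use f in \<open>auto simp: quot_ideal_def\<close>)

lemma cideal_quot_ideal: "cideal (adjoin A b) quot_ideal"
  unfolding cideal_def
proof (intro conjI ballI)
  show "quot_ideal \<subseteq> adjoin A b" by (auto simp: quot_ideal_def adjoin_def)
  have "0 \<in> polyring A" using csubringD(2)[OF A(1)] by (simp add: polyring_def)
  thus "0 \<in> quot_ideal" using quot_ideal_iff[of 0] cideal_polyring(4)[OF A(1,2)] by simp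
next
  fix x y assume "x \<in> quot_ideal" "y \<in> quot_ideal"
  then obtain f g where fg: "f \<in> polyring A" "g \<in> polyring A" "f mod p \<in> polyring I" "g mod p \<in> polyring I"
    "x = poly f b" "y = poly g b" by (auto simp: quot_ideal_def)
  have "(f - g) mod p \<in> polyring I" unfolding poly_mod_diff_left by (intro cideal_polyring[OF A(1,2)] fg)
  thus "x - y \<in> quot_ideal"
    using quot_ideal_iff[of "f - g"] fg polyring_closed(2)[OF A(1)] by simp
next
  fix a x assume "a \<in> adjoin A b" "x \<in> quot_ideal"
  then obtain g f where fg: "g \<in> polyring A" "f \<in> polyring A" "f mod p \<in> polyring I"
    "a = poly g b" "x = poly f b" by (auto simp: quot_ideal_def adjoin_def)
  have "g * (f mod p) mod p \<in> polyring I"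
    by (intro polyring_mod[OF A(1,2) p] cideal_polyring[OF A(1,2)] fg)
  hence "(g * f) mod p \<in> polyring I" by (simp add: mod_mult_right_eq)
  thus "a * x \<in> quot_ideal"
    using quot_ideal_iff[of "g * f"] fg polyring_closed(3)[OF A(1)] by simp
qed

text \<open>A remainder modulo \<open>p\<close> has \<open>degree p\<close> coefficients, and each
  can be replaced by an element of the finite set \<open>T\<close>.\<close>

lemma finite_index_quot_ideal: "finite_index (adjoin A b) quot_ideal"
proof -
  obtain T where T: "finite T" "\<And>x. x \<in> A \<Longrightarrow> \<exists>y\<in>T. y \<in> A \<and> x - y \<in> I"
    using A(3) unfolding finite_index_def by blast
  define n where "n = degree p"
  define T' where "T' = (\<lambda>xs. poly (Poly xs) b) ` {xs. set xs \<subseteq> T \<and> length xs = n}"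
  have "finite T'" unfolding T'_def by (intro finite_imageI finite_lists_length_eq T)
  moreover have "\<exists>y\<in>T'. y \<in> adjoin A b \<and> x - y \<in> quot_ideal" if x: "x \<in> adjoin A b" for x
  proof -
    obtain f where f: "f \<in> polyring A" "x = poly f b" using x by (auto simp: adjoin_def)
    have r: "f mod p \<in> polyring A" by (rule polyring_mod[OF A(1) cideal_self[OF A(1)] p f(1)])
    have "\<forall>i. \<exists>y. y \<in> T \<and> y \<in> A \<and> coeff (f mod p) i - y \<in> I"
      using T(2) r by (auto simp: polyring_def)
    then obtain \<tau> where \<tau>: "\<And>i. \<tau> i \<in> T" "\<And>i. \<tau> i \<in> A" "\<And>i. coeff (f mod p) i - \<tau> i \<in> I" by metis
    define g where "g = Poly (map \<tau> [0..<n])"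
    have cg: "coeff g i = (if i < n then \<tau> i else 0)" for i
      by (simp add: g_def coeff_Poly_eq nth_default_def)
    have g: "g \<in> polyring A" using \<tau>(2) csubringD[OF A(1)] by (auto simp: polyring_def cg)
    have "coeff (f mod p) i = 0" if "i \<ge> n" for i
      using degree_mod_less[OF p(3), of f] that by (auto simp: n_def intro: coeff_eq_0)
    hence "f mod p - g \<in> polyring I"
      using \<tau>(3) cidealD(2)[OF A(2)] by (auto simp: polyring_def cg)
    hence "(f mod p - g) mod p \<in> polyring I" by (rule polyring_mod[OF A(1,2) p])
    hence "(f - g) mod p \<in> polyring I" by (simp add: mod_diff_left_eq)
    hence "x - poly g b \<in> quot_ideal"
      using quot_ideal_iff[of "f - g"] f g polyring_closed(2)[OF A(1)] by simp
    moreover have "poly g b \<in> T'" unfolding T'_def g_def using \<tau>(1) by (intro image_eqI[OF refl]) auto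
    ultimately show ?thesis using g unfolding adjoin_def by blast
  qed
  ultimately show ?thesis unfolding finite_index_def by blast
qed

lemma one_notin_quot_ideal:
  assumes "degree p > 0" "1 \<notin> I"
  shows "1 \<notin> quot_ideal"
proof -
  have "1 mod p = 1" using assms(1) by (intro mod_poly_less) auto
  moreover have "1 \<notin> polyring I" using assms(2) by (auto simp: polyring_def intro!: exI[of _ 0])
  ultimately show ?thesis using quot_ideal_iff[of 1] polyring_closed(7)[OF A(1)] by simp
qed

end

text \<open>Stronger than asking that \<beta> survive in a finite quotient: it must become a unit in
  a nonzero one. The induction on generators needs this, since leading coefficients have to stay
  invertible.\<close>

definition residually_finite :: "complex set \<Rightarrow> bool" where
  "residually_finite A \<longleftrightarrow> (\<forall>\<beta>\<in>A. \<beta> \<noteq> 0 \<longrightarrow>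
     (\<exists>I. cideal A I \<and> finite_index A I \<and> 1 \<notin> I \<and> (\<exists>\<gamma>\<in>A. \<beta> * \<gamma> - 1 \<in> I)))"

lemma residually_finite_Ints: "residually_finite \<int>"
  unfolding residually_finite_def
proof (intro ballI impI)
  fix \<beta> :: complex assume "\<beta> \<in> \<int>" "\<beta> \<noteq> 0"
  then obtain z where z: "\<beta> = of_int z" "z \<noteq> 0" by (auto elim: Ints_cases)
  \<comment> \<open>Modulo this \<open>q\<close> the number \<open>\<bar>z\<bar>\<close> is
    \<open>-1\<close>, so \<open>z\<close> is a unit with inverse \<open>- sgn z\<close>.\<close>
  define q where "q = \<bar>z\<bar> + 1"
  have q: "q \<ge> 2" using z by (simp add: q_def)
  define I where "I = range (\<lambda>k. of_int (q * k) :: complex)"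
  have "cideal \<int> I"
    unfolding cideal_def
  proof (intro conjI ballI)
    show "I \<subseteq> \<int>" by (auto simp: I_def)
    show "0 \<in> I" by (auto simp: I_def image_def)
    show "x - y \<in> I" if "x \<in> I" "y \<in> I" for x y
      using that by (auto simp: I_def image_def simp flip: of_int_diff of_int_mult right_diff_distrib)
    show "a * x \<in> I" if ax: "a \<in> \<int>" "x \<in> I" for a x
    proof -
      obtain j k where "a = of_int j" "x = of_int (q * k)" using ax unfolding I_def by (metis Ints_cases rangeE)
      thus ?thesis unfolding I_def by (intro image_eqI[of _ _ "j * k"]) auto
    qed
  qed
  moreover have "finite_index \<int> I"
    unfolding finite_index_def
  proof (intro exI conjI ballI)
    show "finite (of_int ` {0..<q} :: complex set)" by simp
    fix x :: complex assume "x \<in> \<int>"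
    then obtain j where j: "x = of_int j" by (auto elim: Ints_cases)
    have "j - j mod q = q * (j div q)" by (simp add: minus_mod_eq_mult_div)
    hence "x - of_int (j mod q) \<in> I" unfolding j I_def by (metis of_int_diff rangeI)
    thus "\<exists>y\<in>of_int ` {0..<q}. y \<in> \<int> \<and> x - y \<in> I" using q by (intro bexI[of _ "of_int (j mod q)"]) auto
  qed
  moreover have "1 \<notin> I"
  proof
    assume "1 \<in> I"
    then obtain k where "(1 :: complex) = of_int (q * k)" by (auto simp: I_def)
    hence "q * k = 1" by (metis of_int_eq_1_iff)
    thus False using q by (auto simp: zmult_eq_1_iff)
  qed
  moreover have "\<beta> * of_int (- sgn z) - 1 \<in> I"
    unfolding I_def z by (rule image_eqI[of _ _ "-1"]) (auto simp: q_def abs_sgn)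
  ultimately show "\<exists>I. cideal \<int> I \<and> finite_index \<int> I \<and> 1 \<notin> I \<and> (\<exists>\<gamma>\<in>\<int>. \<beta> * \<gamma> - 1 \<in> I)"
    by (intro exI[of _ I] conjI bexI[of _ "of_int (- sgn z)"]) auto
qed

text \<open>Write \<beta> as \<open>f(b)\<close> and specialize \<open>b\<close> to a natural number
  \<open>c\<close> that is not a root of \<open>f\<close>. This maps \<open>A[b]\<close> onto
  \<open>A\<close>, where \<open>f(c)\<close> can be made a unit; it is the quotient construction
  with \<open>p = t - c\<close>.\<close>

lemma residually_finite_adjoin_transcendental:
  assumes A: "csubring A" "residually_finite A" and b: "\<And>f. f \<in> polyring A \<Longrightarrow> poly f b = 0 \<Longrightarrow> f = 0"
  shows "residually_finite (adjoin A b)"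
  unfolding residually_finite_def
proof (intro ballI impI)
  fix \<beta> assume "\<beta> \<in> adjoin A b" and nz: "\<beta> \<noteq> 0"
  then obtain f where f': "f \<in> polyring A" "\<beta> = poly f b" unfolding adjoin_def by blast
  hence "f \<noteq> 0" using nz by auto
  note f = f' this
  have "\<exists>j::nat. poly f (of_nat j) \<noteq> 0"
  proof (rule ccontr)
    assume "\<not> ?thesis"
    hence "range (of_nat :: nat \<Rightarrow> complex) \<subseteq> {x. poly f x = 0}" by auto
    moreover have "infinite (range (of_nat :: nat \<Rightarrow> complex))"
      by (simp add: finite_image_iff inj_of_nat)
    ultimately show False using poly_roots_finite[OF f(3)] finite_subset by blast
  qed
  then obtain c :: complex where c: "poly f c \<noteq> 0" "c \<in> range of_nat" by auto
  have "of_nat l \<in> A" for l by (induction l) (use csubringD[OF A(1)] in auto)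
  hence cA: "c \<in> A" using c by auto
  have fc: "poly f c \<in> A"
    unfolding poly_altdef using f(1) cA
    by (intro csubring_sum[OF A(1)] csubringD[OF A(1)]) (auto simp: polyring_def)
  obtain I \<gamma> where I: "cideal A I" "finite_index A I" "1 \<notin> I" "\<gamma> \<in> A" "poly f c * \<gamma> - 1 \<in> I"
    using A(2) fc c(1) unfolding residually_finite_def by blast
  define p where "p = [:- c, 1:]"
  have p: "p \<in> polyring A" "inverse (lead_coeff p) \<in> A" "p \<noteq> 0" "degree p > 0"
    unfolding p_def by (auto intro!: polyring_closed[OF A(1)] csubringD[OF A(1)] cA)
  have b': "\<forall>g\<in>polyring A. poly g b = 0 \<longrightarrow> p dvd g" using b by auto
  note Q = cideal_quot_ideal[OF A(1) I(1,2) p(1-3) b'] finite_index_quot_ideal[OF A(1) I(1,2) p(1-3) b']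
    one_notin_quot_ideal[OF A(1) I(1,2) p(1-3) b' p(4) I(3)]
  let ?g = "f * [:\<gamma>:] - 1"
  have "p dvd ?g - [:poly f c * \<gamma> - 1:]"
    unfolding p_def by (subst poly_eq_0_iff_dvd[symmetric]) simp
  hence "?g mod p = [:poly f c * \<gamma> - 1:] mod p" by (simp add: mod_eq_dvd_iff)
  also have "\<dots> = [:poly f c * \<gamma> - 1:]" using p(4) by (intro mod_poly_less) auto
  also have "\<dots> \<in> polyring I" by (intro cideal_polyring[OF A(1) I(1)] I)
  finally have "poly ?g b \<in> quot_ideal A I p b"
    using quot_ideal_iff[OF A(1) I(1,2) p(1-3) b', of ?g] f(1) I(4)
    by (auto intro!: polyring_closed[OF A(1)])
  hence "\<beta> * \<gamma> - 1 \<in> quot_ideal A I p b" by (simp add: f mult.commute)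
  moreover have "\<gamma> \<in> adjoin A b" using adjoin_contains[OF A(1)] I(4) by blast
  ultimately show "\<exists>I. cideal (adjoin A b) I \<and> finite_index (adjoin A b) I \<and> 1 \<notin> I \<and> (\<exists>\<gamma>\<in>adjoin A b. \<beta> * \<gamma> - 1 \<in> I)"
    using Q by blast
qed

text \<open>Each step of the long division multiplies by \<open>lead_coeff g\<close> where ordinary
  division would divide by it, so the coefficients stay in \<open>A\<close>.\<close>

lemma polyring_pseudo_division:
  assumes A: "csubring A" and f: "f \<in> polyring A" and g: "g \<in> polyring A" "g \<noteq> 0"
  shows "\<exists>k. \<exists>q\<in>polyring A. \<exists>r\<in>polyring A. smult (lead_coeff g ^ k) f = q * g + r \<and> (r = 0 \<or> degree r < degree g)"
  using f
proof (induction "degree f" arbitrary: f rule: less_induct)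
  case less
  have A0: "0 \<in> polyring A" using csubringD(2)[OF A] by (simp add: polyring_def)
  have lc: "lead_coeff g \<in> A" "lead_coeff f \<in> A" using g less.prems by (auto simp: polyring_def)
  show ?case
  proof (cases "f = 0 \<or> degree f < degree g")
    case True
    thus ?thesis using less.prems A0 by (intro exI[of _ 0] bexI[of _ 0] bexI[of _ f]) auto
  next
    case False
    define m where "m = monom (lead_coeff f) (degree f - degree g)"
    define f' where "f' = smult (lead_coeff g) f - m * g"
    have m: "m \<in> polyring A" unfolding m_def by (intro polyring_closed[OF A] lc)
    have f': "f' \<in> polyring A" unfolding f'_def by (intro polyring_closed[OF A] lc less.prems m g)
    have "coeff (m * g) (degree f) = lead_coeff f * lead_coeff g"
      using False by (simp add: m_def coeff_monom_mult)
    hence c0: "coeff f' (degree f) = 0" by (simp add: f'_def)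
    have "degree (m * g) \<le> degree f"
      using degree_mult_le[of m g] degree_monom_le[of "lead_coeff f" "degree f - degree g"] False
      unfolding m_def by linarith
    hence "degree f' \<le> degree f" unfolding f'_def by (intro degree_diff_le) auto
    hence "f' = 0 \<or> degree f' < degree f" using c0 degree_less_if_less_eqI by blast
    thus ?thesis
    proof
      assume "f' = 0"
      hence "smult (lead_coeff g ^ 1) f = m * g + 0" by (simp add: f'_def)
      thus ?thesis using m A0 by blast
    next
      assume "degree f' < degree f"
      from less.hyps[OF this f'] obtain k q r where *: "q \<in> polyring A" "r \<in> polyring A"
        "smult (lead_coeff g ^ k) f' = q * g + r" "r = 0 \<or> degree r < degree g" by blast
      have "smult (lead_coeff g ^ Suc k) f = smult (lead_coeff g ^ k) (f' + m * g)"
        by (simp add: f'_def mult.commute)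
      also have "\<dots> = (q + smult (lead_coeff g ^ k) m) * g + r"
        using *(3) by (simp add: smult_add_right algebra_simps)
      finally have "smult (lead_coeff g ^ Suc k) f = (q + smult (lead_coeff g ^ k) m) * g + r" .
      moreover have "q + smult (lead_coeff g ^ k) m \<in> polyring A"
        by (intro polyring_closed[OF A] csubringD(7)[OF A] lc m *)
      ultimately show ?thesis using *(2,4) by blast
    qed
  qed
qed

text \<open>Euclidean descent on the degree of \<open>f\<close>. Pseudo-division of \<open>p\<close>
  by \<open>f\<close> leaves a remainder \<open>r\<close> with \<open>r(b) = - q(b) f(b)\<close>, so
  a multiple of \<open>r(b)\<close> is one of \<open>f(b)\<close>. The remainder is not zero, for
  otherwise \<open>q\<close> would vanish at \<open>b\<close> with degree below that of
  \<open>p\<close>. An arbitrary \<open>f\<close> is first pseudo-reduced by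
  \<open>p\<close>.\<close>

lemma algebraic_multiple_in_base:
  assumes A: "csubring A" and p: "p \<in> polyring A" "p \<noteq> 0" "poly p b = 0"
    and min: "\<forall>f\<in>polyring A. f \<noteq> 0 \<longrightarrow> degree f < degree p \<longrightarrow> poly f b \<noteq> 0"
    and f: "f \<in> polyring A" "poly f b \<noteq> 0"
  shows "\<exists>g\<in>polyring A. poly f b * poly g b \<in> A - {0}"
proof -
  have *: "\<exists>g\<in>polyring A. poly f b * poly g b \<in> A - {0}"
    if "f \<in> polyring A" "f \<noteq> 0" "degree f < degree p" for f
    using that
  proof (induction "degree f" arbitrary: f rule: less_induct)
    case less
    note f = less.prems
    have fb: "poly f b \<noteq> 0" using min f by blast
    show ?case
    proof (cases "degree f = 0")
      case True
      then obtain c where c: "f = [:c:]" by (rule degree_eq_zeroE)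
      hence "poly f b * poly 1 b \<in> A - {0}" using f by (auto simp: polyring_def dest: spec[of _ 0])
      thus ?thesis using polyring_closed(7)[OF A] by blast
    next
      case False
      obtain k q r where *: "q \<in> polyring A" "r \<in> polyring A"
        "smult (lead_coeff f ^ k) p = q * f + r" "r = 0 \<or> degree r < degree f"
        using polyring_pseudo_division[OF A p(1) f(1,2)] by blast
      have b0: "poly q b * poly f b + poly r b = 0"
        using arg_cong[OF *(3), of "\<lambda>p. poly p b"] p(3) by simp
      have "r \<noteq> 0"
      proof
        assume "r = 0"
        hence eq: "smult (lead_coeff f ^ k) p = q * f" using * by simp
        have nz: "smult (lead_coeff f ^ k) p \<noteq> 0" using p f by simp
        hence "q \<noteq> 0" using eq by auto
        have "degree p = degree q + degree f"
          using arg_cong[OF eq, of degree] f(2) \<open>q \<noteq> 0\<close> by (simp add: degree_mult_eq)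
        hence "poly q b \<noteq> 0" using min *(1) \<open>q \<noteq> 0\<close> False by simp
        thus False using b0 fb \<open>r = 0\<close> by simp
      qed
      then obtain g where g: "g \<in> polyring A" "poly r b * poly g b \<in> A - {0}"
        using less.hyps[of r] * f by auto
      have "poly f b * poly (- (q * g)) b = poly r b * poly g b"
      proof -
        have "poly r b = - (poly q b * poly f b)" using b0 by (simp add: add_eq_0_iff)
        thus ?thesis by simp
      qed
      thus ?thesis using g * by (intro bexI[of _ "- (q * g)"] polyring_closed[OF A]) auto
    qed
  qed
  obtain k q r where r: "q \<in> polyring A" "r \<in> polyring A"
    "smult (lead_coeff p ^ k) f = q * p + r" "r = 0 \<or> degree r < degree p"
    using polyring_pseudo_division[OF A f(1) p(1,2)] by blast
  have b0: "lead_coeff p ^ k * poly f b = poly r b"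
    using arg_cong[OF r(3), of "\<lambda>p. poly p b"] p(3) by simp
  hence "r \<noteq> 0" using f(2) p(2) by auto
  then obtain g where "g \<in> polyring A" "poly r b * poly g b \<in> A - {0}" using * r by blast
  moreover have "lead_coeff p ^ k \<in> A" using p(1) by (intro csubringD[OF A]) (auto simp: polyring_def)
  moreover have "poly f b * poly (smult (lead_coeff p ^ k) g) b = poly r b * poly g b"
    by (simp flip: b0)
  ultimately show ?thesis by (metis polyring_closed(5)[OF A])
qed

section \<open>Localization at an element that is invertible modulo an ideal\<close>

context
  fixes A I :: "complex set" and a \<gamma> :: complex
  assumes A: "csubring A" "cideal A I" "finite_index A I" "1 \<notin> I"
    and a: "a \<in> A" "a \<noteq> 0" "\<gamma> \<in> A" "a * \<gamma> - 1 \<in> I"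
begin

text \<open>For \<open>S = A\<close> this is the ring \<open>A[1/a]\<close>; for
  \<open>S = I\<close> it is the ideal that \<open>I\<close> generates there.\<close>

definition localized :: "complex set \<Rightarrow> complex set" where
  "localized S = {x / a ^ k | x k. x \<in> S}"

lemma localizedI: "x \<in> S \<Longrightarrow> x / a ^ k \<in> localized S"
  unfolding localized_def by blast

lemma localized_superset: "S \<subseteq> localized S"
  using localizedI[of _ S 0] by auto

lemma cancel_power_mod: "x \<in> A \<Longrightarrow> a ^ k * x \<in> I \<Longrightarrow> x \<in> I"
proof (induction k)
  case (Suc k)
  let ?y = "a ^ k * x"
  have y: "?y \<in> A" by (intro csubringD[OF A(1)] Suc.prems a)
  have ay: "a * ?y \<in> I" using Suc.prems(2) by (simp add: mult.assoc)
  have "\<gamma> * (a * ?y) - ?y * (a * \<gamma> - 1) \<in> I"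
    by (rule cidealD(4)[OF A(2) cidealD(6)[OF A(2) a(3) ay] cidealD(6)[OF A(2) y a(4)]])
  hence "?y \<in> I" by (simp add: algebra_simps)
  thus ?case using Suc by blast
qed simp

lemma localized_combine:
  assumes "x \<in> localized A" "y \<in> localized I"
  shows "x * y \<in> localized I"
proof -
  obtain u k v l where "u \<in> A" "v \<in> I" "x = u / a ^ k" "y = v / a ^ l"
    using assms unfolding localized_def by blast
  moreover have "(u * v) / a ^ (k + l) \<in> localized I" by (intro localizedI cidealD[OF A(2)] calculation)
  ultimately show ?thesis by (simp add: power_add)
qed

lemma localized_diff:
  assumes J: "cideal A J" and "x \<in> localized J" "y \<in> localized J"
  shows "x - y \<in> localized J"
proof -
  obtain u k v l where *: "u \<in> J" "v \<in> J" "x = u / a ^ k" "y = v / a ^ l"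
    using assms unfolding localized_def by blast
  have "(a ^ l * u - a ^ k * v) / a ^ (k + l) \<in> localized J"
    by (intro localizedI cidealD[OF J] csubringD[OF A(1)] a *)
  moreover have "(a ^ l * u - a ^ k * v) / a ^ (k + l) = x - y"
    using a(2) *(3,4) by (simp add: diff_divide_distrib power_add mult.commute)
  ultimately show ?thesis by simp
qed

lemma csubring_localized: "csubring (localized A)"
  unfolding csubring_def
proof (intro conjI ballI)
  show "1 \<in> localized A" using localized_superset csubringD(1)[OF A(1)] by blast
  fix x y assume xy: "x \<in> localized A" "y \<in> localized A"
  show "x - y \<in> localized A" by (rule localized_diff[OF cideal_self[OF A(1)] xy])
  obtain u k v l where "u \<in> A" "v \<in> A" "x = u / a ^ k" "y = v / a ^ l"
    using xy unfolding localized_def by blast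
  moreover have "(u * v) / a ^ (k + l) \<in> localized A" by (intro localizedI csubringD[OF A(1)] calculation)
  ultimately show "x * y \<in> localized A" by (simp add: power_add)
qed

lemma cideal_localized: "cideal (localized A) (localized I)"
  unfolding cideal_def
proof (intro conjI ballI)
  show "localized I \<subseteq> localized A" using cidealD(1)[OF A(2)] unfolding localized_def by blast
  show "0 \<in> localized I" using localized_superset cidealD(2)[OF A(2)] by blast
qed (use localized_diff[OF A(2)] localized_combine in blast)+

text \<open>As \<open>a\<close> is a unit modulo \<open>I\<close>, clearing denominators cannot
  enlarge \<open>I\<close> within \<open>A\<close>; in particular \<open>1\<close> stays
  outside.\<close>

lemma localized_ideal_contraction: "x \<in> A \<Longrightarrow> x \<in> localized I \<Longrightarrow> x \<in> I"
proof -
  assume x: "x \<in> A" "x \<in> localized I"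
  then obtain y k where "y \<in> I" "x = y / a ^ k" unfolding localized_def by blast
  hence "a ^ k * x \<in> I" using a(2) by simp
  thus "x \<in> I" using cancel_power_mod x by blast
qed

text \<open>Modulo the extended ideal \<open>1 / a ^ k\<close> is congruent to
  \<open>\<gamma> ^ k\<close>, so the representatives for \<open>A\<close> serve again.\<close>

lemma finite_index_localized: "finite_index (localized A) (localized I)"
proof -
  obtain T where T: "finite T" "\<And>x. x \<in> A \<Longrightarrow> \<exists>y\<in>T. y \<in> A \<and> x - y \<in> I"
    using A(3) unfolding finite_index_def by blast
  have "\<exists>y\<in>T. y \<in> localized A \<and> x - y \<in> localized I" if x: "x \<in> localized A" for x
  proof -
    obtain u k where u: "u \<in> A" "x = u / a ^ k" using x unfolding localized_def by blast
    have g: "u * \<gamma> ^ k \<in> A" by (intro csubringD[OF A(1)] u a)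
    have "1 - (a * \<gamma>) ^ k \<in> I"
    proof (induction k)
      case (Suc k)
      have "(1 - (a * \<gamma>) ^ k) - (a * \<gamma>) ^ k * (a * \<gamma> - 1) \<in> I"
        by (intro cidealD[OF A(2)] csubringD[OF A(1)] a Suc)
      thus ?case by (simp add: algebra_simps)
    qed (use cidealD[OF A(2)] in simp)
    hence "(u * (1 - (a * \<gamma>) ^ k)) / a ^ k \<in> localized I"
      by (intro localizedI cidealD(6)[OF A(2) u(1)])
    moreover have "(u * (1 - (a * \<gamma>) ^ k)) / a ^ k = x - u * \<gamma> ^ k"
      using a(2) u by (simp add: field_simps power_mult_distrib)
    ultimately have 1: "x - u * \<gamma> ^ k \<in> localized I" by simp
    obtain y where y: "y \<in> T" "y \<in> A" "u * \<gamma> ^ k - y \<in> I" using T(2)[OF g] by blast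
    have "(x - u * \<gamma> ^ k) + (u * \<gamma> ^ k - y) \<in> localized I"
      by (intro cidealD(5)[OF cideal_localized] 1 subsetD[OF localized_superset y(3)])
    thus ?thesis using y localized_superset by auto
  qed
  thus ?thesis using T(1) unfolding finite_index_def by blast
qed

lemma localized_polyring_denominator:
  assumes "f \<in> polyring (localized A)"
  shows "\<exists>k. smult (a ^ k) f \<in> polyring A"
  using assms
proof (induction f)
  case 0
  show ?case using csubringD(2)[OF A(1)] by (auto simp: polyring_def)
next
  case (pCons c f)
  have "c \<in> localized A" "f \<in> polyring (localized A)"
    using pCons.prems by (auto simp: polyring_def coeff_pCons dest: spec[of _ 0] spec[of _ "Suc _"])
  then obtain k u l where *: "smult (a ^ k) f \<in> polyring A" "u \<in> A" "c = u / a ^ l"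
    using pCons.IH unfolding localized_def by blast
  have "smult (a ^ (k + l)) (pCons c f) = pCons (a ^ k * u) (smult (a ^ l) (smult (a ^ k) f))"
    using a(2) * by (simp add: power_add mult.commute)
  moreover have "pCons (a ^ k * u) (smult (a ^ l) (smult (a ^ k) f)) \<in> polyring A"
    by (intro polyring_closed[OF A(1)] csubringD[OF A(1)] a *)
  ultimately show ?case by metis
qed

end

text \<open>After inverting the leading coefficient of a polynomial \<open>p\<close> of least degree with root \<open>b\<close>, the ring
  \<open>A[b]\<close> embeds in a free module. The ideal for \<open>A\<close> is chosen so that both this leading coefficient and a
  nonzero multiple of \<open>\<beta>\<close> in \<open>A\<close> stay invertible.\<close>

lemma residually_finite_adjoin_algebraic:
  assumes A: "csubring A" "residually_finite A" and ex: "\<exists>f\<in>polyring A. f \<noteq> 0 \<and> poly f b = 0"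
  shows "residually_finite (adjoin A b)"
  unfolding residually_finite_def
proof (intro ballI impI)
  fix \<beta> assume "\<beta> \<in> adjoin A b" and nz: "\<beta> \<noteq> 0"
  then obtain f where f: "f \<in> polyring A" "\<beta> = poly f b" by (auto simp: adjoin_def)
  define Q where "Q f \<longleftrightarrow> f \<in> polyring A \<and> f \<noteq> 0 \<and> poly f b = 0" for f
  obtain p where "Q p" and "\<And>f. Q f \<Longrightarrow> degree p \<le> degree f"
    using ex exists_least_iff[of "\<lambda>d. \<exists>f. Q f \<and> degree f = d"] unfolding Q_def by (metis not_le)
  hence p: "p \<in> polyring A" "p \<noteq> 0" "poly p b = 0"
    and min: "\<forall>f\<in>polyring A. f \<noteq> 0 \<longrightarrow> degree f < degree p \<longrightarrow> poly f b \<noteq> 0"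
    unfolding Q_def by (auto simp flip: not_le)
  have deg: "degree p > 0"
  proof (rule ccontr)
    assume "\<not> ?thesis"
    then obtain c where "p = [:c:]" by (auto elim: degree_eq_zeroE)
    thus False using p by simp
  qed
  obtain g where g: "g \<in> polyring A" "\<beta> * poly g b \<in> A - {0}"
    using algebraic_multiple_in_base[OF A(1) p min f(1)] nz f(2) by blast
  define a where "a = lead_coeff p"
  define \<alpha> where "\<alpha> = \<beta> * poly g b"
  have a: "a \<in> A" "a \<noteq> 0" using p by (auto simp: a_def polyring_def)
  have \<alpha>: "\<alpha> \<in> A" "\<alpha> \<noteq> 0" using g by (auto simp: \<alpha>_def)
  obtain I \<gamma> where I: "cideal A I" "finite_index A I" "1 \<notin> I" "\<gamma> \<in> A" "(a * \<alpha>) * \<gamma> - 1 \<in> I"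
    using A(2) csubringD(6)[OF A(1) a(1) \<alpha>(1)] a(2) \<alpha>(2) unfolding residually_finite_def
    by (metis mult_eq_0_iff)
  have "\<alpha> * \<gamma> \<in> A" by (intro csubringD[OF A(1)] \<alpha> I)
  note loc = A(1) I(1-3) a this I(5)[unfolded mult.assoc]
  let ?A = "localized a A" and ?I = "localized a I"
  note sup = localized_superset[OF loc]
  note L = csubring_localized[OF loc] cideal_localized[OF loc] finite_index_localized[OF loc]
  have one: "1 \<notin> ?I" using localized_ideal_contraction[OF loc] I(3) csubringD(1)[OF A(1)] by blast
  have p': "p \<in> polyring ?A" "inverse (lead_coeff p) \<in> ?A"
    using p sup localizedI[OF loc csubringD(1)[OF A(1)], of 1]
    by (auto simp: polyring_def a_def inverse_eq_divide)
  \<comment> \<open>The remainder of \<open>h\<close> modulo \<open>p\<close> also vanishes at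
    \<open>b\<close>. Cleared of denominators it lies over \<open>A\<close>, so it is zero by the
    minimality of \<open>degree p\<close>.\<close>
  have b: "\<forall>h\<in>polyring ?A. poly h b = 0 \<longrightarrow> p dvd h"
  proof (intro ballI impI, rule ccontr)
    fix h assume h: "h \<in> polyring ?A" "poly h b = 0"
    assume ndvd: "\<not> p dvd h"
    let ?r = "h mod p"
    have r: "?r \<noteq> 0" "degree ?r < degree p"
      using ndvd degree_mod_less[OF p(2), of h] by (auto simp: mod_eq_0_iff_dvd)
    have "?r \<in> polyring ?A" by (rule polyring_mod[OF L(1) cideal_self[OF L(1)] p' p(2) h(1)])
    then obtain k where k: "smult (a ^ k) ?r \<in> polyring A"
      using localized_polyring_denominator[OF loc] by blast
    have "poly ?r b = 0"
      using h(2) p(3) by (metis add_cancel_right_left mod_mult_div_eq mult_eq_0_iff poly_add poly_mult mult_zero_left add.right_neutral)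
    thus False using min k r a(2) by (metis degree_smult_eq mult_zero_right poly_smult power_not_zero smult_eq_0_iff)
  qed
  note Q = cideal_quot_ideal[OF L p' p(2) b] finite_index_quot_ideal[OF L p' p(2) b]
    one_notin_quot_ideal[OF L p' p(2) b deg one] quot_ideal_iff[OF L p' p(2) b]
  define J' where "J' = quot_ideal ?A ?I p b"
  \<comment> \<open>\<open>J'\<close> is an ideal of the possibly larger ring
    \<open>A[1/a][b]\<close> and is contracted to \<open>A[b]\<close>.\<close>
  define J where "J = J' \<inter> adjoin A b"
  have R: "csubring (adjoin A b)" by (rule csubring_adjoin[OF A(1)])
  have sub: "adjoin A b \<subseteq> adjoin ?A b" using sup by (auto simp: adjoin_def polyring_def)
  have "cideal (adjoin A b) J"
    unfolding cideal_def J_def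
  proof (intro conjI ballI)
    show "J' \<inter> adjoin A b \<subseteq> adjoin A b" by blast
    show "0 \<in> J' \<inter> adjoin A b" using cidealD(2)[OF Q(1)] csubringD(2)[OF R] by (simp add: J'_def)
    show "x - y \<in> J' \<inter> adjoin A b" if "x \<in> J' \<inter> adjoin A b" "y \<in> J' \<inter> adjoin A b" for x y
      using that cidealD(4)[OF Q(1), of x y] csubringD(4)[OF R, of x y] by (simp add: J'_def)
    show "c * x \<in> J' \<inter> adjoin A b" if "c \<in> adjoin A b" "x \<in> J' \<inter> adjoin A b" for c x
      using that cidealD(6)[OF Q(1), of c x] csubringD(6)[OF R, of c x] sub by (auto simp: J'_def)
  qed
  moreover have "finite_index (adjoin A b) J"
  proof -
    obtain T where T: "finite T" "\<And>x. x \<in> adjoin ?A b \<Longrightarrow> \<exists>y\<in>T. y \<in> adjoin ?A b \<and> x - y \<in> J'"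
      using Q(2) unfolding finite_index_def J'_def by blast
    \<comment> \<open>An element of \<open>T\<close> need not lie in \<open>A[b]\<close>; each of
      its classes that meets \<open>A[b]\<close> gets a representative there.\<close>
    define rep where "rep y = (SOME z. z \<in> adjoin A b \<and> z - y \<in> J')" for y
    have "\<exists>y\<in>rep ` T. y \<in> adjoin A b \<and> x - y \<in> J" if x: "x \<in> adjoin A b" for x
    proof -
      obtain y where y: "y \<in> T" "x - y \<in> J'" using T(2) x sub by blast
      have r: "rep y \<in> adjoin A b \<and> rep y - y \<in> J'"
        unfolding rep_def by (rule someI[of _ x]) (use x y(2) in blast)
      have "(x - y) - (rep y - y) \<in> J'"
        by (rule cidealD(4)[OF Q(1), folded J'_def, OF y(2) conjunct2[OF r]])
      hence "x - rep y \<in> J" using x r csubringD[OF R] by (simp add: J_def)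
      thus ?thesis using y r by blast
    qed
    thus ?thesis using T(1) unfolding finite_index_def by (intro exI[of _ "rep ` T"]) auto
  qed
  moreover have "1 \<notin> J" using Q(3) by (simp add: J_def J'_def)
  \<comment> \<open>Here \<open>\<beta> * poly g b\<close> is \<alpha>, and
    \<open>a * \<alpha> * \<gamma>\<close> is \<open>1\<close> modulo \<open>I\<close>.\<close>
  moreover have "\<beta> * (poly g b * (a * \<gamma>)) - 1 \<in> J"
  proof -
    let ?c = "a * (\<alpha> * \<gamma>) - 1"
    have c: "?c \<in> A" using loc(8) cidealD(1)[OF I(1)] by blast
    have "[:?c:] mod p = [:?c:]" using deg by (intro mod_poly_less) auto
    also have "\<dots> \<in> polyring ?I" using loc(8) sup by (intro cideal_polyring(5)[OF L(1,2)]) blast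
    finally have "poly [:?c:] b \<in> J'" using Q(4)[of "[:?c:]"] c sup polyring_closed(6)[OF L(1)]
      unfolding J'_def by blast
    moreover have "?c \<in> adjoin A b" using c adjoin_contains[OF A(1)] by blast
    ultimately show ?thesis by (simp add: J_def \<alpha>_def mult_ac)
  qed
  moreover have "poly g b * (a * \<gamma>) \<in> adjoin A b"
    using g(1) a I(4) adjoin_contains(1)[OF A(1)] csubringD(6)[OF R] csubringD(6)[OF A(1)]
    by (metis adjoin_def imageI subsetD)
  ultimately show "\<exists>I. cideal (adjoin A b) I \<and> finite_index (adjoin A b) I \<and> 1 \<notin> I \<and> (\<exists>\<gamma>\<in>adjoin A b. \<beta> * \<gamma> - 1 \<in> I)"
    by blast
qed

text \<open>Starting from the integers, the numbers are adjoined one at a time, each algebraic or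
  transcendental over the ring built so far. Countability is carried along to leave room for a
  transcendental number.\<close>

theorem finite_set_in_residually_finite_subring:
  assumes "finite S"
  shows "\<exists>A. csubring A \<and> countable A \<and> residually_finite A \<and> S \<subseteq> A"
  using assms
proof induction
  case empty
  have "csubring \<int>" by (auto simp: csubring_def)
  moreover have "countable (\<int> :: complex set)" by (simp add: Ints_def)
  ultimately show ?case using residually_finite_Ints by blast
next
  case (insert b S)
  then obtain A where A: "csubring A" "countable A" "residually_finite A" "S \<subseteq> A" by blast
  have "residually_finite (adjoin A b)"
    using residually_finite_adjoin_algebraic[OF A(1,3), of b] residually_finite_adjoin_transcendental[OF A(1,3), of b]
    by blast
  moreover have "countable (adjoin A b)"
    unfolding adjoin_def by (intro countable_image countable_polyring A)
  ultimately show ?case using csubring_adjoin[OF A(1)] adjoin_contains[OF A(1), of b] A(4)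
    by (intro exI[of _ "adjoin A b"]) auto
qed

lemma exists_transcendental:
  assumes "countable A"
  shows "\<exists>\<tau>. \<forall>f\<in>polyring A. poly f \<tau> = 0 \<longrightarrow> f = 0"
proof -
  have "countable (\<Union>f\<in>polyring A - {0}. {x. poly f x = 0})"
    using countable_polyring[OF assms]
    by (intro countable_UN) (auto intro: countable_finite poly_roots_finite countable_subset)
  hence "(\<Union>f\<in>polyring A - {0}. {x. poly f x = 0}) \<noteq> UNIV" using uncountable_UNIV_complex by metis
  then obtain \<tau> where "\<tau> \<notin> (\<Union>f\<in>polyring A - {0}. {x. poly f x = 0})" by blast
  thus ?thesis by blast
qed

section \<open>Polynomiality of the inverse\<close>

text \<open>An injective self-map of a finite set is onto. The finite set \<open>E\<close> contains
  one point for each class of points modulo \<open>I\<close>, with coordinates normalized by \<rho>;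
  \<phi> is the map \<open>F\<close> on it, and the identity for \<Gamma> makes \<phi>
  injective.\<close>

lemma polyfun_map_surj_mod:
  assumes A: "csubring A" "cideal A I" "finite_index A I"
    and F: "\<And>j. j < m \<Longrightarrow> F j \<in> polyfun A m"
    and \<Gamma>: "\<And>i j. i < m \<Longrightarrow> j < m \<Longrightarrow> \<Gamma> i j \<in> polyfun A (2 * m)"
    and id: "\<And>x y i. i < m \<Longrightarrow> x i - y i = (\<Sum>j<m. \<Gamma> i j (juxt m x y) * (F j x - F j y))"
    and y: "\<And>k. k < m \<Longrightarrow> y k \<in> A"
  shows "\<exists>x. (\<forall>k<m. x k \<in> A) \<and> (\<forall>j<m. F j x - y j \<in> I)"
proof -
  obtain T where T: "finite T" "\<And>x. x \<in> A \<Longrightarrow> \<exists>y\<in>T. y \<in> A \<and> x - y \<in> I"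
    using A(3) unfolding finite_index_def by blast
  define \<rho> where "\<rho> x = (SOME t. t \<in> T \<and> t \<in> A \<and> x - t \<in> I)" for x
  have \<rho>: "\<rho> x \<in> T" "\<rho> x \<in> A" "x - \<rho> x \<in> I" if "x \<in> A" for x
    using someI_ex[of "\<lambda>t. t \<in> T \<and> t \<in> A \<and> x - t \<in> I"] T(2)[OF that] unfolding \<rho>_def by blast+
  have \<rho>_eq: "\<rho> x = \<rho> x'" if "x - x' \<in> I" for x x'
  proof -
    have "x - t \<in> I \<longleftrightarrow> x' - t \<in> I" for t
      using cidealD(4)[OF A(2) _ that, of "x - t"] cidealD(5)[OF A(2) _ that, of "x' - t"] by auto
    thus ?thesis unfolding \<rho>_def by simp
  qed
  define R where "R = \<rho> ` A"
  have R: "R \<subseteq> T" "R \<subseteq> A" using \<rho> by (auto simp: R_def)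
  have \<rho>R: "\<rho> r = r" if "r \<in> R" for r
    using that \<rho>_eq[OF \<rho>(3)] unfolding R_def by force
  define E where "E = PiE {..<m} (\<lambda>_. R)"
  have fin: "finite E" unfolding E_def using R(1) T(1) by (intro finite_PiE) (auto intro: finite_subset)
  have EA: "z k \<in> A" if "z \<in> E" "k < m" for z k using that R(2) by (auto simp: E_def)
  define \<phi> where "\<phi> z = (\<lambda>j\<in>{..<m}. \<rho> (F j z))" for z
  have FA: "F j z \<in> A" if "z \<in> E" "j < m" for j z
    using polyfun_in_csubring[OF F[OF that(2)] A(1)] EA[OF that(1)] by blast
  have "\<phi> ` E \<subseteq> E" using FA by (auto simp: \<phi>_def E_def R_def)
  moreover have "inj_on \<phi> E"
  proof (rule inj_onI)
    fix z w assume zw: "z \<in> E" "w \<in> E" "\<phi> z = \<phi> w"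
    have d: "F j z - F j w \<in> I" if j: "j < m" for j
    proof -
      have "\<rho> (F j z) = \<rho> (F j w)" using fun_cong[OF zw(3), of j] j by (simp add: \<phi>_def)
      hence "F j z - F j w = (F j z - \<rho> (F j z)) - (F j w - \<rho> (F j w))" by simp
      also have "\<dots> \<in> I" by (intro cidealD(4)[OF A(2)] \<rho> FA zw j)
      finally show ?thesis .
    qed
    have J: "juxt m z w k \<in> A" if "k < 2 * m" for k
      using that EA zw by (auto simp: juxt_def)
    have "z i = w i" if i: "i < m" for i
    proof -
      have "(\<Sum>j<m. \<Gamma> i j (juxt m z w) * (F j z - F j w)) \<in> I"
        by (intro cideal_sum[OF A(2)] cidealD(6)[OF A(2)] d polyfun_in_csubring[OF \<Gamma> A(1) J] i) auto
      hence "z i - w i \<in> I" using id[OF i, of z w] by simp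
      hence "\<rho> (z i) = \<rho> (w i)" by (rule \<rho>_eq)
      thus ?thesis using zw i \<rho>R by (auto simp: E_def PiE_iff)
    qed
    thus "z = w" using zw(1,2) unfolding E_def by (intro PiE_ext) auto
  qed
  ultimately have "\<phi> ` E = E" using endo_inj_surj fin by blast
  moreover have "(\<lambda>j\<in>{..<m}. \<rho> (y j)) \<in> E" using y by (auto simp: E_def R_def)
  ultimately obtain x where x: "x \<in> E" "(\<lambda>j\<in>{..<m}. \<rho> (y j)) = \<phi> x" by blast
  have "F j x - y j \<in> I" if j: "j < m" for j
  proof -
    have "\<rho> (F j x) = \<rho> (y j)" using fun_cong[OF x(2), of j] j by (simp add: \<phi>_def)
    hence "F j x - y j = (F j x - \<rho> (F j x)) - (y j - \<rho> (y j))" by simp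
    also have "\<dots> \<in> I" by (intro cidealD(4)[OF A(2)] \<rho> FA x y j)
    finally show ?thesis .
  qed
  thus ?thesis using EA x(1) by blast
qed

text \<open>The line parameter is specialized to a number \<open>\<tau>\<close> transcendental over the coefficients, so that
  polynomials in it become complex numbers. If \<open>\<alpha>\<close> does not divide \<open>\<beta>\<close>, some ideal of finite index in \<open>A[\<tau>]\<close>
  contains \<open>\<alpha>(\<tau>)\<close> but not \<open>\<beta>(\<tau>)\<close>, whereas solving \<open>F x = y + \<tau> V\<close> modulo it gives \<open>\<alpha>(\<tau>) x\<^sub>i = \<beta>(\<tau>)\<close>.\<close>

lemma denominator_dvd_numerator:
  assumes F: "\<And>j. j < m \<Longrightarrow> F j \<in> polyfun UNIV m"
    and \<Gamma>: "\<And>i j. i < m \<Longrightarrow> j < m \<Longrightarrow> \<Gamma> i j \<in> polyfun UNIV (2 * m)"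
    and id: "\<And>x y i. i < m \<Longrightarrow> x i - y i = (\<Sum>j<m. \<Gamma> i j (juxt m x y) * (F j x - F j y))"
    and ab: "a \<in> polyfun UNIV m" "b \<in> polyfun UNIV m" "\<And>x. a (\<lambda>j. F j x) * x i = b (\<lambda>j. F j x)"
    and i: "i < m"
    and \<alpha>: "\<And>t. a (\<lambda>k. y k + t * V k) = poly \<alpha> t" "\<alpha> \<noteq> 0"
    and \<beta>: "\<And>t. b (\<lambda>k. y k + t * V k) = poly \<beta> t"
  shows "\<alpha> dvd \<beta>"
proof (rule ccontr)
  assume "\<not> \<alpha> dvd \<beta>"
  hence "\<beta> mod \<alpha> \<noteq> 0" by (simp add: mod_eq_0_iff_dvd)
  then obtain l where l: "coeff (\<beta> mod \<alpha>) l \<noteq> 0" by (auto simp: poly_eq_iff)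
  obtain C1 where C1: "finite C1" "\<And>j. j < m \<Longrightarrow> F j \<in> polyfun C1 m"
    using polyfun_finite_coeffs_family[of "{..<m}" F UNIV m] F by auto
  obtain C2 where C2: "finite C2" "\<And>i j. i < m \<Longrightarrow> j < m \<Longrightarrow> \<Gamma> i j \<in> polyfun C2 (2 * m)"
    using polyfun_finite_coeffs_family[of "{..<m} \<times> {..<m}" "\<lambda>(i, j). \<Gamma> i j" UNIV "2 * m"] \<Gamma> by auto
  obtain C3 where C3: "finite C3" "a \<in> polyfun C3 m" using polyfun_finite_coeffs[OF ab(1)] by blast
  obtain C4 where C4: "finite C4" "b \<in> polyfun C4 m" using polyfun_finite_coeffs[OF ab(2)] by blast
  \<comment> \<open>The inverse of the leading coefficient of \<alpha> is included so that division
    by \<alpha> stays over \<open>A\<close>.\<close>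
  define C where "C = C1 \<union> C2 \<union> C3 \<union> C4 \<union> y ` {..<m} \<union> V ` {..<m}
    \<union> set (coeffs \<alpha>) \<union> set (coeffs \<beta>) \<union> {inverse (lead_coeff \<alpha>)}"
  have "finite C" using C1 C2 C3 C4 by (simp add: C_def)
  then obtain A where A: "csubring A" "countable A" "residually_finite A" "C \<subseteq> A"
    using finite_set_in_residually_finite_subring by blast
  obtain \<tau> where \<tau>: "\<forall>f\<in>polyring A. poly f \<tau> = 0 \<longrightarrow> f = 0"
    using exists_transcendental[OF A(2)] by blast
  have coeff_in: "coeff q k \<in> A" if "set (coeffs q) \<subseteq> A" for q k
    using that csubringD(2)[OF A(1)] coeff_in_coeffs[of q k] by (cases "q = 0 \<or> k > degree q") (auto simp: coeff_eq_0)
  have \<alpha>A: "\<alpha> \<in> polyring A" "inverse (lead_coeff \<alpha>) \<in> A" and \<beta>A: "\<beta> \<in> polyring A"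
    using A(4) coeff_in by (auto simp: polyring_def C_def)
  have "\<beta> mod \<alpha> \<in> polyring A" by (rule polyring_mod[OF A(1) cideal_self[OF A(1)] \<alpha>A \<alpha>(2) \<beta>A])
  hence lA: "coeff (\<beta> mod \<alpha>) l \<in> A" by (simp add: polyring_def)
  \<comment> \<open>A nonzero coefficient of \<open>\<beta> mod \<alpha>\<close> becomes a unit
    modulo \<open>I\<close> and so is not in \<open>I\<close>, which keeps
    \<open>poly \<beta> \<tau>\<close> out of \<open>J\<close>.\<close>
  obtain I \<gamma> where I: "cideal A I" "finite_index A I" "1 \<notin> I" "\<gamma> \<in> A" "coeff (\<beta> mod \<alpha>) l * \<gamma> - 1 \<in> I"
    using A(3) lA l unfolding residually_finite_def by blast
  have lI: "coeff (\<beta> mod \<alpha>) l \<notin> I"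
  proof
    assume "coeff (\<beta> mod \<alpha>) l \<in> I"
    hence "coeff (\<beta> mod \<alpha>) l * \<gamma> - (coeff (\<beta> mod \<alpha>) l * \<gamma> - 1) \<in> I"
      by (intro cidealD(4)[OF I(1)] cidealD(7)[OF I(1)] I)
    thus False using I(3) by simp
  qed
  have dvd: "\<forall>f\<in>polyring A. poly f \<tau> = 0 \<longrightarrow> \<alpha> dvd f" using \<tau> by auto
  define R where "R = adjoin A \<tau>"
  define J where "J = quot_ideal A I \<alpha> \<tau>"
  have R: "csubring R" "A \<subseteq> R" "\<tau> \<in> R"
    unfolding R_def using csubring_adjoin adjoin_contains A(1) by auto
  note Q = cideal_quot_ideal[OF A(1) I(1,2) \<alpha>A \<alpha>(2) dvd, folded R_def J_def]
    finite_index_quot_ideal[OF A(1) I(1,2) \<alpha>A \<alpha>(2) dvd, folded R_def J_def]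
    quot_ideal_iff[OF A(1) I(1,2) \<alpha>A \<alpha>(2) dvd, folded R_def J_def]
  define Y where "Y k = y k + \<tau> * V k" for k
  have CR: "C \<subseteq> R" using A(4) R(2) by blast
  have YR: "Y k \<in> R" if "k < m" for k
    unfolding Y_def using that CR R(3) by (intro csubringD[OF R(1)]) (auto simp: C_def)
  have aR: "a \<in> polyfun R m" and bR: "b \<in> polyfun R m"
    using polyfun_mono[OF C3(2)] polyfun_mono[OF C4(2)] CR by (auto simp: C_def)
  have FR: "F j \<in> polyfun R m" if "j < m" for j
    by (rule polyfun_mono[OF C1(2)[OF that]]) (use CR in \<open>auto simp: C_def\<close>)
  have \<Gamma>R: "\<Gamma> i j \<in> polyfun R (2 * m)" if "i < m" "j < m" for i j
    by (rule polyfun_mono[OF C2(2)[OF that]]) (use CR in \<open>auto simp: C_def\<close>)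
  have "\<exists>x. (\<forall>k<m. x k \<in> R) \<and> (\<forall>j<m. F j x - Y j \<in> J)"
    by (rule polyfun_map_surj_mod[where \<Gamma> = \<Gamma>, OF R(1) Q(1,2)]) (assumption | rule FR \<Gamma>R id YR)+
  then obtain x where x: "\<forall>k<m. x k \<in> R" "\<forall>j<m. F j x - Y j \<in> J" by blast
  have FxR: "F j x \<in> R" if "j < m" for j
    using polyfun_in_csubring[OF FR[OF that] R(1)] x(1) by blast
  have "a (\<lambda>j. F j x) - a Y \<in> J" "b (\<lambda>j. F j x) - b Y \<in> J"
    using x(2) FxR YR
    by (auto intro!: polyfun_cong_mod[OF aR R(1) Q(1)] polyfun_cong_mod[OF bR R(1) Q(1)])
  moreover have Y: "a Y = poly \<alpha> \<tau>" "b Y = poly \<beta> \<tau>"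
    using \<alpha>(1)[of \<tau>] \<beta>[of \<tau>] unfolding Y_def[abs_def] by auto
  ultimately have *: "a (\<lambda>j. F j x) - poly \<alpha> \<tau> \<in> J" "b (\<lambda>j. F j x) - poly \<beta> \<tau> \<in> J" by auto
  have "\<alpha> mod \<alpha> \<in> polyring I" using cideal_polyring(4)[OF A(1) I(1)] by simp
  hence \<alpha>J: "poly \<alpha> \<tau> \<in> J" using Q(3)[OF \<alpha>A(1)] by blast
  have xi: "x i \<in> R" using x(1) i by blast
  \<comment> \<open>By \<open>a(F x) x_i = b(F x)\<close> this combination of elements of
    \<open>J\<close> collapses to \<open>poly \<beta> \<tau>\<close>.\<close>
  have "(a (\<lambda>j. F j x) - poly \<alpha> \<tau>) * x i + poly \<alpha> \<tau> * x i - (b (\<lambda>j. F j x) - poly \<beta> \<tau>) \<in> J"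
    by (intro cidealD(4)[OF Q(1)] cidealD(5)[OF Q(1)] cidealD(7)[OF Q(1)] * \<alpha>J xi)
  hence "poly \<beta> \<tau> \<in> J" using ab(3)[of x] by (simp add: algebra_simps)
  hence "\<beta> mod \<alpha> \<in> polyring I" using Q(3)[OF \<beta>A] by blast
  thus False using lI by (simp add: polyring_def)
qed

text \<open>On the line in direction \<open>V\<close> the quotient \<open>W V\<close> is a
  polynomial of degree at most \<open>E\<close>. Its coefficients come from power series division by
  \<open>P V\<close>, whose constant term is the number \<open>a y\<close> for every
  \<open>V\<close>; hence they are polynomial in \<open>V\<close>. The value at \<open>t = 1\<close>
  for \<open>V = z - y\<close> is \<open>G z\<close>.\<close>

lemma polyfun_quotient_from_lines:
  assumes a: "a \<in> polyfun UNIV m" "a y \<noteq> 0" and b: "b \<in> polyfun UNIV m"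
    and dvd: "\<And>V \<alpha> \<beta>. (\<And>t. a (\<lambda>k. y k + t * V k) = poly \<alpha> t) \<Longrightarrow> \<alpha> \<noteq> 0 \<Longrightarrow>
      (\<And>t. b (\<lambda>k. y k + t * V k) = poly \<beta> t) \<Longrightarrow> \<alpha> dvd \<beta>"
  shows "\<exists>G\<in>polyfun UNIV m. \<forall>z. a z * G z = b z"
proof -
  obtain P D where P: "\<And>V. degree (P V) \<le> D" "\<And>j. (\<lambda>V. coeff (P V) j) \<in> polyfun UNIV m"
    "\<And>V t. a (\<lambda>k. y k + t * V k) = poly (P V) t"
    using polyfun_along_line[OF a(1)] by metis
  obtain Q E where Q: "\<And>V. degree (Q V) \<le> E" "\<And>j. (\<lambda>V. coeff (Q V) j) \<in> polyfun UNIV m"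
    "\<And>V t. b (\<lambda>k. y k + t * V k) = poly (Q V) t"
    using polyfun_along_line[OF b] by metis
  have P0: "coeff (P V) 0 = a y" for V using P(3)[of 0 V] by (simp add: poly_0_coeff_0)
  have Pnz: "P V \<noteq> 0" for V using P0[of V] a(2) by auto
  define W where "W V = Q V div P V" for V
  have W: "Q V = P V * W V" for V
    using dvd[OF P(3) Pnz Q(3), of V] unfolding W_def by simp
  have degW: "degree (W V) \<le> E" for V
    using Q(1)[of V] degree_mult_eq[OF Pnz[of V], of "W V"] unfolding W by (cases "W V = 0") auto
  have cW: "(\<lambda>V. coeff (W V) j) \<in> polyfun UNIV m" for j
  proof (induction j rule: less_induct)
    case (less j)
    have "coeff (W V) j = inverse (a y) * (coeff (Q V) j - (\<Sum>i<j. coeff (P V) (j - i) * coeff (W V) i))" for V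
    proof -
      have "coeff (Q V) j = (\<Sum>i\<le>j. coeff (W V) i * coeff (P V) (j - i))"
        by (subst W) (simp only: mult.commute[of "P V"] coeff_mult)
      also have "{..j} = insert j {..<j}" by auto
      finally show ?thesis using a(2) by (simp add: P0 field_simps)
    qed
    moreover have "(\<lambda>V. inverse (a y) * (coeff (Q V) j - (\<Sum>i<j. coeff (P V) (j - i) * coeff (W V) i))) \<in> polyfun UNIV m"
      by (intro polyfun.mult polyfun.const polyfun_diff polyfun_sum Q P less) auto
    ultimately show ?case by simp
  qed
  define G where "G z = (\<Sum>j\<le>E. coeff (W (\<lambda>k. z k - y k)) j)" for z
  have "G \<in> polyfun UNIV m"
    unfolding G_def
    by (intro polyfun_sum polyfun_comp[OF cW] polyfun_diff polyfun.intros) auto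
  moreover have "a z * G z = b z" for z
  proof -
    define V where "V k = z k - y k" for k
    have "poly (W V) 1 = (\<Sum>j\<le>E. coeff (W V) j)"
      unfolding poly_altdef using degW[of V]
      by (auto intro!: sum.mono_neutral_left le_degree)
    hence G: "G z = poly (W V) 1" by (simp add: G_def V_def[abs_def])
    have z: "(\<lambda>k. y k + 1 * V k) = z" by (simp add: V_def)
    have "a z = poly (P V) 1" "b z = poly (Q V) 1" using P(3)[of 1 V] Q(3)[of 1 V] unfolding z by auto
    thus ?thesis using G by (simp add: W[of V])
  qed
  ultimately show ?thesis by blast
qed

text \<open>The lines start at \<open>F x0\<close>, where the denominator \<open>a\<close> does not
  vanish. From \<open>a(F x) (G(F x) - x_i) = 0\<close> the first factor cancels because it is not
  the zero polynomial.\<close>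

theorem polynomial_left_inverse:
  assumes F: "\<And>j. j < m \<Longrightarrow> F j \<in> polyfun UNIV m"
    and \<Gamma>: "\<And>i j. i < m \<Longrightarrow> j < m \<Longrightarrow> \<Gamma> i j \<in> polyfun UNIV (2 * m)"
    and id: "\<And>x y i. i < m \<Longrightarrow> x i - y i = (\<Sum>j<m. \<Gamma> i j (juxt m x y) * (F j x - F j y))"
  shows "\<exists>G. \<forall>i<m. G i \<in> polyfun UNIV m \<and> (\<forall>x. G i (\<lambda>j. F j x) = x i)"
proof -
  have "\<exists>G. G \<in> polyfun UNIV m \<and> (\<forall>x. G (\<lambda>j. F j x) = x i)" if i: "i < m" for i
  proof -
    obtain a b x0 where ab: "a \<in> polyfun UNIV m" "b \<in> polyfun UNIV m" "a (\<lambda>j. F j x0) \<noteq> 0"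
      "\<And>x. a (\<lambda>j. F j x) * x i = b (\<lambda>j. F j x)"
      using polynomial_identity_rational_inverse[of m F "\<Gamma> i" i, OF F \<Gamma>[OF i] id[OF i] i] by blast
    have "\<exists>G\<in>polyfun UNIV m. \<forall>z. a z * G z = b z"
      by (rule polyfun_quotient_from_lines[OF ab(1,3,2)],
          rule denominator_dvd_numerator[where F = F and \<Gamma> = \<Gamma>])
        (assumption | rule F \<Gamma> id ab i)+
    then obtain G where G: "G \<in> polyfun UNIV m" "\<And>z. a z * G z = b z" by blast
    have 1: "(\<lambda>x. a (\<lambda>j. F j x)) \<in> polyfun UNIV m" by (rule polyfun_comp[OF ab(1) F])
    have 2: "(\<lambda>x. G (\<lambda>j. F j x) - x i) \<in> polyfun UNIV m"
      by (intro polyfun_diff polyfun_comp[OF G(1) F] polyfun.var i) auto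
    have 3: "a (\<lambda>j. F j x) * (G (\<lambda>j. F j x) - x i) = 0" for x
      using ab(4)[of x] G(2)[of "\<lambda>j. F j x"] by (simp add: algebra_simps)
    have "G (\<lambda>j. F j x) - x i = 0" for x by (rule polyfun_mult_eq_0[OF 1 2 3 ab(3)])
    thus ?thesis using G(1) by auto
  qed
  thus ?thesis by metis
qed

section \<open>The difference quotient of a free polynomial\<close>

text \<open>A tuple of \<open>N\<close> matrices of size \<open>n\<close> is identified with its \<open>N n\<^sup>2\<close> entries: entry \<open>(a, b)\<close> of the
  \<open>i\<close>-th matrix has index \<open>(i n + a) n + b\<close>.\<close>

definition tup :: "nat \<Rightarrow> nat \<Rightarrow> (nat \<Rightarrow> complex) \<Rightarrow> complex mat list" where
  "tup n N z = map (\<lambda>i. mat n n (\<lambda>(a, b). z ((i * n + a) * n + b))) [0..<N]"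

definition ent :: "nat \<Rightarrow> complex mat list \<Rightarrow> nat \<Rightarrow> complex" where
  "ent n L k = L ! (k div n div n) $$ (k div n mod n, k mod n)"

lemma index_less:
  fixes n :: nat
  assumes "i < N" "a < n" "b < n"
  shows "(i * n + a) * n + b < N * n * n"
proof -
  have "i * n + a < Suc i * n" using assms(2) by simp
  also have "\<dots> \<le> N * n" using assms(1) by (intro mult_le_mono1) simp
  finally have "i * n + a < N * n" .
  hence "Suc (i * n + a) * n \<le> (N * n) * n" by (intro mult_le_mono1) simp
  thus ?thesis using assms by simp
qed

lemma index_cases:
  fixes n :: nat
  assumes "k < N * n * n"
  obtains i a b where "i < N" "a < n" "b < n" "k = (i * n + a) * n + b"
proof
  have n: "n > 0" using assms by (cases n) auto
  show "k div n div n < N" using assms by (simp add: less_mult_imp_div_less)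
  show "k div n mod n < n" "k mod n < n" using n by auto
  show "k = (k div n div n * n + k div n mod n) * n + k mod n" by simp
qed

lemma ent_index: "a < n \<Longrightarrow> b < n \<Longrightarrow> ent n L ((i * n + a) * n + b) = L ! i $$ (a, b)"
  by (simp add: ent_def)

lemma tup_in: "tup n N z \<in> mat_tuples n N"
  by (auto simp: tup_def mat_tuples_def)

lemma tup_entry: "i < N \<Longrightarrow> a < n \<Longrightarrow> b < n \<Longrightarrow> tup n N z ! i $$ (a, b) = z ((i * n + a) * n + b)"
  by (simp add: tup_def)

lemma tup_ent:
  assumes "L \<in> mat_tuples n N"
  shows "tup n N (ent n L) = L"
  using assms by (auto simp: mat_tuples_def tup_def ent_index intro!: nth_equalityI eq_matI)

lemma mat_tuples_eqI:
  assumes "L \<in> mat_tuples n N" "L' \<in> mat_tuples n N" "\<And>k. k < N * n * n \<Longrightarrow> ent n L k = ent n L' k"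
  shows "L = L'"
proof -
  have "tup n N (ent n L) = tup n N (ent n L')"
    by (auto simp: tup_def assms(3) index_less intro!: eq_matI)
  thus ?thesis using tup_ent assms(1,2) by metis
qed

lemma feval_carrier:
  "X \<in> mat_tuples n N \<Longrightarrow> fvars p \<subseteq> {..<N} \<Longrightarrow> feval n X p \<in> carrier_mat n n"
  by (induction p) (auto simp: mat_tuples_def)

lemma fmap_eval_in:
  "free_poly_map N Q \<Longrightarrow> X \<in> mat_tuples n N \<Longrightarrow> fmap_eval n Q X \<in> mat_tuples n N"
  using feval_carrier by (auto simp: free_poly_map_def fmap_eval_def mat_tuples_def)

lemma fmap_eval_index:
  assumes "free_poly_map N Q" "i < N" "a < n" "b < n"
  shows "ent n (fmap_eval n Q X) ((i * n + a) * n + b) = feval n X (Q ! i) $$ (a, b)"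
  using assms by (simp add: ent_index fmap_eval_def free_poly_map_def)

lemma mat_mult_entry:
  assumes "A \<in> carrier_mat n n" "B \<in> carrier_mat n n" "a < n" "b < n"
  shows "(A * B) $$ (a, b) = (\<Sum>c<n. A $$ (a, c) * B $$ (c, b))"
  using assms by (auto simp: scalar_prod_def lessThan_atLeast0)

lemma polyfun_feval:
  assumes "fvars p \<subseteq> {..<N}" "a < n" "b < n"
  shows "(\<lambda>z. feval n (tup n N z) p $$ (a, b)) \<in> polyfun UNIV (N * n * n)"
  using assms
proof (induction p arbitrary: a b)
  case (FConst c)
  thus ?case by (auto intro: polyfun.intros)
next
  case (FVar i)
  thus ?case using index_less by (auto simp: tup_entry intro!: polyfun.var)
next
  case (FAdd p q)
  have "feval n (tup n N z) (FAdd p q) $$ (a, b) = feval n (tup n N z) p $$ (a, b) + feval n (tup n N z) q $$ (a, b)" for z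
    using FAdd.prems feval_carrier[OF tup_in[of n N z], of q] by auto
  thus ?case using FAdd by (auto intro!: polyfun.add)
next
  case (FMul p q)
  have "feval n (tup n N z) (FMul p q) $$ (a, b)
    = (\<Sum>c<n. feval n (tup n N z) p $$ (a, c) * feval n (tup n N z) q $$ (c, b))" for z
    using FMul.prems feval_carrier[OF tup_in] by (simp add: mat_mult_entry)
  thus ?case using FMul by (auto intro!: polyfun_sum polyfun.mult)
qed

text \<open>The upper right block of the value at the block matrices with rows \<open>(X, H)\<close> and \<open>(0, Y)\<close>.\<close>

fun fdelta :: "nat \<Rightarrow> complex mat list \<Rightarrow> complex mat list \<Rightarrow> complex mat list \<Rightarrow> fpoly \<Rightarrow> complex mat" where
  "fdelta n X Y H (FConst c) = 0\<^sub>m n n"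
| "fdelta n X Y H (FVar i) = H ! i"
| "fdelta n X Y H (FAdd p q) = fdelta n X Y H p + fdelta n X Y H q"
| "fdelta n X Y H (FMul p q) = feval n X p * fdelta n X Y H q + fdelta n X Y H p * feval n Y q"

lemma fdelta_carrier:
  "X \<in> mat_tuples n N \<Longrightarrow> Y \<in> mat_tuples n N \<Longrightarrow> H \<in> mat_tuples n N \<Longrightarrow> fvars p \<subseteq> {..<N} \<Longrightarrow>
    fdelta n X Y H p \<in> carrier_mat n n"
proof (induction p)
  case (FMul p q)
  thus ?case using feval_carrier[of X n N p] feval_carrier[of Y n N q] by auto
qed (auto simp: mat_tuples_def)

definition block :: "nat \<Rightarrow> nat \<Rightarrow> complex mat list \<Rightarrow> complex mat list \<Rightarrow> complex mat list \<Rightarrow> complex mat list" where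
  "block n N X Y H = map (\<lambda>i. four_block_mat (X ! i) (H ! i) (0\<^sub>m n n) (Y ! i)) [0..<N]"

lemma block_in:
  "X \<in> mat_tuples n N \<Longrightarrow> Y \<in> mat_tuples n N \<Longrightarrow> block n N X Y H \<in> mat_tuples (n + n) N"
  by (auto simp: block_def mat_tuples_def)

lemma feval_block:
  assumes XYH: "X \<in> mat_tuples n N" "Y \<in> mat_tuples n N" "H \<in> mat_tuples n N" and "fvars p \<subseteq> {..<N}"
  shows "feval (n + n) (block n N X Y H) p
    = four_block_mat (feval n X p) (fdelta n X Y H p) (0\<^sub>m n n) (feval n Y p)"
  using assms(4)
proof (induction p)
  case (FConst c)
  show ?case by (rule eq_matI) (auto simp: four_block_mat_def)
next
  case (FVar i)
  thus ?case by (simp add: block_def)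
next
  case (FAdd p q)
  hence pq: "fvars p \<subseteq> {..<N}" "fvars q \<subseteq> {..<N}" by auto
  note c = feval_carrier[OF XYH(1)] feval_carrier[OF XYH(2)] fdelta_carrier[OF XYH] zero_carrier_mat
  show ?case using FAdd.IH pq
    by (simp add: add_four_block_mat[OF c(1)[OF pq(1)] c(3)[OF pq(1)] c(4)[of n n] c(2)[OF pq(1)]
      c(1)[OF pq(2)] c(3)[OF pq(2)] c(4)[of n n] c(2)[OF pq(2)]])
next
  case (FMul p q)
  hence pq: "fvars p \<subseteq> {..<N}" "fvars q \<subseteq> {..<N}" by auto
  note c = feval_carrier[OF XYH(1)] feval_carrier[OF XYH(2)] fdelta_carrier[OF XYH] zero_carrier_mat
  show ?case using FMul.IH pq c(1,2,3)[OF pq(1)] c(1,2,3)[OF pq(2)]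
    by (simp add: mult_four_block_mat[OF c(1)[OF pq(1)] c(3)[OF pq(1)] c(4)[of n n] c(2)[OF pq(1)]
      c(1)[OF pq(2)] c(3)[OF pq(2)] c(4)[of n n] c(2)[OF pq(2)]])
qed

text \<open>If the upper right blocks vanish, \<open>P\<close> takes the same value at the block
  matrices built with \<open>H\<close> and with \<open>0\<close>, so these coincide.\<close>

lemma fdelta_injective:
  assumes P: "free_poly_map N P" and inj: "inj_on (fmap_eval (n + n) P) (mat_tuples (n + n) N)"
    and XYH: "X \<in> mat_tuples n N" "Y \<in> mat_tuples n N" "H \<in> mat_tuples n N"
    and 0: "\<And>j. j < N \<Longrightarrow> fdelta n X Y H (P ! j) = 0\<^sub>m n n"
    and i: "i < N"
  shows "H ! i = 0\<^sub>m n n"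
proof -
  define Z0 where "Z0 = replicate N (0\<^sub>m n n :: complex mat)"
  have Z0: "Z0 \<in> mat_tuples n N" by (auto simp: Z0_def mat_tuples_def)
  have PN: "length P = N" "\<And>j. j < N \<Longrightarrow> fvars (P ! j) \<subseteq> {..<N}" using P by (auto simp: free_poly_map_def)
  have Z00: "fdelta n X Y Z0 p = 0\<^sub>m n n" if "fvars p \<subseteq> {..<N}" for p
    using that
  proof (induction p)
    case (FMul p q)
    thus ?case using feval_carrier[OF XYH(1), of p] feval_carrier[OF XYH(2), of q] by auto
  qed (auto simp: Z0_def)
  have "fmap_eval (n + n) P (block n N X Y H) = fmap_eval (n + n) P (block n N X Y Z0)"
    unfolding fmap_eval_def
    by (rule nth_equalityI) (auto simp: PN 0 Z00 feval_block[OF XYH] feval_block[OF XYH(1,2) Z0])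
  hence "block n N X Y H = block n N X Y Z0"
    using inj block_in[OF XYH(1,2)] by (auto dest: inj_onD)
  hence eq: "four_block_mat (X ! i) (H ! i) (0\<^sub>m n n) (Y ! i) = four_block_mat (X ! i) (Z0 ! i) (0\<^sub>m n n) (Y ! i)"
    using i by (simp add: block_def)
  have c: "X ! i \<in> carrier_mat n n" "H ! i \<in> carrier_mat n n" "Y ! i \<in> carrier_mat n n" "Z0 ! i = 0\<^sub>m n n"
    using XYH i by (auto simp: mat_tuples_def Z0_def)
  show ?thesis
  proof (rule eq_matI)
    fix a b assume ab: "a < dim_row (0\<^sub>m n n :: complex mat)" "b < dim_col (0\<^sub>m n n :: complex mat)"
    have "four_block_mat (X ! i) (H ! i) (0\<^sub>m n n) (Y ! i) $$ (a, n + b) = H ! i $$ (a, b)"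
      using ab c by (subst index_mat_four_block) auto
    moreover have "four_block_mat (X ! i) (Z0 ! i) (0\<^sub>m n n) (Y ! i) $$ (a, n + b) = 0"
      using ab c by (subst index_mat_four_block) auto
    ultimately show "H ! i $$ (a, b) = 0\<^sub>m n n $$ (a, b)" using eq ab by simp
  qed (use c in auto)
qed

text \<open>The product case telescopes: \<open>p(X) q(X) - p(Y) q(Y) = p(X) (q(X) - q(Y)) + (p(X) -
  p(Y)) q(Y)\<close>.\<close>

lemma feval_diff_eq_fdelta:
  assumes XY: "X \<in> mat_tuples n N" "Y \<in> mat_tuples n N" and p: "fvars p \<subseteq> {..<N}"
    and H: "H \<in> mat_tuples n N" "\<And>i. i < N \<Longrightarrow> H ! i = X ! i - Y ! i"
  shows "fdelta n X Y H p = feval n X p - feval n Y p"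
  using p
proof (induction p)
  case (FConst c)
  show ?case by (rule eq_matI) auto
next
  case (FVar i)
  thus ?case using H by simp
next
  case (FAdd p q)
  thus ?case using feval_carrier[OF XY(1), of p] feval_carrier[OF XY(2), of p]
      feval_carrier[OF XY(1), of q] feval_carrier[OF XY(2), of q]
    by (auto intro!: eq_matI)
next
  case (FMul p q)
  have c: "feval n X p \<in> carrier_mat n n" "feval n Y p \<in> carrier_mat n n"
    "feval n X q \<in> carrier_mat n n" "feval n Y q \<in> carrier_mat n n"
    using feval_carrier[OF XY(1), of p] feval_carrier[OF XY(2), of p]
      feval_carrier[OF XY(1), of q] feval_carrier[OF XY(2), of q] FMul.prems by auto
  have "feval n X p * (feval n X q - feval n Y q) = feval n X p * feval n X q - feval n X p * feval n Y q"
    using c by (simp add: mult_minus_distrib_mat)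
  moreover have "(feval n X p - feval n Y p) * feval n Y q = feval n X p * feval n Y q - feval n Y p * feval n Y q"
    using c by (simp add: minus_mult_distrib_mat)
  moreover have "(U - V) + (V - W) = U - W"
    if "U \<in> carrier_mat n n" "V \<in> carrier_mat n n" "W \<in> carrier_mat n n" for U V W :: "complex mat"
    using that by (auto intro!: eq_matI)
  ultimately show ?case using FMul c by simp
qed

lemma fdelta_linear_polyfun:
  assumes "fvars p \<subseteq> {..<N}" "m = N * n * n"
  shows "\<exists>d. (\<forall>a<n. \<forall>b<n. \<forall>l<m. d a b l \<in> polyfun UNIV (2 * m)) \<and>
    (\<forall>x y h. \<forall>a<n. \<forall>b<n. fdelta n (tup n N x) (tup n N y) (tup n N h) p $$ (a, b)
      = (\<Sum>l<m. d a b l (juxt m x y) * h l))"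
  using assms(1)
proof (induction p)
  case (FConst c)
  show ?case by (rule exI[of _ "\<lambda>_ _ _ _. 0"]) (auto intro: polyfun.intros)
next
  case (FVar i)
  have "(\<Sum>l<m. (if l = (i * n + a) * n + b then 1 else 0) * h l) = h ((i * n + a) * n + b)"
    if "a < n" "b < n" for a b and h :: "nat \<Rightarrow> complex"
    using index_less[of i N a n b] that FVar assms(2)
    by (simp add: if_distrib[of "\<lambda>x. x * _"] cong: if_cong)
  thus ?case using FVar
    by (intro exI[of _ "\<lambda>a b l _. if l = (i * n + a) * n + b then 1 else 0"]) (auto intro: polyfun.intros simp: tup_entry)
next
  case (FAdd p q)
  then obtain d e where *:
    "\<forall>a<n. \<forall>b<n. \<forall>l<m. d a b l \<in> polyfun UNIV (2 * m)"
    "\<forall>x y h. \<forall>a<n. \<forall>b<n. fdelta n (tup n N x) (tup n N y) (tup n N h) p $$ (a, b) = (\<Sum>l<m. d a b l (juxt m x y) * h l)"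
    "\<forall>a<n. \<forall>b<n. \<forall>l<m. e a b l \<in> polyfun UNIV (2 * m)"
    "\<forall>x y h. \<forall>a<n. \<forall>b<n. fdelta n (tup n N x) (tup n N y) (tup n N h) q $$ (a, b) = (\<Sum>l<m. e a b l (juxt m x y) * h l)"
    by force
  note * = *[rule_format]
  have c: "fdelta n (tup n N x) (tup n N y) (tup n N h) q \<in> carrier_mat n n" for x y h
    using FAdd.prems by (intro fdelta_carrier[of _ n N] tup_in) auto
  have "fdelta n (tup n N x) (tup n N y) (tup n N h) (FAdd p q) $$ (a, b)
      = (\<Sum>l<m. (d a b l (juxt m x y) + e a b l (juxt m x y)) * h l)" if "a < n" "b < n" for x y h a b
    using that c[of x y h] by (auto simp: * sum.distrib algebra_simps)
  thus ?case using *(1,3)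
    by (intro exI[of _ "\<lambda>a b l z. d a b l z + e a b l z"]) (auto intro!: polyfun.add)
next
  case (FMul p q)
  then obtain d e where *:
    "\<forall>a<n. \<forall>b<n. \<forall>l<m. d a b l \<in> polyfun UNIV (2 * m)"
    "\<forall>x y h. \<forall>a<n. \<forall>b<n. fdelta n (tup n N x) (tup n N y) (tup n N h) p $$ (a, b) = (\<Sum>l<m. d a b l (juxt m x y) * h l)"
    "\<forall>a<n. \<forall>b<n. \<forall>l<m. e a b l \<in> polyfun UNIV (2 * m)"
    "\<forall>x y h. \<forall>a<n. \<forall>b<n. fdelta n (tup n N x) (tup n N y) (tup n N h) q $$ (a, b) = (\<Sum>l<m. e a b l (juxt m x y) * h l)"
    by force
  note * = *[rule_format]
  have pq: "fvars p \<subseteq> {..<N}" "fvars q \<subseteq> {..<N}" using FMul.prems by auto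
  note c = feval_carrier[OF tup_in pq(1)] feval_carrier[OF tup_in pq(2)]
    fdelta_carrier[OF tup_in tup_in tup_in pq(1)] fdelta_carrier[OF tup_in tup_in tup_in pq(2)]
  \<comment> \<open>The first \<open>m\<close> coordinates of \<open>z\<close> encode
    \<open>X\<close>, the next \<open>m\<close> encode \<open>Y\<close>; the two sums are the two
    terms of the product rule.\<close>
  define D where "D a b l z = (\<Sum>c<n. feval n (tup n N z) p $$ (a, c) * e c b l z)
    + (\<Sum>c<n. d a c l z * feval n (tup n N (\<lambda>k. z (m + k))) q $$ (c, b))" for a b l z
  have x: "tup n N (juxt m x y) = tup n N x" for x y
    unfolding tup_def juxt_def using assms(2) by (auto intro!: eq_matI simp: index_less)
  have y: "(\<lambda>k. juxt m x y (m + k)) = y" for x y by (auto simp: juxt_def)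
  have D: "D a b l \<in> polyfun UNIV (2 * m)" if "a < n" "b < n" "l < m" for a b l
    unfolding D_def
  proof (intro polyfun.add polyfun_sum polyfun.mult * that)
    fix c assume "c \<in> {..<n}"
    hence c: "c < n" by simp
    show "(\<lambda>z. feval n (tup n N z) p $$ (a, c)) \<in> polyfun UNIV (2 * m)"
      using polyfun_feval[OF pq(1) that(1) c] by (rule polyfun_mono) (auto simp: assms(2))
    show "(\<lambda>z. feval n (tup n N (\<lambda>k. z (m + k))) q $$ (c, b)) \<in> polyfun UNIV (2 * m)"
      by (rule polyfun_comp[where g = "\<lambda>k z. z (m + k)", OF polyfun_feval[OF pq(2) c that(2)]])
        (auto intro: polyfun.var simp: assms(2))
  qed auto
  have "fdelta n (tup n N x) (tup n N y) (tup n N h) (FMul p q) $$ (a, b)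
      = (\<Sum>l<m. D a b l (juxt m x y) * h l)" if ab: "a < n" "b < n" for x y h a b
  proof -
    have "fdelta n (tup n N x) (tup n N y) (tup n N h) (FMul p q) $$ (a, b)
      = (feval n (tup n N x) p * fdelta n (tup n N x) (tup n N y) (tup n N h) q) $$ (a, b)
      + (fdelta n (tup n N x) (tup n N y) (tup n N h) p * feval n (tup n N y) q) $$ (a, b)"
      using ab c(3)[of n x y h] c(2)[of n y] by auto
    also have "\<dots> = (\<Sum>c<n. \<Sum>l<m. feval n (tup n N x) p $$ (a, c) * e c b l (juxt m x y) * h l)
      + (\<Sum>c<n. \<Sum>l<m. d a c l (juxt m x y) * feval n (tup n N y) q $$ (c, b) * h l)"
      using ab by (simp add: mat_mult_entry[OF c(1) c(4)] mat_mult_entry[OF c(3) c(2)] *(2,4)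
        sum_distrib_left sum_distrib_right mult_ac)
    also have "\<dots> = (\<Sum>l<m. \<Sum>c<n. feval n (tup n N x) p $$ (a, c) * e c b l (juxt m x y) * h l)
      + (\<Sum>l<m. \<Sum>c<n. d a c l (juxt m x y) * feval n (tup n N y) q $$ (c, b) * h l)"
      by (intro arg_cong2[where f = "(+)"] sum.swap)
    also have "\<dots> = (\<Sum>l<m. D a b l (juxt m x y) * h l)"
      by (simp add: D_def x y sum.distrib distrib_right sum_distrib_right)
    finally show ?thesis .
  qed
  thus ?case using D by blast
qed

text \<open>The coefficients \<open>d\<close> are exported along with their inverse \<Gamma> because
  the error of a Newton step is expressed through \<open>d\<close> near the origin.\<close>

lemma free_map_difference_inverse:
  assumes P: "free_poly_map N P" and inj: "inj_on (fmap_eval (n + n) P) (mat_tuples (n + n) N)"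
    and m: "m = N * n * n"
  defines "F \<equiv> \<lambda>k z. ent n (fmap_eval n P (tup n N z)) k"
  shows "\<exists>d \<Gamma>. (\<forall>k<m. \<forall>l<m. d k l \<in> polyfun UNIV (2 * m)) \<and> (\<forall>k<m. \<forall>l<m. \<Gamma> k l \<in> polyfun UNIV (2 * m)) \<and>
    (\<forall>x y h. \<forall>i<N. \<forall>a<n. \<forall>b<n. fdelta n (tup n N x) (tup n N y) (tup n N h) (P ! i) $$ (a, b)
      = (\<Sum>l<m. d ((i * n + a) * n + b) l (juxt m x y) * h l)) \<and>
    (\<forall>x y. \<forall>k<m. F k x - F k y = (\<Sum>l<m. d k l (juxt m x y) * (x l - y l))) \<and>
    (\<forall>x y. \<forall>k<m. x k - y k = (\<Sum>l<m. \<Gamma> k l (juxt m x y) * (F l x - F l y)))"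
proof -
  have PN: "\<And>j. j < N \<Longrightarrow> fvars (P ! j) \<subseteq> {..<N}" using P by (auto simp: free_poly_map_def)
  have "\<forall>i. \<exists>d. i < N \<longrightarrow> (\<forall>a<n. \<forall>b<n. \<forall>l<m. d a b l \<in> polyfun UNIV (2 * m)) \<and>
    (\<forall>x y h. \<forall>a<n. \<forall>b<n. fdelta n (tup n N x) (tup n N y) (tup n N h) (P ! i) $$ (a, b)
      = (\<Sum>l<m. d a b l (juxt m x y) * h l))"
    using fdelta_linear_polyfun[OF PN m] by blast
  from choice[OF this] obtain D where D': "\<forall>i. i < N \<longrightarrow> (\<forall>a<n. \<forall>b<n. \<forall>l<m. D i a b l \<in> polyfun UNIV (2 * m)) \<and>
    (\<forall>x y h. \<forall>a<n. \<forall>b<n. fdelta n (tup n N x) (tup n N y) (tup n N h) (P ! i) $$ (a, b)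
      = (\<Sum>l<m. D i a b l (juxt m x y) * h l))" ..
  note D = D'[rule_format, THEN conjunct1, rule_format] D'[rule_format, THEN conjunct2, rule_format]
  define d where "d k = D (k div n div n) (k div n mod n) (k mod n)" for k
  have d: "d ((i * n + a) * n + b) = D i a b" if "a < n" "b < n" for i a b
    using that by (simp add: d_def)
  have dp: "d k l \<in> polyfun UNIV (2 * m)" if k: "k < m" and l: "l < m" for k l
  proof -
    obtain i a b where i: "i < N" "a < n" "b < n" "k = (i * n + a) * n + b"
      using k unfolding m by (rule index_cases)
    show ?thesis using D(1)[OF i(1-3) l] d[OF i(2,3)] i(4) by simp
  qed
  have dl: "fdelta n (tup n N x) (tup n N y) (tup n N h) (P ! i) $$ (a, b)
      = (\<Sum>l<m. d ((i * n + a) * n + b) l (juxt m x y) * h l)" if "i < N" "a < n" "b < n" for x y h i a b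
    using that by (simp add: d D)
  have diff: "F k x - F k y = (\<Sum>l<m. d k l (juxt m x y) * (x l - y l))" if k: "k < m" for k x y
  proof -
    obtain i a b where i: "i < N" "a < n" "b < n" "k = (i * n + a) * n + b"
      using k unfolding m by (rule index_cases)
    have "fdelta n (tup n N x) (tup n N y) (tup n N (\<lambda>l. x l - y l)) (P ! i)
      = feval n (tup n N x) (P ! i) - feval n (tup n N y) (P ! i)"
      by (rule feval_diff_eq_fdelta[OF tup_in tup_in PN[OF i(1)] tup_in]) (auto simp: tup_def intro!: eq_matI)
    hence "(feval n (tup n N x) (P ! i) - feval n (tup n N y) (P ! i)) $$ (a, b)
      = (\<Sum>l<m. d k l (juxt m x y) * (x l - y l))" using dl[OF i(1-3)] i(4) by metis
    thus ?thesis using feval_carrier[OF tup_in PN[OF i(1)], of n x] feval_carrier[OF tup_in PN[OF i(1)], of n y] i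
      by (simp add: F_def fmap_eval_index[OF P])
  qed
  have "h j = 0" if h: "\<And>k. k < m \<Longrightarrow> (\<Sum>l<m. d k l z * h l) = 0" and j: "j < m" for z h j
  proof -
    \<comment> \<open>The matrix \<open>d\<close> must be injective at every point of the doubled
      space; the two halves of \<open>z\<close> supply arbitrary \<open>X\<close> and
      \<open>Y\<close>.\<close>
    have z: "juxt m z (\<lambda>k. z (m + k)) = z" by (auto simp: juxt_def)
    obtain i a b where i: "i < N" "a < n" "b < n" "j = (i * n + a) * n + b"
      using j unfolding m by (rule index_cases)
    have "tup n N h ! i = 0\<^sub>m n n"
    proof (rule fdelta_injective[OF P inj tup_in tup_in tup_in _ i(1)])
      fix i' assume i': "i' < N"
      show "fdelta n (tup n N z) (tup n N (\<lambda>k. z (m + k))) (tup n N h) (P ! i') = 0\<^sub>m n n"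
        using fdelta_carrier[OF tup_in tup_in tup_in PN[OF i'], of n z "\<lambda>k. z (m + k)" h] i'
        by (intro eq_matI) (auto simp: dl m z[unfolded m] intro!: h[unfolded m] index_less)
    qed
    thus ?thesis using tup_entry[OF i(1-3), of h] i by simp
  qed
  then obtain \<Gamma> where \<Gamma>: "\<forall>k<m. \<forall>l<m. \<Gamma> k l \<in> polyfun UNIV (2 * m)"
    "\<forall>z. \<forall>i<m. \<forall>k<m. (\<Sum>j<m. \<Gamma> i j z * d j k z) = (if i = k then 1 else 0)"
    using polyfun_inverse_matrix[of m d "2 * m"] dp by blast
  have inv: "x k - y k = (\<Sum>l<m. \<Gamma> k l (juxt m x y) * (F l x - F l y))" if k: "k < m" for k x y
  proof -
    have "(\<Sum>l<m. \<Gamma> k l (juxt m x y) * (F l x - F l y))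
      = (\<Sum>l<m. \<Sum>j<m. \<Gamma> k l (juxt m x y) * d l j (juxt m x y) * (x j - y j))"
      by (simp add: diff sum_distrib_left mult.assoc)
    also have "\<dots> = (\<Sum>j<m. \<Sum>l<m. \<Gamma> k l (juxt m x y) * d l j (juxt m x y) * (x j - y j))"
      by (rule sum.swap)
    also have "\<dots> = (\<Sum>j<m. (if k = j then 1 else 0) * (x j - y j))"
      using \<Gamma>(2) k by (simp flip: sum_distrib_right)
    also have "\<dots> = x k - y k" using k by (simp add: if_distrib[of "\<lambda>x. x * _"] cong: if_cong)
    finally show ?thesis by simp
  qed
  show ?thesis
    by (intro exI[of _ d] exI[of _ \<Gamma>] conjI allI impI)
      (assumption | rule dp \<Gamma>(1)[rule_format] dl diff inv)+
qed

section \<open>Free polynomial approximations of the inverse\<close>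

text \<open>Polynomial functions of \<open>t\<close> that vanish to order at least \<open>k\<close> at \<open>0\<close>.\<close>

definition ord_at_0 :: "nat \<Rightarrow> (complex \<Rightarrow> complex) set" where
  "ord_at_0 k = {f. \<exists>p. \<forall>t. f t = t ^ k * poly p t}"

lemma ord_at_0_add: "f \<in> ord_at_0 k \<Longrightarrow> g \<in> ord_at_0 k \<Longrightarrow> (\<lambda>t. f t + g t) \<in> ord_at_0 k"
  unfolding ord_at_0_def
proof (elim CollectE exE, intro CollectI)
  fix p q assume "\<forall>t. f t = t ^ k * poly p t" "\<forall>t. g t = t ^ k * poly q t"
  thus "\<exists>r. \<forall>t. f t + g t = t ^ k * poly r t" by (intro exI[of _ "p + q"]) (simp add: algebra_simps)
qed

lemma ord_at_0_mult: "f \<in> ord_at_0 k \<Longrightarrow> g \<in> ord_at_0 l \<Longrightarrow> (\<lambda>t. f t * g t) \<in> ord_at_0 (k + l)"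
  unfolding ord_at_0_def
proof (elim CollectE exE, intro CollectI)
  fix p q assume "\<forall>t. f t = t ^ k * poly p t" "\<forall>t. g t = t ^ l * poly q t"
  thus "\<exists>r. \<forall>t. f t * g t = t ^ (k + l) * poly r t" by (intro exI[of _ "p * q"]) (simp add: power_add)
qed

lemma ord_at_0_mono: "f \<in> ord_at_0 k \<Longrightarrow> l \<le> k \<Longrightarrow> f \<in> ord_at_0 l"
  unfolding ord_at_0_def
proof (elim CollectE exE, intro CollectI)
  fix p assume "\<forall>t. f t = t ^ k * poly p t" "l \<le> k"
  thus "\<exists>r. \<forall>t. f t = t ^ l * poly r t"
    by (intro exI[of _ "monom 1 (k - l) * p"]) (simp add: poly_monom mult.assoc[symmetric] flip: power_add)
qed

lemma ord_at_0_zero: "(\<lambda>_. 0) \<in> ord_at_0 k"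
  unfolding ord_at_0_def by (auto intro: exI[of _ 0])

lemma ord_at_0_const: "(\<lambda>_. c) \<in> ord_at_0 0"
  unfolding ord_at_0_def by (auto intro: exI[of _ "[:c:]"])

lemma ord_at_0_poly: "poly p \<in> ord_at_0 0"
  unfolding ord_at_0_def by auto

lemma ord_at_0_cmult: "f \<in> ord_at_0 k \<Longrightarrow> (\<lambda>t. c * f t) \<in> ord_at_0 k"
  using ord_at_0_mult[OF ord_at_0_const] by simp

lemma ord_at_0_diff: "f \<in> ord_at_0 k \<Longrightarrow> g \<in> ord_at_0 k \<Longrightarrow> (\<lambda>t. f t - g t) \<in> ord_at_0 k"
  using ord_at_0_add[OF _ ord_at_0_cmult[of g k "-1"], of f] by simp

lemma ord_at_0_sum: "(\<And>i. i \<in> S \<Longrightarrow> f i \<in> ord_at_0 k) \<Longrightarrow> (\<lambda>t. \<Sum>i\<in>S. f i t) \<in> ord_at_0 k"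
  by (induction S rule: infinite_finite_induct) (auto intro: ord_at_0_add ord_at_0_zero)

lemma ord_at_0_coeff:
  assumes "poly p \<in> ord_at_0 k" "j < k"
  shows "coeff p j = 0"
proof -
  obtain q where "\<forall>t. poly p t = t ^ k * poly q t" using assms(1) unfolding ord_at_0_def by blast
  hence "poly p = poly (monom 1 k * q)" by (auto simp: poly_monom)
  hence "p = monom 1 k * q" using poly_eq_poly_eq_iff by blast
  thus ?thesis using assms(2) by (simp add: coeff_monom_mult)
qed

lemma ord_at_0_all_imp_zero:
  assumes "\<And>k. f \<in> ord_at_0 k"
  shows "f t = 0"
proof -
  obtain p where p: "f = poly p" using assms[of 0] unfolding ord_at_0_def by auto
  have "coeff p j = 0" for j using ord_at_0_coeff[of p "Suc j" j] assms p by simp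
  hence "p = 0" by (simp add: poly_eq_iff)
  thus ?thesis by (simp add: p)
qed

lemma polyfun_ord_at_0:
  assumes f: "f \<in> polyfun A M" and uw: "\<And>k. k < M \<Longrightarrow> (\<lambda>t. u t k) \<in> ord_at_0 0"
  shows "(\<lambda>t. f (u t)) \<in> ord_at_0 0"
  using f by induction (use uw ord_at_0_mult[of _ 0 _ 0] in \<open>auto intro: ord_at_0_add ord_at_0_const\<close>)

text \<open>The telescoping used for congruence modulo an ideal, now with the multiples of
  \<open>t ^ r\<close>.\<close>

lemma polyfun_cong_ord_at_0:
  assumes f: "f \<in> polyfun A M" and uw: "\<And>k. k < M \<Longrightarrow> (\<lambda>t. u t k) \<in> ord_at_0 0" "\<And>k. k < M \<Longrightarrow> (\<lambda>t. w t k) \<in> ord_at_0 0"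
    and d: "\<And>k. k < M \<Longrightarrow> (\<lambda>t. u t k - w t k) \<in> ord_at_0 r"
  shows "(\<lambda>t. f (u t) - f (w t)) \<in> ord_at_0 r"
  using f
proof induction
  case (const c)
  show ?case by (simp add: ord_at_0_zero)
next
  case (var k)
  thus ?case using d by simp
next
  case (add f g)
  have "(\<lambda>t. (f (u t) - f (w t)) + (g (u t) - g (w t))) \<in> ord_at_0 r" by (intro ord_at_0_add add)
  thus ?case by (simp add: algebra_simps)
next
  case (mult f g)
  have "(\<lambda>t. f (u t)) \<in> ord_at_0 0" "(\<lambda>t. g (w t)) \<in> ord_at_0 0"
    using polyfun_ord_at_0[OF mult(1), of u] polyfun_ord_at_0[OF mult(2), of w] uw by auto
  from ord_at_0_mult[OF this(1) mult.IH(2)] ord_at_0_mult[OF this(2) mult.IH(1)]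
  have "(\<lambda>t. f (u t) * (g (u t) - g (w t)) + g (w t) * (f (u t) - f (w t))) \<in> ord_at_0 r"
    by (intro ord_at_0_add) simp_all
  thus ?case by (simp add: algebra_simps)
qed

section \<open>Substitution and sums in the free algebra\<close>

fun fsubst :: "fpoly list \<Rightarrow> fpoly \<Rightarrow> fpoly" where
  "fsubst Q (FConst c) = FConst c"
| "fsubst Q (FVar i) = Q ! i"
| "fsubst Q (FAdd p q) = FAdd (fsubst Q p) (fsubst Q q)"
| "fsubst Q (FMul p q) = FMul (fsubst Q p) (fsubst Q q)"

definition fsum :: "fpoly list \<Rightarrow> fpoly" where
  "fsum ps = foldr FAdd ps (FConst 0)"

lemma feval_fsubst:
  "fvars p \<subseteq> {..<length Q} \<Longrightarrow> feval n X (fsubst Q p) = feval n (fmap_eval n Q X) p"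
  by (induction p) (auto simp: fmap_eval_def)

lemma fvars_fsubst:
  assumes "free_poly_map N Q" "fvars p \<subseteq> {..<N}"
  shows "fvars (fsubst Q p) \<subseteq> {..<N}"
  using assms(2) by (induction p) (use assms(1) in \<open>auto simp: free_poly_map_def\<close>)

lemma fvars_fsum: "(\<And>p. p \<in> set ps \<Longrightarrow> fvars p \<subseteq> V) \<Longrightarrow> fvars (fsum ps) \<subseteq> V"
  unfolding fsum_def by (induction ps) auto

lemma feval_fsum:
  assumes X: "X \<in> mat_tuples n N" and "\<And>p. p \<in> set ps \<Longrightarrow> fvars p \<subseteq> {..<N}" "a < n" "b < n"
  shows "feval n X (fsum ps) $$ (a, b) = (\<Sum>p\<leftarrow>ps. feval n X p $$ (a, b))"
  using assms(2)
proof (induction ps)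
  case Nil
  show ?case using assms(3,4) by (simp add: fsum_def)
next
  case (Cons p ps)
  have "feval n X (fsum ps) \<in> carrier_mat n n"
    by (intro feval_carrier[OF X] fvars_fsum) (use Cons.prems in auto)
  thus ?case using Cons assms(3,4) by (simp add: fsum_def)
qed

lemma feval_add_entry:
  assumes "X \<in> mat_tuples n N" "fvars q \<subseteq> {..<N}" "a < n" "b < n"
  shows "feval n X (FAdd p q) $$ (a, b) = feval n X p $$ (a, b) + feval n X q $$ (a, b)"
  using feval_carrier[OF assms(1,2)] assms(3,4) by auto

lemma feval_cmul_entry:
  assumes "X \<in> mat_tuples n N" "fvars q \<subseteq> {..<N}" "a < n" "b < n"
  shows "feval n X (FMul (FConst c) q) $$ (a, b) = c * feval n X q $$ (a, b)"
proof -
  have q: "feval n X q \<in> carrier_mat n n" by (rule feval_carrier[OF assms(1,2)])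
  have "(c \<cdot>\<^sub>m 1\<^sub>m n) * feval n X q = c \<cdot>\<^sub>m feval n X q"
    using q by (simp add: mult_smult_assoc_mat[of _ n n])
  thus ?thesis using q assms(3,4) by simp
qed

section \<open>The linear part at the origin\<close>

fun fcoeff0 :: "fpoly \<Rightarrow> complex" where
  "fcoeff0 (FConst c) = c"
| "fcoeff0 (FVar i) = 0"
| "fcoeff0 (FAdd p q) = fcoeff0 p + fcoeff0 q"
| "fcoeff0 (FMul p q) = fcoeff0 p * fcoeff0 q"

fun fcoeff1 :: "nat \<Rightarrow> fpoly \<Rightarrow> complex" where
  "fcoeff1 i (FConst c) = 0"
| "fcoeff1 i (FVar j) = (if i = j then 1 else 0)"
| "fcoeff1 i (FAdd p q) = fcoeff1 i p + fcoeff1 i q"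
| "fcoeff1 i (FMul p q) = fcoeff0 p * fcoeff1 i q + fcoeff1 i p * fcoeff0 q"

lemma feval_zero:
  assumes "fvars p \<subseteq> {..<N}"
  shows "feval n (tup n N (\<lambda>_. 0)) p = fcoeff0 p \<cdot>\<^sub>m 1\<^sub>m n"
  using assms
proof (induction p)
  case (FVar i)
  thus ?case by (auto simp: tup_def intro!: eq_matI)
next
  case (FAdd p q)
  thus ?case by (auto intro!: eq_matI simp: distrib_right)
next
  case (FMul p q)
  hence "feval n (tup n N (\<lambda>_. 0)) (FMul p q) = (fcoeff0 p \<cdot>\<^sub>m 1\<^sub>m n) * (fcoeff0 q \<cdot>\<^sub>m 1\<^sub>m n)" by simp
  also have "\<dots> = fcoeff0 p \<cdot>\<^sub>m (fcoeff0 q \<cdot>\<^sub>m 1\<^sub>m n)"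
    by (subst mult_smult_assoc_mat[of _ n n _ n]) auto
  also have "\<dots> = fcoeff0 (FMul p q) \<cdot>\<^sub>m 1\<^sub>m n" by (auto intro!: eq_matI)
  finally show ?case .
qed simp

text \<open>At the origin every polynomial takes a scalar matrix as value, and scalars commute past
  \<open>H\<close>. The derivative there is thus an \<open>N\<close> by \<open>N\<close> matrix of
  numbers acting on the components of \<open>H\<close>, the same for all sizes; this is why a Newton
  step can be written in the free algebra.\<close>

lemma fdelta_zero:
  assumes "fvars p \<subseteq> {..<N}" "H \<in> mat_tuples n N" "a < n" "b < n"
  shows "fdelta n (tup n N (\<lambda>_. 0)) (tup n N (\<lambda>_. 0)) H p $$ (a, b) = (\<Sum>i<N. fcoeff1 i p * H ! i $$ (a, b))"
  using assms(1)
proof (induction p)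
  case (FConst c)
  thus ?case using assms by simp
next
  case (FVar i)
  thus ?case by (simp add: if_distrib[of "\<lambda>x. x * _"] cong: if_cong)
next
  case (FAdd p q)
  hence "fdelta n (tup n N (\<lambda>_. 0)) (tup n N (\<lambda>_. 0)) H q \<in> carrier_mat n n"
    by (intro fdelta_carrier[OF tup_in tup_in assms(2)]) simp
  thus ?case using FAdd assms(3,4) by (simp add: distrib_right sum.distrib)
next
  case (FMul p q)
  let ?O = "tup n N (\<lambda>_. 0)"
  have pq: "fvars p \<subseteq> {..<N}" "fvars q \<subseteq> {..<N}" using FMul.prems by auto
  note c = fdelta_carrier[OF tup_in tup_in assms(2) pq(1), of "\<lambda>_. 0" "\<lambda>_. 0"]
    fdelta_carrier[OF tup_in tup_in assms(2) pq(2), of "\<lambda>_. 0" "\<lambda>_. 0"]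
  have "fdelta n ?O ?O H (FMul p q)
    = (fcoeff0 p \<cdot>\<^sub>m 1\<^sub>m n) * fdelta n ?O ?O H q + fdelta n ?O ?O H p * (fcoeff0 q \<cdot>\<^sub>m 1\<^sub>m n)"
    using feval_zero[OF pq(1)] feval_zero[OF pq(2)] by simp
  also have "\<dots> = fcoeff0 p \<cdot>\<^sub>m fdelta n ?O ?O H q + fcoeff0 q \<cdot>\<^sub>m fdelta n ?O ?O H p"
    using c by (simp add: mult_smult_assoc_mat[of _ n n] mult_smult_distrib[of _ n n _ n])
  finally show ?case
    using FMul.IH pq c assms(3,4) by (simp add: sum_distrib_left sum.distrib algebra_simps)
qed

lemma linear_part_invertible:
  assumes P: "free_poly_map N P" and inj: "inj_on (fmap_eval (n + n) P) (mat_tuples (n + n) N)" and n: "n \<ge> 1"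
  shows "\<exists>B. \<forall>j<N. \<forall>l<N. (\<Sum>i<N. fcoeff1 i (P ! j) * B i l) = (if j = l then 1 else 0)"
proof -
  define J where "J = mat N N (\<lambda>(j, i). fcoeff1 i (P ! j))"
  have J: "J \<in> carrier_mat N N" by (simp add: J_def)
  have PN: "\<And>j. j < N \<Longrightarrow> fvars (P ! j) \<subseteq> {..<N}" using P by (auto simp: free_poly_map_def)
  have "det J \<noteq> 0"
  proof
    assume "det J = 0"
    then obtain v where v: "v \<in> carrier_vec N" "v \<noteq> 0\<^sub>v N" "J *\<^sub>v v = 0\<^sub>v N"
      using det_0_iff_vec_prod_zero_field[OF J] by blast
    \<comment> \<open>A kernel vector of the linear part becomes a direction of scalar matrices that
      the difference quotient at the origin kills.\<close>
    define H where "H = map (\<lambda>i. v $ i \<cdot>\<^sub>m (1\<^sub>m n :: complex mat)) [0..<N]"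
    have H: "H \<in> mat_tuples n N" by (auto simp: H_def mat_tuples_def)
    have "v $ i = 0" if i: "i < N" for i
    proof -
      have "H ! i = 0\<^sub>m n n"
      proof (rule fdelta_injective[OF P inj tup_in tup_in H _ i])
        fix j assume j: "j < N"
        have "(J *\<^sub>v v) $ j = 0" using v(3) j by simp
        hence 0: "(\<Sum>i<N. fcoeff1 i (P ! j) * v $ i) = 0"
          using j v(1) by (simp add: J_def scalar_prod_def lessThan_atLeast0)
        show "fdelta n (tup n N (\<lambda>_. 0)) (tup n N (\<lambda>_. 0)) H (P ! j) = 0\<^sub>m n n"
        proof (rule eq_matI)
          fix a b assume "a < dim_row (0\<^sub>m n n :: complex mat)" "b < dim_col (0\<^sub>m n n :: complex mat)"
          hence ab: "a < n" "b < n" by auto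
          have "(\<Sum>i<N. fcoeff1 i (P ! j) * H ! i $$ (a, b))
            = (\<Sum>i<N. fcoeff1 i (P ! j) * v $ i) * (if a = b then 1 else 0)"
            using ab by (simp add: H_def)
          thus "fdelta n (tup n N (\<lambda>_. 0)) (tup n N (\<lambda>_. 0)) H (P ! j) $$ (a, b) = 0\<^sub>m n n $$ (a, b)"
            using fdelta_zero[OF PN[OF j] H ab] 0 ab by simp
        qed (use fdelta_carrier[OF tup_in tup_in H PN[OF j], of "\<lambda>_. 0" "\<lambda>_. 0"] in auto)
      qed
      hence "H ! i $$ (0, 0) = 0" using n by simp
      thus ?thesis using n i by (simp add: H_def)
    qed
    hence "v = 0\<^sub>v N" using v(1) by (intro eq_vecI) auto
    thus False using v(2) by simp
  qed
  define B where "B i l = adj_mat J $$ (i, l) / det J" for i l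
  note adj = adj_mat[OF J]
  have "(\<Sum>i<N. fcoeff1 i (P ! j) * B i l) = (if j = l then 1 else 0)" if jl: "j < N" "l < N" for j l
  proof -
    have "(\<Sum>i<N. fcoeff1 i (P ! j) * adj_mat J $$ (i, l)) = (J * adj_mat J) $$ (j, l)"
      using jl by (simp add: mat_mult_entry[OF J adj(1)]) (simp add: J_def)
    also have "\<dots> = (if j = l then det J else 0)" using adj(2) jl by simp
    finally show ?thesis using \<open>det J \<noteq> 0\<close> by (simp add: B_def flip: sum_divide_distrib)
  qed
  thus ?thesis by blast
qed

section \<open>Homogeneous components\<close>

fun fhom :: "nat \<Rightarrow> fpoly \<Rightarrow> fpoly" where
  "fhom j (FConst c) = FConst (if j = 0 then c else 0)"
| "fhom j (FVar i) = (if j = 1 then FVar i else FConst 0)"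
| "fhom j (FAdd p q) = FAdd (fhom j p) (fhom j q)"
| "fhom j (FMul p q) = fsum (map (\<lambda>i. FMul (fhom i p) (fhom (j - i) q)) [0..<Suc j])"

lemma fvars_fhom: "fvars (fhom j p) \<subseteq> fvars p"
proof (induction p arbitrary: j)
  case (FMul p q)
  show ?case unfolding fhom.simps
    by (rule fvars_fsum) (auto dest!: subsetD[OF FMul.IH(1)] subsetD[OF FMul.IH(2)])
qed (auto split: if_splits)

text \<open>Scaling all variables by \<open>t\<close> multiplies the component of degree
  \<open>j\<close> by \<open>t ^ j\<close>, so components are read off as coefficients.\<close>

lemma feval_fhom:
  assumes "fvars p \<subseteq> {..<N}" "a < n" "b < n"
  shows "\<exists>q. (\<forall>j. coeff q j = feval n (tup n N V) (fhom j p) $$ (a, b)) \<and>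
    (\<forall>t. feval n (tup n N (\<lambda>k. t * V k)) p $$ (a, b) = poly q t)"
  using assms
proof (induction p arbitrary: a b)
  case (FConst c)
  thus ?case by (intro exI[of _ "[:c * (if a = b then 1 else 0):]"]) (auto simp: coeff_pCons split: nat.splits)
next
  case (FVar i)
  thus ?case by (intro exI[of _ "[:0, V ((i * n + a) * n + b):]"])
    (auto simp: tup_entry coeff_pCons split: nat.splits)
next
  case (FAdd p q)
  have pq: "fvars p \<subseteq> {..<N}" "fvars q \<subseteq> {..<N}" using FAdd.prems by auto
  obtain f g where "\<forall>j. coeff f j = feval n (tup n N V) (fhom j p) $$ (a, b)"
    "\<forall>t. feval n (tup n N (\<lambda>k. t * V k)) p $$ (a, b) = poly f t"
    "\<forall>j. coeff g j = feval n (tup n N V) (fhom j q) $$ (a, b)"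
    "\<forall>t. feval n (tup n N (\<lambda>k. t * V k)) q $$ (a, b) = poly g t"
    using FAdd.IH(1)[OF pq(1) FAdd.prems(2,3)] FAdd.IH(2)[OF pq(2) FAdd.prems(2,3)] by blast
  moreover have "fvars (fhom j q) \<subseteq> {..<N}" for j using fvars_fhom pq by blast
  ultimately show ?case
    using feval_add_entry[OF tup_in _ FAdd.prems(2,3)] pq by (intro exI[of _ "f + g"]) auto
next
  case (FMul p q)
  have pq: "fvars p \<subseteq> {..<N}" "fvars q \<subseteq> {..<N}" using FMul.prems by auto
  have h: "fvars (fhom j p) \<subseteq> {..<N}" "fvars (fhom j q) \<subseteq> {..<N}" for j using fvars_fhom pq by blast+
  have "\<forall>c. \<exists>f. c < n \<longrightarrow> (\<forall>j. coeff f j = feval n (tup n N V) (fhom j p) $$ (a, c)) \<and>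
    (\<forall>t. feval n (tup n N (\<lambda>k. t * V k)) p $$ (a, c) = poly f t)"
    using FMul.IH(1)[OF pq(1) FMul.prems(2)] by blast
  from choice[OF this] obtain f where f: "\<forall>c. c < n \<longrightarrow> (\<forall>j. coeff (f c) j = feval n (tup n N V) (fhom j p) $$ (a, c)) \<and>
    (\<forall>t. feval n (tup n N (\<lambda>k. t * V k)) p $$ (a, c) = poly (f c) t)" ..
  have "\<forall>c. \<exists>f. c < n \<longrightarrow> (\<forall>j. coeff f j = feval n (tup n N V) (fhom j q) $$ (c, b)) \<and>
    (\<forall>t. feval n (tup n N (\<lambda>k. t * V k)) q $$ (c, b) = poly f t)"
    using FMul.IH(2)[OF pq(2) _ FMul.prems(3)] by blast
  from choice[OF this] obtain g where g: "\<forall>c. c < n \<longrightarrow> (\<forall>j. coeff (g c) j = feval n (tup n N V) (fhom j q) $$ (c, b)) \<and>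
    (\<forall>t. feval n (tup n N (\<lambda>k. t * V k)) q $$ (c, b) = poly (g c) t)" ..
  have "coeff (\<Sum>c<n. f c * g c) j = feval n (tup n N V) (fhom j (FMul p q)) $$ (a, b)" for j
  proof -
    have "coeff (\<Sum>c<n. f c * g c) j = (\<Sum>c<n. \<Sum>i\<le>j. feval n (tup n N V) (fhom i p) $$ (a, c) * feval n (tup n N V) (fhom (j - i) q) $$ (c, b))"
      using f g by (simp add: coeff_sum coeff_mult)
    also have "\<dots> = (\<Sum>i\<le>j. \<Sum>c<n. feval n (tup n N V) (fhom i p) $$ (a, c) * feval n (tup n N V) (fhom (j - i) q) $$ (c, b))"
      by (rule sum.swap)
    also have "\<dots> = (\<Sum>i\<le>j. feval n (tup n N V) (FMul (fhom i p) (fhom (j - i) q)) $$ (a, b))"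
      using FMul.prems(2,3) by (simp add: mat_mult_entry[OF feval_carrier[OF tup_in h(1)] feval_carrier[OF tup_in h(2)]])
    also have "\<dots> = (\<Sum>p\<leftarrow>map (\<lambda>i. FMul (fhom i p) (fhom (j - i) q)) [0..<Suc j]. feval n (tup n N V) p $$ (a, b))"
      by (simp add: comp_def interv_sum_list_conv_sum_set_nat atLeast0LessThan lessThan_Suc_atMost
        del: upt_Suc feval.simps)
    also have "\<dots> = feval n (tup n N V) (fhom j (FMul p q)) $$ (a, b)"
      unfolding fhom.simps by (rule feval_fsum[OF tup_in _ FMul.prems(2,3), symmetric])
        (auto dest!: subsetD[OF h(1)] subsetD[OF h(2)])
    finally show ?thesis .
  qed
  moreover have "feval n (tup n N (\<lambda>k. t * V k)) (FMul p q) $$ (a, b) = poly (\<Sum>c<n. f c * g c) t" for t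
    using FMul.prems(2,3) f g
    by (simp add: mat_mult_entry[OF feval_carrier[OF tup_in pq(1)] feval_carrier[OF tup_in pq(2)]] poly_sum)
  ultimately show ?case by blast
qed

text \<open>Newton's method for \<open>P(Z) = x\<close> with the derivative frozen at the origin:
  the residual \<open>x - P(Z)\<close> is corrected by \<open>B\<close>, the inverse of the linear
  part. The variables are the target value.\<close>

definition newton_step :: "nat \<Rightarrow> (nat \<Rightarrow> nat \<Rightarrow> complex) \<Rightarrow> fpoly list \<Rightarrow> fpoly list \<Rightarrow> fpoly list" where
  "newton_step N B P Z = map (\<lambda>i. FAdd (Z ! i) (fsum (map (\<lambda>j.
     FMul (FConst (B i j)) (FAdd (FVar j) (FMul (FConst (-1)) (fsubst Z (P ! j))))) [0..<N]))) [0..<N]"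

primrec newton :: "nat \<Rightarrow> (nat \<Rightarrow> nat \<Rightarrow> complex) \<Rightarrow> fpoly list \<Rightarrow> nat \<Rightarrow> fpoly list" where
  "newton N B P 0 = replicate N (FConst 0)"
| "newton N B P (Suc k) = newton_step N B P (newton N B P k)"

lemma free_poly_mapD: "free_poly_map N P \<Longrightarrow> j < N \<Longrightarrow> fvars (P ! j) \<subseteq> {..<N}"
  by (auto simp: free_poly_map_def)

lemma fvars_newton_increment:
  assumes "free_poly_map N P" "free_poly_map N Z" "j < N"
  shows "fvars (FMul (FConst (B i j)) (FAdd (FVar j) (FMul (FConst (-1)) (fsubst Z (P ! j))))) \<subseteq> {..<N}"
  using fvars_fsubst[OF assms(2) free_poly_mapD[OF assms(1,3)]] assms(3) by simp

lemma free_newton_step: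
  assumes "free_poly_map N P" "free_poly_map N Z"
  shows "free_poly_map N (newton_step N B P Z)"
proof -
  have "fvars (newton_step N B P Z ! i) \<subseteq> {..<N}" if i: "i < N" for i
  proof -
    have "fvars (fsum (map (\<lambda>j. FMul (FConst (B i j)) (FAdd (FVar j) (FMul (FConst (-1)) (fsubst Z (P ! j))))) [0..<N])) \<subseteq> {..<N}"
      using fvars_newton_increment[OF assms, of _ B i] by (intro fvars_fsum) force
    thus ?thesis using i free_poly_mapD[OF assms(2) i] by (simp add: newton_step_def)
  qed
  thus ?thesis by (auto simp: free_poly_map_def in_set_conv_nth newton_step_def)
qed

lemma free_newton: "free_poly_map N P \<Longrightarrow> free_poly_map N (newton N B P k)"
proof (induction k)
  case 0
  show ?case by (simp add: free_poly_map_def)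
qed (simp add: free_newton_step)

lemma newton_step_entry:
  assumes P: "free_poly_map N P" and Z: "free_poly_map N Z" and X: "X \<in> mat_tuples n N"
    and i: "i < N" and ab: "a < n" "b < n"
  shows "feval n X (newton_step N B P Z ! i) $$ (a, b) = feval n X (Z ! i) $$ (a, b)
    + (\<Sum>j<N. B i j * (X ! j $$ (a, b) - feval n (fmap_eval n Z X) (P ! j) $$ (a, b)))"
proof -
  define inc where "inc j = FMul (FConst (B i j)) (FAdd (FVar j) (FMul (FConst (-1)) (fsubst Z (P ! j))))" for j
  have inc: "fvars (inc j) \<subseteq> {..<N}" if "j < N" for j
    unfolding inc_def by (rule fvars_newton_increment[OF P Z that])
  have "feval n X (inc j) $$ (a, b) = B i j * (X ! j $$ (a, b) - feval n (fmap_eval n Z X) (P ! j) $$ (a, b))"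
    if j: "j < N" for j
  proof -
    have s: "fvars (fsubst Z (P ! j)) \<subseteq> {..<N}" by (rule fvars_fsubst[OF Z free_poly_mapD[OF P j]])
    hence s': "fvars (FMul (FConst (-1)) (fsubst Z (P ! j))) \<subseteq> {..<N}"
      "fvars (FAdd (FVar j) (FMul (FConst (-1)) (fsubst Z (P ! j)))) \<subseteq> {..<N}" using j by auto
    have "feval n X (fsubst Z (P ! j)) = feval n (fmap_eval n Z X) (P ! j)"
      using feval_fsubst free_poly_mapD[OF P j] Z by (simp add: free_poly_map_def)
    thus ?thesis unfolding inc_def
      by (simp only: feval_cmul_entry[OF X s'(2) ab] feval_add_entry[OF X s'(1) ab]
        feval_cmul_entry[OF X s ab] feval.simps(2)) simp
  qed
  hence "feval n X (fsum (map inc [0..<N])) $$ (a, b)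
    = (\<Sum>j<N. B i j * (X ! j $$ (a, b) - feval n (fmap_eval n Z X) (P ! j) $$ (a, b)))"
    using feval_fsum[OF X _ ab, of "map inc [0..<N]"] inc
    by (auto simp: comp_def interv_sum_list_conv_sum_set_nat atLeast0LessThan)
  moreover have "fvars (fsum (map inc [0..<N])) \<subseteq> {..<N}"
    using inc by (intro fvars_fsum) force
  ultimately show ?thesis
    using feval_add_entry[OF X _ ab, of "fsum (map inc [0..<N])" "Z ! i"] i
    by (simp add: newton_step_def inc_def[abs_def] del: feval.simps)
qed

definition shift :: "nat \<Rightarrow> (nat \<Rightarrow> complex) \<Rightarrow> fpoly list" where
  "shift N c = map (\<lambda>j. FAdd (FVar j) (FConst (c j))) [0..<N]"

lemma free_shift: "free_poly_map N (shift N c)"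
  by (auto simp: free_poly_map_def shift_def)

text \<open>Adding a constant to a variable moves only the diagonal entries, which are those with
  equal row \<open>k div n mod n\<close> and column \<open>k mod n\<close>.\<close>

lemma fmap_eval_shift:
  "fmap_eval n (shift N c) (tup n N z) = tup n N (\<lambda>k. z k + (if k div n mod n = k mod n then c (k div n div n) else 0))"
  by (auto simp: fmap_eval_def shift_def tup_def intro!: nth_equalityI eq_matI)

theorem free_inverse_at_size:
  assumes P: "free_poly_map N P" and inj: "inj_on (fmap_eval (n + n) P) (mat_tuples (n + n) N)" and n: "n \<ge> 1"
  shows "\<exists>Q. free_poly_map N Q \<and> (\<forall>Y\<in>mat_tuples n N. fmap_eval n P (fmap_eval n Q Y) = Y)"
proof -
  define m where "m = N * n * n"
  define F where "F k z = ent n (fmap_eval n P (tup n N z)) k" for k z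
  have F_index: "F ((i * n + a) * n + b) z = feval n (tup n N z) (P ! i) $$ (a, b)"
    if "i < N" "a < n" "b < n" for i a b z
    unfolding F_def by (rule fmap_eval_index[OF P that])
  obtain d \<Gamma> where dG: "\<forall>k<m. \<forall>l<m. d k l \<in> polyfun UNIV (2 * m)" "\<forall>k<m. \<forall>l<m. \<Gamma> k l \<in> polyfun UNIV (2 * m)"
    "\<forall>x y h. \<forall>i<N. \<forall>a<n. \<forall>b<n. fdelta n (tup n N x) (tup n N y) (tup n N h) (P ! i) $$ (a, b)
      = (\<Sum>l<m. d ((i * n + a) * n + b) l (juxt m x y) * h l)"
    "\<forall>x y. \<forall>k<m. F k x - F k y = (\<Sum>l<m. d k l (juxt m x y) * (x l - y l))"
    "\<forall>x y. \<forall>k<m. x k - y k = (\<Sum>l<m. \<Gamma> k l (juxt m x y) * (F l x - F l y))"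
    using free_map_difference_inverse[OF P inj m_def, folded F_def] by (elim exE conjE)
  have Fp: "F k \<in> polyfun UNIV m" if k: "k < m" for k
  proof -
    obtain i a b where i: "i < N" "a < n" "b < n" "k = (i * n + a) * n + b"
      using k unfolding m_def by (rule index_cases)
    have "F k = (\<lambda>z. feval n (tup n N z) (P ! i) $$ (a, b))" using F_index[OF i(1-3)] i(4) by auto
    thus ?thesis using polyfun_feval[OF free_poly_mapD[OF P i(1)] i(2,3)] by (simp add: m_def)
  qed
  have "\<exists>G. \<forall>i<m. G i \<in> polyfun UNIV m \<and> (\<forall>x. G i (\<lambda>j. F j x) = x i)"
    by (rule polynomial_left_inverse[where \<Gamma> = \<Gamma>]) (assumption | rule Fp dG(2,5)[rule_format])+
  then obtain G where G': "\<forall>i<m. G i \<in> polyfun UNIV m \<and> (\<forall>x. G i (\<lambda>j. F j x) = x i)" ..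
  have G: "G i \<in> polyfun UNIV m" "G i (\<lambda>j. F j x) = x i" if "i < m" for i x using G' that by auto
  obtain B where B: "\<forall>j<N. \<forall>l<N. (\<Sum>i<N. fcoeff1 i (P ! j) * B i l) = (if j = l then 1 else 0)"
    using linear_part_invertible[OF P inj n] by blast
  \<comment> \<open>The entries of \<open>P(0)\<close>, a tuple of scalar matrices.\<close>
  define c where "c k = (if k div n mod n = k mod n then fcoeff0 (P ! (k div n div n)) else 0)" for k
  have c: "F k (\<lambda>_. 0) = c k" if k: "k < m" for k
  proof -
    obtain i a b where i: "i < N" "a < n" "b < n" "k = (i * n + a) * n + b"
      using k unfolding m_def by (rule index_cases)
    thus ?thesis using F_index[OF i(1-3)] feval_zero[OF free_poly_mapD[OF P i(1)]] by (auto simp: c_def)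
  qed
  define Z where "Z k = newton N B P k" for k
  have Z: "free_poly_map N (Z k)" for k unfolding Z_def by (rule free_newton[OF P])
  define zz where "zz k y = ent n (fmap_eval n (Z k) (tup n N y))" for k y
  have tup_zz: "tup n N (zz k y) = fmap_eval n (Z k) (tup n N y)" for k y
    unfolding zz_def by (rule tup_ent[OF fmap_eval_in[OF Z tup_in]])
  have zz_index: "zz k y ((i * n + a) * n + b) = feval n (tup n N y) (Z k ! i) $$ (a, b)"
    if "i < N" "a < n" "b < n" for k y i a b
    unfolding zz_def by (rule fmap_eval_index[OF Z that])
  have zz0: "zz 0 y l = 0" if l: "l < m" for y l
  proof -
    obtain i a b where i: "i < N" "a < n" "b < n" "l = (i * n + a) * n + b"
      using l unfolding m_def by (rule index_cases)
    thus ?thesis by (simp add: zz_index Z_def)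
  qed
  have zz_Suc: "zz (Suc k) y ((i * n + a) * n + b) = zz k y ((i * n + a) * n + b)
      + (\<Sum>j<N. B i j * (y ((j * n + a) * n + b) - F ((j * n + a) * n + b) (zz k y)))"
    if i: "i < N" "a < n" "b < n" for k y i a b
  proof -
    have "feval n (tup n N y) (Z (Suc k) ! i) $$ (a, b) = feval n (tup n N y) (Z k ! i) $$ (a, b)
      + (\<Sum>j<N. B i j * (tup n N y ! j $$ (a, b) - feval n (fmap_eval n (Z k) (tup n N y)) (P ! j) $$ (a, b)))"
      using newton_step_entry[OF P Z tup_in i, where B = B] by (simp add: Z_def)
    thus ?thesis using i by (simp add: zz_index F_index tup_entry tup_zz)
  qed
  \<comment> \<open>Targets on a line through \<open>P(0)\<close>, where the starting value
    \<open>0\<close> of the iteration is exact.\<close>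
  define y where "y V t l = c l + t * V l" for V :: "nat \<Rightarrow> complex" and t l
  have y0: "(\<lambda>t. y V t l) \<in> ord_at_0 0" for V l
  proof -
    have "(\<lambda>t. y V t l) = poly [:c l, V l:]" by (simp add: y_def fun_eq_iff)
    thus ?thesis using ord_at_0_poly by metis
  qed
  have newton: "(\<forall>l<m. (\<lambda>t. zz k (y V t) l) \<in> ord_at_0 1) \<and>
      (\<forall>l<m. (\<lambda>t. y V t l - F l (zz k (y V t))) \<in> ord_at_0 (Suc k))" for k V
  proof (induction k)
    case 0
    have "y V t l - F l (zz 0 (y V t)) = t ^ 1 * poly [:V l:] t" if l: "l < m" for l t
      using polyfun_cong[OF Fp[OF l], of "zz 0 (y V t)" "\<lambda>_. 0"] zz0 c[OF l] by (simp add: y_def)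
    hence "(\<lambda>t. y V t l - F l (zz 0 (y V t))) \<in> ord_at_0 1" if "l < m" for l
      using that unfolding ord_at_0_def by blast
    thus ?case by (simp add: zz0 ord_at_0_zero)
  next
    case (Suc k)
    define z where "z t = zz k (y V t)" for t
    define z' where "z' t = zz (Suc k) (y V t)" for t
    define E where "E l t = y V t l - F l (z t)" for l t
    define h where "h t l = z' t l - z t l" for t l
    have z1: "(\<lambda>t. z t l) \<in> ord_at_0 1" and E1: "E l \<in> ord_at_0 (Suc k)" if "l < m" for l
      using Suc that by (auto simp: z_def E_def[abs_def])
    have h_index: "h t ((i * n + a) * n + b) = (\<Sum>j<N. B i j * E ((j * n + a) * n + b) t)"
      if "i < N" "a < n" "b < n" for i a b t
      using zz_Suc[OF that] by (simp add: h_def z'_def z_def E_def)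
    have h1: "(\<lambda>t. h t l) \<in> ord_at_0 (Suc k)" if l: "l < m" for l
    proof -
      obtain i a b where i: "i < N" "a < n" "b < n" "l = (i * n + a) * n + b"
        using l unfolding m_def by (rule index_cases)
      have "(\<lambda>t. \<Sum>j<N. B i j * E ((j * n + a) * n + b) t) \<in> ord_at_0 (Suc k)"
        using i by (intro ord_at_0_sum ord_at_0_cmult E1) (auto simp: m_def index_less)
      thus ?thesis using h_index[OF i(1-3)] i(4) by simp
    qed
    have z'1: "(\<lambda>t. z' t l) \<in> ord_at_0 1" if l: "l < m" for l
      using ord_at_0_add[OF z1[OF l] ord_at_0_mono[OF h1[OF l], of 1]] by (simp add: h_def)
    have zero: "juxt m (\<lambda>_. 0) (\<lambda>_. 0) = (\<lambda>_. 0)" by (auto simp: juxt_def)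
    have j1: "(\<lambda>t. juxt m (z' t) (z t) q) \<in> ord_at_0 1" if q: "q < 2 * m" for q
      using z1[of "q - m"] z'1[of q] q by (cases "q < m") (auto simp: juxt_def)
    have d1: "(\<lambda>t. d l l' (juxt m (z' t) (z t)) - d l l' (\<lambda>_. 0)) \<in> ord_at_0 1" if "l < m" "l' < m" for l l'
      using polyfun_cong_ord_at_0[OF dG(1)[rule_format, OF that], of "\<lambda>t. juxt m (z' t) (z t)" "\<lambda>_ _. 0" 1]
        j1 ord_at_0_mono[OF j1] ord_at_0_zero by simp
    \<comment> \<open>With \<open>d\<close> at the origin the increment \<open>h\<close> would
      remove the residual exactly, as \<open>B\<close> inverts the linear part. What is left is the
      deviation of \<open>d\<close>, of order one, times \<open>h\<close>, of order
      \<open>k + 1\<close>.\<close>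
    have "y V t l - F l (z' t) = 0 - (\<Sum>l'<m. (d l l' (juxt m (z' t) (z t)) - d l l' (\<lambda>_. 0)) * h t l')"
      if l: "l < m" for l t
    proof -
      obtain i a b where i: "i < N" "a < n" "b < n" "l = (i * n + a) * n + b"
        using l unfolding m_def by (rule index_cases)
      have "(\<Sum>l'<m. d l l' (\<lambda>_. 0) * h t l')
        = fdelta n (tup n N (\<lambda>_. 0)) (tup n N (\<lambda>_. 0)) (tup n N (h t)) (P ! i) $$ (a, b)"
        using dG(3) i zero by simp
      also have "\<dots> = (\<Sum>i'<N. fcoeff1 i' (P ! i) * (\<Sum>j<N. B i' j * E ((j * n + a) * n + b) t))"
        using fdelta_zero[OF free_poly_mapD[OF P i(1)] tup_in i(2,3), of "h t"] i
        by (simp add: tup_entry h_index)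
      also have "\<dots> = (\<Sum>i'<N. \<Sum>j<N. fcoeff1 i' (P ! i) * B i' j * E ((j * n + a) * n + b) t)"
        by (simp add: sum_distrib_left mult.assoc)
      also have "\<dots> = (\<Sum>j<N. \<Sum>i'<N. fcoeff1 i' (P ! i) * B i' j * E ((j * n + a) * n + b) t)"
        by (rule sum.swap)
      also have "\<dots> = (\<Sum>j<N. (if i = j then 1 else 0) * E ((j * n + a) * n + b) t)"
        using B i(1) by (simp flip: sum_distrib_right)
      also have "\<dots> = E l t" using i by (simp add: if_distrib[of "\<lambda>x. x * _"] cong: if_cong)
      finally have "(\<Sum>l'<m. d l l' (\<lambda>_. 0) * h t l') = E l t" .
      moreover have "F l (z' t) - F l (z t) = (\<Sum>l'<m. d l l' (juxt m (z' t) (z t)) * h t l')"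
        using dG(4) l by (simp add: h_def)
      ultimately have "(\<Sum>l'<m. (d l l' (juxt m (z' t) (z t)) - d l l' (\<lambda>_. 0)) * h t l') = F l (z' t) - F l (z t) - E l t"
        by (simp add: left_diff_distrib sum_subtractf)
      thus ?thesis by (simp add: E_def)
    qed
    moreover have "(\<lambda>t. 0 - (\<Sum>l'<m. (d l l' (juxt m (z' t) (z t)) - d l l' (\<lambda>_. 0)) * h t l')) \<in> ord_at_0 (Suc (Suc k))"
      if l: "l < m" for l
      using ord_at_0_mult[OF d1[OF l] h1] by (intro ord_at_0_diff ord_at_0_zero ord_at_0_sum) auto
    ultimately show ?case using z'1 by (simp add: z'_def)
  qed
  have zz1: "(\<lambda>t. zz k (y V t) l) \<in> ord_at_0 0" if "l < m" for k V l
    using newton that ord_at_0_mono[of _ 1 0] by blast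
  have Fzz: "(\<lambda>t. F l (zz k (y V t)) - y V t l) \<in> ord_at_0 (Suc k)" if "l < m" for k V l
    using ord_at_0_cmult[of "\<lambda>t. y V t l - F l (zz k (y V t))" "Suc k" "-1"] newton that by simp
  \<comment> \<open>Applying \<open>G\<close> to the congruence between \<open>F(zz)\<close> and
    \<open>y\<close> returns \<open>zz\<close> on the left, since \<open>G\<close> is a left inverse
    of \<open>F\<close>.\<close>
  have zzG: "(\<lambda>t. zz k (y V t) l - G l (y V t)) \<in> ord_at_0 (Suc k)" if l: "l < m" for k V l
  proof -
    have "(\<lambda>t. G l (\<lambda>j. F j (zz k (y V t))) - G l (y V t)) \<in> ord_at_0 (Suc k)"
      by (rule polyfun_cong_ord_at_0[OF G(1)[OF l]]) (auto intro!: polyfun_ord_at_0[OF Fp] zz1 y0 Fzz)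
    thus ?thesis using G(2)[OF l] by simp
  qed
  \<comment> \<open>Both sides are polynomial in \<open>t\<close> along the line and agree to every
    order, hence agree; \<open>t = 1\<close> with \<open>V = w - c\<close> reaches an arbitrary
    point \<open>w\<close>.\<close>
  have FG: "F l (\<lambda>j. G j w) = w l" if l: "l < m" for l w
  proof -
    define V where "V k = w k - c k" for k
    have "(\<lambda>t. F l (\<lambda>j. G j (y V t)) - y V t l) \<in> ord_at_0 k" for k
    proof -
      have "(\<lambda>t. F l (zz k (y V t)) - F l (\<lambda>j. G j (y V t))) \<in> ord_at_0 (Suc k)"
        by (rule polyfun_cong_ord_at_0[OF Fp[OF l]]) (auto intro!: polyfun_ord_at_0[OF G(1)] zz1 y0 zzG)
      from ord_at_0_diff[OF Fzz[OF l, of k V] this]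
      have "(\<lambda>t. F l (\<lambda>j. G j (y V t)) - y V t l) \<in> ord_at_0 (Suc k)" by simp
      thus ?thesis by (rule ord_at_0_mono) simp
    qed
    hence "F l (\<lambda>j. G j (y V 1)) - y V 1 l = 0" by (rule ord_at_0_all_imp_zero)
    moreover have "y V 1 = w" by (auto simp: y_def V_def)
    ultimately show ?thesis by simp
  qed
  have "\<forall>l. \<exists>p D. l < m \<longrightarrow> (\<forall>V. degree (p V) \<le> D) \<and> (\<forall>V t. G l (y V t) = poly (p V) t)"
    using polyfun_along_line[OF G(1), of _ c] unfolding y_def[abs_def] by metis
  then obtain p D0 where p: "\<And>l V. l < m \<Longrightarrow> degree (p l V) \<le> D0 l" "\<And>l V t. l < m \<Longrightarrow> G l (y V t) = poly (p l V) t"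
    by metis
  \<comment> \<open>A common degree bound for all coordinates of \<open>G\<close> on all lines
    through \<open>P(0)\<close>. The iterate \<open>Z D\<close> agrees with \<open>G\<close> up to
    and including this degree.\<close>
  define D where "D = (\<Sum>l<m. D0 l)"
  have pD: "degree (p l V) \<le> D" if "l < m" for l V
    using p(1)[OF that, of V] member_le_sum[of l "{..<m}" D0] that unfolding D_def by auto
  \<comment> \<open>The homogeneous components must be taken in \<open>V = Y - P(0)\<close>:
    \<open>W\<close> is the iterate recentred at \<open>P(0)\<close>, \<open>T\<close> its part of
    degree at most \<open>D\<close>, and \<open>Q\<close> undoes the translation.\<close>
  define W where "W i = fsubst (shift N (\<lambda>j. fcoeff0 (P ! j))) (Z D ! i)" for i
  define T where "T i = fsum (map (\<lambda>j. fhom j (W i)) [0..<Suc D])" for i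
  define Q where "Q = map (\<lambda>i. fsubst (shift N (\<lambda>j. - fcoeff0 (P ! j))) (T i)) [0..<N]"
  have Wv: "fvars (W i) \<subseteq> {..<N}" if "i < N" for i
    unfolding W_def by (rule fvars_fsubst[OF free_shift free_poly_mapD[OF Z that]])
  have hv: "fvars (fhom j (W i)) \<subseteq> {..<N}" if "i < N" for i j
    using fvars_fhom Wv[OF that] by blast
  have Tv: "fvars (T i) \<subseteq> {..<N}" if "i < N" for i
    unfolding T_def by (rule fvars_fsum) (auto dest!: subsetD[OF hv[OF that]])
  have Q: "free_poly_map N Q"
    using fvars_fsubst[OF free_shift Tv] by (auto simp: free_poly_map_def Q_def)
  have QG: "ent n (fmap_eval n Q (tup n N w)) l = G l w" if l: "l < m" for l w
  proof -
    define V where "V k = w k - c k" for k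
    obtain i a b where i: "i < N" "a < n" "b < n" "l = (i * n + a) * n + b"
      using l unfolding m_def by (rule index_cases)
    have w: "fmap_eval n (shift N (\<lambda>j. - fcoeff0 (P ! j))) (tup n N w) = tup n N V"
      unfolding fmap_eval_shift by (rule arg_cong[of _ _ "tup n N"]) (auto simp: V_def c_def)
    have W: "feval n (tup n N (\<lambda>k. t * V k)) (W i) $$ (a, b) = zz D (y V t) l" for t
    proof -
      have "fmap_eval n (shift N (\<lambda>j. fcoeff0 (P ! j))) (tup n N (\<lambda>k. t * V k)) = tup n N (y V t)"
        unfolding fmap_eval_shift by (rule arg_cong[of _ _ "tup n N"]) (auto simp: y_def c_def)
      moreover have "feval n (tup n N (\<lambda>k. t * V k)) (W i)
        = feval n (fmap_eval n (shift N (\<lambda>j. fcoeff0 (P ! j))) (tup n N (\<lambda>k. t * V k))) (Z D ! i)"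
        unfolding W_def by (rule feval_fsubst) (use free_poly_mapD[OF Z i(1)] in \<open>simp add: shift_def\<close>)
      ultimately show ?thesis using zz_index[OF i(1-3)] i(4) by simp
    qed
    obtain q where q: "\<forall>j. coeff q j = feval n (tup n N V) (fhom j (W i)) $$ (a, b)"
      "\<forall>t. feval n (tup n N (\<lambda>k. t * V k)) (W i) $$ (a, b) = poly q t"
      using feval_fhom[OF Wv[OF i(1)] i(2,3)] by blast
    have "poly (q - p l V) \<in> ord_at_0 (Suc D)"
      using zzG[OF l, of D V] q(2) W p(2)[OF l] by (simp add: poly_diff[abs_def])
    hence qp: "coeff q j = coeff (p l V) j" if "j \<le> D" for j
      using ord_at_0_coeff[of "q - p l V" "Suc D" j] that by simp
    have "ent n (fmap_eval n Q (tup n N w)) l = feval n (tup n N w) (Q ! i) $$ (a, b)"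
      unfolding i(4) by (rule fmap_eval_index[OF Q i(1-3)])
    also have "feval n (tup n N w) (Q ! i) = feval n (tup n N V) (T i)"
      using feval_fsubst[of "T i" "shift N (\<lambda>j. - fcoeff0 (P ! j))" n "tup n N w"] Tv[OF i(1)] i(1) w
      by (simp add: Q_def shift_def)
    also have "\<dots> $$ (a, b) = (\<Sum>r\<leftarrow>map (\<lambda>j. fhom j (W i)) [0..<Suc D]. feval n (tup n N V) r $$ (a, b))"
      unfolding T_def by (rule feval_fsum[OF tup_in _ i(2,3)]) (auto dest!: subsetD[OF hv[OF i(1)]])
    also have "\<dots> = (\<Sum>j\<le>D. coeff q j)"
      using q(1) by (simp add: comp_def interv_sum_list_conv_sum_set_nat atLeast0LessThan lessThan_Suc_atMost del: upt_Suc)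
    also have "\<dots> = (\<Sum>j\<le>D. coeff (p l V) j)" by (rule sum.cong) (auto simp: qp)
    also have "\<dots> = poly (p l V) 1"
      unfolding poly_altdef using pD[OF l, of V] by (auto intro!: sum.mono_neutral_right le_degree)
    also have "\<dots> = G l (y V 1)" using p(2)[OF l] by simp
    also have "y V 1 = w" by (auto simp: y_def V_def)
    finally show ?thesis .
  qed
  have "fmap_eval n P (fmap_eval n Q Y) = Y" if Y: "Y \<in> mat_tuples n N" for Y
  proof (rule mat_tuples_eqI)
    have QY: "fmap_eval n Q Y \<in> mat_tuples n N" by (rule fmap_eval_in[OF Q Y])
    show "fmap_eval n P (fmap_eval n Q Y) \<in> mat_tuples n N" by (rule fmap_eval_in[OF P QY])
    fix l assume "l < N * n * n"
    hence l: "l < m" by (simp add: m_def)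
    have "ent n (fmap_eval n P (fmap_eval n Q Y)) l = F l (ent n (fmap_eval n Q Y))"
      unfolding F_def tup_ent[OF QY] ..
    also have "\<dots> = F l (\<lambda>j. G j (ent n Y))"
      by (rule polyfun_cong[OF Fp[OF l]]) (use QG[of _ "ent n Y"] tup_ent[OF Y] in simp)
    also have "\<dots> = ent n Y l" by (rule FG[OF l])
    finally show "ent n (fmap_eval n P (fmap_eval n Q Y)) l = ent n Y l" .
  qed (rule Y)
  thus ?thesis using Q by blast
qed

text \<open>A right inverse \<open>Q\<close> with values in the domain is \<open>P^-1\<close>,
  because \<open>P\<close> is injective at size \<open>n\<close>; surjectivity follows from
  it.\<close>

theorem theorem4:
  fixes N :: nat and P :: "fpoly list"
  assumes "free_poly_map N P"
    and inj: "\<forall>n\<ge>1. inj_on (fmap_eval n P) (mat_tuples n N)"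
  shows "(\<forall>n\<ge>1. fmap_eval n P ` mat_tuples n N = mat_tuples n N)
    \<and> (\<forall>n\<ge>1. \<exists>Q. free_poly_map N Q \<and>
          (\<forall>Y\<in>mat_tuples n N. fmap_eval n P (fmap_eval n Q Y) = Y
                 \<and> fmap_eval n Q Y \<in> mat_tuples n N))"
proof -
  have Q: "\<exists>Q. free_poly_map N Q \<and> (\<forall>Y\<in>mat_tuples n N. fmap_eval n P (fmap_eval n Q Y) = Y
      \<and> fmap_eval n Q Y \<in> mat_tuples n N)" if n: "n \<ge> 1" for n
    using free_inverse_at_size[OF assms(1) _ n] inj n fmap_eval_in by (metis trans_le_add1)
  have "fmap_eval n P ` mat_tuples n N = mat_tuples n N" if n: "n \<ge> 1" for n
  proof
    show "fmap_eval n P ` mat_tuples n N \<subseteq> mat_tuples n N" using fmap_eval_in[OF assms(1)] by blast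
    show "mat_tuples n N \<subseteq> fmap_eval n P ` mat_tuples n N" using Q[OF n] by (metis image_eqI subsetI)
  qed
  thus ?thesis using Q by blast
qed

end
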